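(* Consider $\mathfrak{Cont}$ with contact manifolds as objects and Legendrian correspondences as morphisms. Then the contact product $\bar\star:(Q_1,Q_2)\mapsto Q_1\star Q_2$ is a bifunctor from $\mathfrak{Cont}\times\mathfrak{Cont}$ to $\mathfrak{Cont}$; that is, with $\bar\star$ defined on morphisms by $\bar\star(R_{ab},R_{\alpha\beta}):=\sigma(R_{ab}\star R_{\alpha\beta})$, one has $$\bar\star(R_{bc},R_{\beta\gamma})\circ\bar\star(R_{ab},R_{\alpha\beta})=\bar\star(R_{bc}\circ R_{ab},\,R_{\beta\gamma}\circ R_{\alpha\beta})$$ for Legendrian correspondences $R_{ab}\subset\overline{Q}_a\star Q_b$, $R_{bc}\subset\overline{Q}_b\star Q_c$, $R_{\alpha\beta}\subset\overline{Q}_\alpha\star Q_\beta$, $R_{\beta\gamma}\subset\overline{Q}_\beta\star Q_\gamma$ for which the compositions are defined.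
   Context: For a contact manifold $(Q,\xi)$, $SQ=\{\beta\in T^*Q\setminus\{0\}\mid\beta|_\xi=0\}$, with $\theta$ the restriction of the Liouville one-form of $T^*Q$. $Q_1\star Q_2$ (resp. $\overline{Q}_1\star Q_2$) is $(SQ_1\times SQ_2)/\mathbb{R}_+$ (diagonal multiplication by positive reals) with contact structure the projection of $\ker(\theta_1\oplus\theta_2)$ (resp. $\ker(-\theta_1\oplus\theta_2)$). A Legendrian correspondence from $Q_1$ to $Q_2$ is an embedded Legendrian submanifold of $\overline{Q}_1\star Q_2$. Composition (only generically defined): given $R_{12}\subset\overline{Q}_1\star Q_2$, $R_{23}\subset\overline{Q}_2\star Q_3$ with preimages $L_{12}\subset SQ_1\times SQ_2$, $L_{23}\subset SQ_2\times SQ_3$, the pair is composable if $L_{12}\times L_{23}$ is transverse to $SQ_1\times\Delta_{SQ_2}\times SQ_3$; then the composition, written $R_{23}\circ R_{12}$ here, is the image in $\overline{Q}_1\star Q_3$ of $\{(\beta_1,\beta_2,\beta_2,\beta_3)\mid(\beta_1,\beta_2)\in L_{12},(\beta_2,\beta_3)\in L_{23}\}/\mathbb{R}_+$ under $[(\beta_1,\beta_2,\beta_2,\beta_3)]\mapsto[(\beta_1,\beta_3)]$. It is understood throughout that all pairs being composed are composable. Product: iterated contact products are identified with $\mathbb{R}_+$-quotients of products of symplectizations. $R_{ab}\star R_{\alpha\beta}=(L_{ab}\times L_{\alpha\beta})/\mathbb{R}_+\subset(SQ_a\times SQ_b\times SQ_\alpha\times SQ_\beta)/\mathbb{R}_+$,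 and $\sigma$ is the map induced by permuting factors to $(SQ_a\times SQ_\alpha\times SQ_b\times SQ_\beta)/\mathbb{R}_+$, regarded as $\overline{(Q_a\star Q_\alpha)}\star(Q_b\star Q_\beta)$ with contact structure induced by $\ker(-\theta_a-\theta_\alpha+\theta_b+\theta_\beta)$; thus $\sigma(R_{ab}\star R_{\alpha\beta})$ is a Legendrian correspondence from $Q_a\star Q_\alpha$ to $Q_b\star Q_\beta$. A bifunctor is a functor out of the product category; a functor is a map on objects and morphisms that respects composition. *)

theory Defs
  imports "HOL-Analysis.Analysis"
begin

section \<open>Smooth manifolds\<close>

primrec C_on :: "nat \<Rightarrow> 'e::euclidean_space set \<Rightarrow> ('e \<Rightarrow> 'f::real_normed_vector) \<Rightarrow> bool" where
  "C_on 0 S f = continuous_on S f"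
| "C_on (Suc k) S f =
     (f differentiable_on S \<and> (\<forall>h. C_on k S (\<lambda>u. frechet_derivative f (at u) h)))"

text \<open>Only used for open \<open>S\<close>.\<close>

definition smooth_on :: "'e::euclidean_space set \<Rightarrow> ('e \<Rightarrow> 'f::real_normed_vector) \<Rightarrow> bool" where
  "smooth_on S f \<longleftrightarrow> (\<forall>k. C_on k S f)"

text \<open>
  A manifold of dimension \<open>DIM('e)\<close> is given by an atlas of local parametrizations (inverses
  of charts) \<open>(V, x)\<close>, where \<open>x\<close> maps the open set \<open>V\<close> of the model space \<open>'e\<close> into \<open>'a\<close>.
  The underlying set and the topology are those determined by the atlas.
\<close>

type_synonym ('a, 'e) atlas = "('e set \<times> ('e \<Rightarrow> 'a)) set"

definition points :: "('a, 'e) atlas \<Rightarrow> 'a set" where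
  "points A = (\<Union>(V, x)\<in>A. x ` V)"

definition atlas_topology :: "('a, 'e::euclidean_space) atlas \<Rightarrow> 'a topology" where
  "atlas_topology A =
     topology (\<lambda>U. U \<subseteq> points A \<and> (\<forall>(V, x)\<in>A. open {u \<in> V. x u \<in> U}))"

lemma openin_atlas_topology:
  "openin (atlas_topology A) U \<longleftrightarrow> U \<subseteq> points A \<and> (\<forall>(V, x)\<in>A. open {u \<in> V. x u \<in> U})"
proof -
  let ?P = "\<lambda>U. U \<subseteq> points A \<and> (\<forall>(V, x)\<in>A. open {u \<in> V. x u \<in> U})"
  have "?P (S \<inter> T)" if S: "?P S" and T: "?P T" for S T
  proof -
    have "open {u \<in> V. x u \<in> S \<inter> T}" if "(V, x) \<in> A" for V x
    proof -
      have "open ({u \<in> V. x u \<in> S} \<inter> {u \<in> V. x u \<in> T})"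
        using S T that by (intro open_Int) (auto dest!: bspec)
      moreover have "{u \<in> V. x u \<in> S} \<inter> {u \<in> V. x u \<in> T} = {u \<in> V. x u \<in> S \<inter> T}" by auto
      ultimately show ?thesis by simp
    qed
    then show ?thesis using S by auto
  qed
  moreover have "?P (\<Union>K)" if K: "\<forall>S\<in>K. ?P S" for K
  proof -
    have "open {u \<in> V. x u \<in> \<Union>K}" if "(V, x) \<in> A" for V x
    proof -
      have "open (\<Union>S\<in>K. {u \<in> V. x u \<in> S})"
        using K that by (intro open_UN) (auto dest!: bspec)
      moreover have "(\<Union>S\<in>K. {u \<in> V. x u \<in> S}) = {u \<in> V. x u \<in> \<Union>K}" by auto
      ultimately show ?thesis by simp
    qed
    then show ?thesis using K by auto
  qed
  ultimately have "istopology ?P" unfolding istopology_def by blast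
  then show ?thesis by (simp add: atlas_topology_def topology_inverse')
qed

definition compatible ::
  "'e::euclidean_space set \<times> ('e \<Rightarrow> 'a) \<Rightarrow> 'e set \<times> ('e \<Rightarrow> 'a) \<Rightarrow> bool" where
  "compatible = (\<lambda>(V, x) (W, y).
     open {u \<in> V. x u \<in> y ` W} \<and> smooth_on {u \<in> V. x u \<in> y ` W} (inv_into W y \<circ> x) \<and>
     open {w \<in> W. y w \<in> x ` V} \<and> smooth_on {w \<in> W. y w \<in> x ` V} (inv_into V x \<circ> y))"

definition smooth_manifold :: "('a, 'e::euclidean_space) atlas \<Rightarrow> bool" where
  "smooth_manifold A \<longleftrightarrow>
     (\<forall>(V, x)\<in>A. open V \<and> inj_on x V) \<and>
     (\<forall>c\<in>A. \<forall>d\<in>A. compatible c d) \<and>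
     Hausdorff_space (atlas_topology A) \<and> second_countable (atlas_topology A)"

definition max_atlas :: "('a, 'e::euclidean_space) atlas \<Rightarrow> ('a, 'e) atlas" where
  "max_atlas A = {(V, x). open V \<and> inj_on x V \<and> x ` V \<subseteq> points A \<and> (\<forall>c\<in>A. compatible (V, x) c)}"

subsection \<open>Tangent vectors\<close>

text \<open>
  The tangent vector of a curve \<open>c\<close> at time \<open>0\<close> is the functional \<open>f \<mapsto> (f \<circ> c)'(0)\<close> on the real
  functions that are smooth near \<open>c 0\<close>; it is extended by \<open>0\<close> to all other functions, so that
  equality of tangent vectors is equality in HOL.  The vector space operations on a tangent
  space are the pointwise ones.
\<close>

type_synonym 'a tvec = "('a \<Rightarrow> real) \<Rightarrow> real"

definition smooth_at :: "('a, 'e::euclidean_space) atlas \<Rightarrow> 'a \<Rightarrow> ('a \<Rightarrow> real) \<Rightarrow> bool" where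
  "smooth_at A p f \<longleftrightarrow>
     (\<exists>(V, x)\<in>A. \<exists>W. open W \<and> W \<subseteq> V \<and> p \<in> x ` W \<and> smooth_on W (f \<circ> x))"

definition smooth_curve :: "('a, 'e::euclidean_space) atlas \<Rightarrow> (real \<Rightarrow> 'a) \<Rightarrow> bool" where
  "smooth_curve A c \<longleftrightarrow>
     (\<exists>(V, x)\<in>A. \<exists>e>0. \<exists>g. smooth_on {-e<..<e} g \<and> (\<forall>t\<in>{-e<..<e}. g t \<in> V \<and> c t = x (g t)))"

definition velocity :: "('a, 'e::euclidean_space) atlas \<Rightarrow> (real \<Rightarrow> 'a) \<Rightarrow> 'a tvec" where
  "velocity A c = (\<lambda>f. if smooth_at A (c 0) f then deriv (f \<circ> c) 0 else 0)"

text \<open>The tangent vectors at \<open>p\<close> of curves that stay in \<open>S\<close>; for an embedded submanifold \<open>S\<close> this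
  is its tangent space, as a subspace of the ambient tangent space.\<close>

definition tangent :: "('a, 'e::euclidean_space) atlas \<Rightarrow> 'a set \<Rightarrow> 'a \<Rightarrow> 'a tvec set" where
  "tangent A S p =
     {velocity A c | c. smooth_curve A c \<and> c 0 = p \<and> (\<forall>\<^sub>F t in nhds 0. c t \<in> S)}"

abbreviation tangent_space :: "('a, 'e::euclidean_space) atlas \<Rightarrow> 'a \<Rightarrow> 'a tvec set" where
  "tangent_space A p \<equiv> tangent A (points A) p"

text \<open>The tangent vector at \<open>x u\<close> with components \<open>h\<close> in the parametrization \<open>x\<close>.\<close>

definition coord_vec ::
  "('a, 'e::euclidean_space) atlas \<Rightarrow> ('e \<Rightarrow> 'a) \<Rightarrow> 'e \<Rightarrow> 'e \<Rightarrow> 'a tvec" where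
  "coord_vec A x u h = velocity A (\<lambda>t. x (u + t *\<^sub>R h))"

text \<open>The differential of \<open>F\<close>, applied to a vector \<open>v\<close> at a point over \<open>q\<close>; \<open>B\<close> is the target.\<close>

definition push :: "('b, 'f::euclidean_space) atlas \<Rightarrow> 'b \<Rightarrow> ('a \<Rightarrow> 'b) \<Rightarrow> 'a tvec \<Rightarrow> 'b tvec" where
  "push B q F v = (\<lambda>g. if smooth_at B q g then v (g \<circ> F) else 0)"

subsection \<open>Submanifolds, products, transversality\<close>

definition embedded_submanifold ::
  "('a, 'e::euclidean_space) atlas \<Rightarrow> nat \<Rightarrow> 'a set \<Rightarrow> bool" where
  "embedded_submanifold A k S \<longleftrightarrow> S \<subseteq> points A \<and>
     (\<forall>p\<in>S. \<exists>(V, x)\<in>max_atlas A. \<exists>W. subspace W \<and> dim W = k \<and>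
        p \<in> x ` V \<and> x ` (V \<inter> W) = S \<inter> x ` V)"

text \<open>The atlas that the slice charts of the ambient manifold induce on a submanifold \<open>S\<close> modelled
  on \<open>'f\<close>.\<close>

definition sub_atlas ::
  "('a, 'e::euclidean_space) atlas \<Rightarrow> 'a set \<Rightarrow> ('a, 'f::euclidean_space) atlas" where
  "sub_atlas A S =
     {(j -` V, x \<circ> j) | V x j. (V, x) \<in> max_atlas A \<and> linear j \<and> inj j \<and>
        x ` (V \<inter> range j) = S \<inter> x ` V}"

definition prod_atlas :: "('a, 'e) atlas \<Rightarrow> ('b, 'f) atlas \<Rightarrow> ('a \<times> 'b, 'e \<times> 'f) atlas" where
  "prod_atlas A B = {(V \<times> W, map_prod x y) | V x W y. (V, x) \<in> A \<and> (W, y) \<in> B}"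

definition transverse :: "('a, 'e::euclidean_space) atlas \<Rightarrow> 'a set \<Rightarrow> 'a set \<Rightarrow> bool" where
  "transverse A S T \<longleftrightarrow> (\<forall>p \<in> S \<inter> T. \<forall>v \<in> tangent_space A p.
     \<exists>v1 \<in> tangent A S p. \<exists>v2 \<in> tangent A T p. v = (\<lambda>f. v1 f + v2 f))"

section \<open>Contact manifolds\<close>

record ('a, 'e) contact =
  atlas :: "('a, 'e) atlas"
  hyperplane :: "'a \<Rightarrow> 'a tvec set"

text \<open>
  Locally \<open>\<xi> = ker \<alpha>\<close> for a nowhere vanishing 1-form \<open>\<alpha> = \<Sum> a\<^sub>b du\<^sub>b\<close> such that \<open>d\<alpha>\<close> is
  nondegenerate on \<open>ker \<alpha>\<close>.  In coordinates \<open>d\<alpha>(h, k) = (Da h) \<bullet> k - (Da k) \<bullet> h\<close>.  The hyperplane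
  field need not be coorientable.
\<close>

definition contact_manifold :: "('a, 'e::euclidean_space) contact \<Rightarrow> bool" where
  "contact_manifold Q \<longleftrightarrow>
     smooth_manifold (atlas Q) \<and> odd DIM('e) \<and>
     (\<forall>p \<in> points (atlas Q). \<exists>(V, x) \<in> max_atlas (atlas Q). p \<in> x ` V \<and>
        (\<exists>a :: 'e \<Rightarrow> 'e. smooth_on V a \<and> (\<forall>u\<in>V.
           a u \<noteq> 0 \<and>
           hyperplane Q (x u) = {coord_vec (atlas Q) x u h | h. a u \<bullet> h = 0} \<and>
           (\<forall>h. a u \<bullet> h = 0 \<and>
                (\<forall>k. a u \<bullet> k = 0 \<longrightarrow>
                   frechet_derivative a (at u) h \<bullet> k - frechet_derivative a (at u) k \<bullet> h = 0)
                \<longrightarrow> h = 0))))"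

definition legendrian :: "('a, 'e::euclidean_space) contact \<Rightarrow> 'a set \<Rightarrow> bool" where
  "legendrian Q R \<longleftrightarrow>
     (\<exists>k. DIM('e) = 2 * k + 1 \<and> embedded_submanifold (atlas Q) k R) \<and>
     (\<forall>p\<in>R. tangent (atlas Q) R p \<subseteq> hyperplane Q p)"

section \<open>Cotangent bundle and symplectization\<close>

text \<open>A covector at \<open>p\<close> is a linear functional on the tangent space at \<open>p\<close>, extended by \<open>0\<close>.\<close>

type_synonym 'a covec = "'a tvec \<Rightarrow> real"

definition cotangent_space :: "('a, 'e::euclidean_space) atlas \<Rightarrow> 'a \<Rightarrow> 'a covec set" where
  "cotangent_space A p =
     {\<beta>. (\<forall>v \<in> tangent_space A p. \<forall>w \<in> tangent_space A p. \<beta> (\<lambda>f. v f + w f) = \<beta> v + \<beta> w) \<and>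
         (\<forall>v \<in> tangent_space A p. \<forall>r. \<beta> (\<lambda>f. r * v f) = r * \<beta> v) \<and>
         (\<forall>v. v \<notin> tangent_space A p \<longrightarrow> \<beta> v = 0)}"

text \<open>The covector \<open>\<Sum> w\<^sub>b du\<^sub>b\<close> at \<open>x u\<close>.\<close>

definition coord_covec ::
  "('a, 'e::euclidean_space) atlas \<Rightarrow> ('e \<Rightarrow> 'a) \<Rightarrow> 'e \<Rightarrow> 'e \<Rightarrow> 'a covec" where
  "coord_covec A x u w =
     (\<lambda>v. if v \<in> tangent_space A (x u) then w \<bullet> (THE h. v = coord_vec A x u h) else 0)"

definition cotangent_bundle ::
  "('a, 'e::euclidean_space) atlas \<Rightarrow> ('a \<times> 'a covec, 'e \<times> 'e) atlas" where
  "cotangent_bundle A = {(V \<times> UNIV, \<lambda>(u, w). (x u, coord_covec A x u w)) | V x. (V, x) \<in> A}"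

definition liouville ::
  "('a, 'e::euclidean_space) atlas \<Rightarrow> 'a \<times> 'a covec \<Rightarrow> ('a \<times> 'a covec) tvec \<Rightarrow> real" where
  "liouville A = (\<lambda>(q, \<beta>) v. \<beta> (push A q fst v))"

definition symp_points :: "('a, 'e::euclidean_space) contact \<Rightarrow> ('a \<times> 'a covec) set" where
  "symp_points Q = {(q, \<beta>). q \<in> points (atlas Q) \<and> \<beta> \<in> cotangent_space (atlas Q) q \<and>
     \<beta> \<noteq> (\<lambda>v. 0) \<and> (\<forall>v \<in> hyperplane Q q. \<beta> v = 0)}"

text \<open>
  The common shape of symplectizations and their products: a manifold with an action of the
  positive reals and a 1-form.  The model space is \<open>'h \<times> real\<close>, so that the quotient by the
  action is modelled on \<open>'h\<close>.
\<close>

record ('s, 'h) cone =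
  cone_atlas :: "('s, 'h \<times> real) atlas"
  scale :: "real \<Rightarrow> 's \<Rightarrow> 's"
  form :: "'s \<Rightarrow> 's tvec \<Rightarrow> real"

definition symplectization :: "('a, 'e::euclidean_space) contact \<Rightarrow> ('a \<times> 'a covec, 'e) cone" where
  "symplectization Q = \<lparr>
     cone_atlas = sub_atlas (cotangent_bundle (atlas Q)) (symp_points Q),
     scale = (\<lambda>r (q, \<beta>). (q, \<lambda>v. r * \<beta> v)),
     form = (\<lambda>s v. liouville (atlas Q) s (push (cotangent_bundle (atlas Q)) s id v)) \<rparr>"

definition neg_cone :: "('s, 'h) cone \<Rightarrow> ('s, 'h) cone" where
  "neg_cone C = C\<lparr>form := (\<lambda>s v. - form C s v)\<rparr>"

text \<open>
  The product with the diagonal action and the 1-form \<open>\<theta>\<^sub>1 \<oplus> \<theta>\<^sub>2\<close>.  Its atlas is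
  \<open>prod_atlas (cone_atlas C) (cone_atlas D)\<close> up to the reordering of coordinates
  \<open>((h, k, r), s) \<mapsto> ((h, r), (k, s))\<close> of the model space.
\<close>

definition prod_cone ::
  "('s, 'h::euclidean_space) cone \<Rightarrow> ('t, 'k::euclidean_space) cone \<Rightarrow> ('s \<times> 't, 'h \<times> 'k \<times> real) cone" where
  "prod_cone C D = \<lparr>
     cone_atlas =
       (let j = (\<lambda>((h, k, r), s). ((h, r), (k, s)))
        in {(j -` V, x \<circ> j) | V x. (V, x) \<in> prod_atlas (cone_atlas C) (cone_atlas D)}),
     scale = (\<lambda>r. map_prod (scale C r) (scale D r)),
     form = (\<lambda>(s, t) v. form C s (push (cone_atlas C) s fst v) + form D t (push (cone_atlas D) t snd v)) \<rparr>"

section \<open>Quotients by the positive reals and the contact product\<close>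

definition orbit :: "('s, 'h) cone \<Rightarrow> 's \<Rightarrow> 's set" where
  "orbit C s = {scale C r s | r. r > 0}"

text \<open>
  The smooth structure on the quotient for which the projection is a principal bundle: its
  parametrizations are the projections of local sections \<open>s\<close> for which \<open>(u, r) \<mapsto> r \<cdot> s u\<close> is
  a parametrization of the total space.
\<close>

definition quotient_atlas :: "('s, 'h::euclidean_space) cone \<Rightarrow> ('s set, 'h) atlas" where
  "quotient_atlas C = {(V, \<lambda>u. orbit C (s u)) | V s.
     (V \<times> {0<..}, \<lambda>(u, r). scale C r (s u)) \<in> max_atlas (cone_atlas C)}"

definition contact_quotient :: "('s, 'h::euclidean_space) cone \<Rightarrow> ('s set, 'h) contact" where
  "contact_quotient C = \<lparr>
     atlas = quotient_atlas C,
     hyperplane = (\<lambda>P. {push (quotient_atlas C) P (orbit C) v | s v.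
        s \<in> points (cone_atlas C) \<and> orbit C s = P \<and>
        v \<in> tangent_space (cone_atlas C) s \<and> form C s v = 0}) \<rparr>"

definition contact_product ::
  "('a, 'e::euclidean_space) contact \<Rightarrow> ('b, 'f::euclidean_space) contact \<Rightarrow>
   ((('a \<times> 'a covec) \<times> ('b \<times> 'b covec)) set, 'e \<times> 'f \<times> real) contact" where
  "contact_product Q Q' = contact_quotient (prod_cone (symplectization Q) (symplectization Q'))"

section \<open>Legendrian correspondences\<close>

text \<open>
  The source and target of a correspondence are specified by cones: \<open>symplectization Q\<close> for a contact
  manifold \<open>Q\<close>, and \<open>prod_cone (symplectization Q) (symplectization Q')\<close> for the contact product of \<open>Q\<close> and \<open>Q'\<close>,
  since iterated contact products are taken to be quotients of products of symplectizations.
  (The full annihilator of the contact structure of \<open>contact_product Q Q'\<close> would instead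
  consist of two copies, \<open>\<plusminus>\<close>, of \<open>prod_cone (symplectization Q) (symplectization Q')\<close>.)
\<close>

definition corr_cone ::
  "('s, 'h::euclidean_space) cone \<Rightarrow> ('t, 'k::euclidean_space) cone \<Rightarrow> ('s \<times> 't, 'h \<times> 'k \<times> real) cone" where
  "corr_cone C D = prod_cone (neg_cone C) D"

definition legendrian_correspondence ::
  "('s, 'h::euclidean_space) cone \<Rightarrow> ('t, 'k::euclidean_space) cone \<Rightarrow> ('s \<times> 't) set set \<Rightarrow> bool" where
  "legendrian_correspondence C D R \<longleftrightarrow> legendrian (contact_quotient (corr_cone C D)) R"

definition preimage ::
  "('s, 'h::euclidean_space) cone \<Rightarrow> ('t, 'k::euclidean_space) cone \<Rightarrow> ('s \<times> 't) set set \<Rightarrow> ('s \<times> 't) set" where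
  "preimage C D R = {s \<in> points (cone_atlas (corr_cone C D)). orbit (corr_cone C D) s \<in> R}"

definition composable ::
  "('s, 'h::euclidean_space) cone \<Rightarrow> ('t, 'k::euclidean_space) cone \<Rightarrow> ('u, 'l::euclidean_space) cone \<Rightarrow>
   ('s \<times> 't) set set \<Rightarrow> ('t \<times> 'u) set set \<Rightarrow> bool" where
  "composable C1 C2 C3 R12 R23 \<longleftrightarrow>
     transverse
       (prod_atlas (prod_atlas (cone_atlas C1) (cone_atlas C2))
                   (prod_atlas (cone_atlas C2) (cone_atlas C3)))
       (preimage C1 C2 R12 \<times> preimage C2 C3 R23)
       {((b1, b2), (b2, b3)) | b1 b2 b3.
          b1 \<in> points (cone_atlas C1) \<and> b2 \<in> points (cone_atlas C2) \<and> b3 \<in> points (cone_atlas C3)}"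

text \<open>\<open>comp_corr C1 C2 C3 R12 R23\<close> is \<open>R\<^sub>2\<^sub>3 \<circ> R\<^sub>1\<^sub>2\<close>.\<close>

definition comp_corr ::
  "('s, 'h::euclidean_space) cone \<Rightarrow> ('t, 'k::euclidean_space) cone \<Rightarrow> ('u, 'l::euclidean_space) cone \<Rightarrow>
   ('s \<times> 't) set set \<Rightarrow> ('t \<times> 'u) set set \<Rightarrow> ('s \<times> 'u) set set" where
  "comp_corr C1 C2 C3 R12 R23 = {orbit (corr_cone C1 C3) (b1, b3) | b1 b2 b3.
     (b1, b2) \<in> preimage C1 C2 R12 \<and> (b2, b3) \<in> preimage C2 C3 R23}"

text \<open>The product of correspondences before and after permuting factors.  Points of a quotient are
  orbits, so the map induced on quotients by the permutation is its image map.\<close>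

definition product_corr ::
  "('s, 'h::euclidean_space) cone \<Rightarrow> ('t, 'k::euclidean_space) cone \<Rightarrow>
   ('u, 'l::euclidean_space) cone \<Rightarrow> ('v, 'm::euclidean_space) cone \<Rightarrow>
   ('s \<times> 't) set set \<Rightarrow> ('u \<times> 'v) set set \<Rightarrow> (('s \<times> 't) \<times> ('u \<times> 'v)) set set" where
  "product_corr Ca Cb C\<alpha> C\<beta> R R' =
     orbit (prod_cone (corr_cone Ca Cb) (corr_cone C\<alpha> C\<beta>)) ` (preimage Ca Cb R \<times> preimage C\<alpha> C\<beta> R')"

definition sigma :: "(('s \<times> 't) \<times> ('u \<times> 'v)) set \<Rightarrow> (('s \<times> 'u) \<times> ('t \<times> 'v)) set" where
  "sigma P = (\<lambda>((a, b), (\<alpha>, \<beta>)). ((a, \<alpha>), (b, \<beta>))) ` P"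

definition star ::
  "('s, 'h::euclidean_space) cone \<Rightarrow> ('t, 'k::euclidean_space) cone \<Rightarrow>
   ('u, 'l::euclidean_space) cone \<Rightarrow> ('v, 'm::euclidean_space) cone \<Rightarrow>
   ('s \<times> 't) set set \<Rightarrow> ('u \<times> 'v) set set \<Rightarrow> (('s \<times> 'u) \<times> ('t \<times> 'v)) set set" where
  "star Ca Cb C\<alpha> C\<beta> R R' = sigma ` product_corr Ca Cb C\<alpha> C\<beta> R R'"

end

theory Submission
  imports Defs
begin

text \<open>
  The idea is that a symplectization, and every product of symplectizations, looks the same
  locally: it is \<open>V \<times> R+\<close>, where the positive reals act on the second factor, with the 1-form
  \<open>r \<alpha>\<close> for a contact form \<open>\<alpha>\<close> on an open set \<open>V\<close> of a Euclidean space.  Call a cone that is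
  covered by countably many such equivariant charts a Liouville cone (\<open>liouville_cone\<close>).
  Symplectizations are Liouville cones: a contact form \<open>\<alpha>\<close> on a chart of \<open>Q\<close> gives two charts, one
  for the positive and one for the negative multiples of \<open>\<alpha>\<close>.  The class is closed under changing
  the sign of the 1-form, and under products: if \<open>\<sigma>\<close> and \<open>\<tau>\<close> are sections of two cones with contact
  forms \<open>\<alpha>\<close> and \<open>\<beta>\<close>, then \<open>(h, k, r) \<mapsto> (r \<cdot> \<sigma> h, \<tau> k)\<close> is a section of the product cone, and it pulls
  the 1-form back to \<open>r \<alpha> + \<beta>\<close>, which is again a contact form (\<open>contact_form_product\<close>).  The charts of
  a Liouville cone induce charts of its quotient in which the contact hyperplanes are \<open>ker \<alpha>\<close>.
  So contact products are contact manifolds as soon as they are Hausdorff, which follows by separating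
  orbits in the factors (\<open>Hausdorff_quotient_prod\<close>); and iterated products need no separate
  treatment.

  The product of two correspondences is controlled by one remark: since both factors are invariant
  under the positive reals, the orbit of \<open>((a, p), (b, q))\<close> lies in \<open>star R R'\<close> iff the orbit of
  \<open>(a, b)\<close> lies in \<open>R\<close> and the orbit of \<open>(p, q)\<close> lies in \<open>R'\<close> (\<open>mem_preimage_star_iff\<close>).  Hence
  the product correspondence is locally \<open>R \<times> R'\<close> times a ratio of scales: it is a submanifold of dimension
  \<open>k + l + 1\<close>, in a contact manifold of dimension \<open>2 (k + l + 1) + 1\<close>.  A curve in it
  projects to curves in \<open>R\<close> and \<open>R'\<close>, on which the two summands \<open>- \<theta>\<^sub>a + \<theta>\<^sub>b\<close> and
  \<open>- \<theta>\<^sub>p + \<theta>\<^sub>q\<close> of its 1-form vanish separately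
  (\<open>legendrian_correspondence_star\<close>).

  After a regrouping of factors, the pair of submanifolds whose transversality has to be shown is the
  product of the two pairs that are transverse by assumption, and a product of transverse pairs is
  transverse (\<open>composable_star\<close>).  The composition law itself concerns only points: the intermediate
  points \<open>b\<close> and \<open>q\<close> of the two factors can be chosen independently of each other, and invariance
  under scaling turns equalities of orbits into equalities of points (\<open>comp_corr_star\<close>).
\<close>

section \<open>Smooth maps between open sets\<close>

lemma C_on_cong:
  assumes "open S" "C_on k S f" "\<And>u. u \<in> S \<Longrightarrow> f u = g u"
  shows "C_on k S g"
  using assms(2,3)
proof (induction k arbitrary: f g)
  case 0
  then show ?case using continuous_on_cong[of S S f g] by auto
next
  case (Suc k)
  have D: "(g has_derivative frechet_derivative f (at u)) (at u)" if u: "u \<in> S" for u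
  proof (rule has_derivative_transform_within_open[OF _ assms(1) u])
    have "f differentiable (at u)"
      using Suc.prems(1) u assms(1) by (simp add: differentiable_on_eq_differentiable_at)
    then show "(f has_derivative frechet_derivative f (at u)) (at u)"
      by (simp add: frechet_derivative_works)
  qed (use Suc.prems(2) in auto)
  then have "g differentiable_on S"
    using assms(1) by (auto simp: differentiable_on_eq_differentiable_at differentiable_def)
  moreover have "C_on k S (\<lambda>u. frechet_derivative g (at u) h)" for h
  proof (rule Suc.IH[where f = "\<lambda>u. frechet_derivative f (at u) h"])
    show "C_on k S (\<lambda>u. frechet_derivative f (at u) h)" using Suc.prems(1) by simp
    show "frechet_derivative f (at u) h = frechet_derivative g (at u) h" if "u \<in> S" for u
      using frechet_derivative_at[OF D[OF that]] by simp
  qed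
  ultimately show ?case by simp
qed

text \<open>
  With an explicit formula \<open>D\<close> for the derivative, closure properties of \<open>C_on\<close> follow by induction
  from the differentiation rules.
\<close>

lemma C_on_SucI:
  assumes "open S" "\<And>u. u \<in> S \<Longrightarrow> (f has_derivative D u) (at u)" "\<And>h. C_on k S (\<lambda>u. D u h)"
  shows "C_on (Suc k) S f"
proof -
  have "f differentiable_on S"
    using assms(1,2) by (auto simp: differentiable_on_eq_differentiable_at differentiable_def)
  moreover have "C_on k S (\<lambda>u. frechet_derivative f (at u) h)" for h
    by (rule C_on_cong[OF assms(1) assms(3)[of h]])
       (simp add: frechet_derivative_at[OF assms(2), symmetric])
  ultimately show ?thesis by simp
qed

lemma C_on_has_derivative:
  assumes "open S" "C_on (Suc k) S f" "u \<in> S"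
  shows "(f has_derivative frechet_derivative f (at u)) (at u)"
  using assms by (simp add: differentiable_on_eq_differentiable_at frechet_derivative_works)

lemma C_on_SucD: "C_on (Suc k) S f \<Longrightarrow> C_on k S f"
  by (induction k arbitrary: f) (auto simp: differentiable_imp_continuous_on)

lemma C_on_subset: "C_on k S f \<Longrightarrow> T \<subseteq> S \<Longrightarrow> C_on k T f"
  by (induction k arbitrary: f) (auto intro: continuous_on_subset differentiable_on_subset)

text \<open>
  Differentiability of all orders is a local property; transition maps are only ever known locally.
\<close>

lemma C_on_local:
  assumes "\<And>u. u \<in> S \<Longrightarrow> \<exists>T. open T \<and> u \<in> T \<and> C_on k T f"
  shows "C_on k S f"
  using assms
proof (induction k arbitrary: f)
  case 0
  have "isCont f u" if "u \<in> S" for u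
    using 0[OF that] by (auto simp: continuous_on_eq_continuous_at)
  then show ?case by (simp add: continuous_at_imp_continuous_on)
next
  case (Suc k)
  have "f differentiable (at u)" if "u \<in> S" for u
    using Suc.prems[OF that] by (auto simp: differentiable_on_eq_differentiable_at)
  then have "f differentiable_on S"
    by (simp add: differentiable_at_imp_differentiable_on)
  moreover have "C_on k S (\<lambda>u. frechet_derivative f (at u) h)" for h
  proof (rule Suc.IH)
    show "\<exists>T. open T \<and> u \<in> T \<and> C_on k T (\<lambda>u. frechet_derivative f (at u) h)" if "u \<in> S" for u
      using Suc.prems[OF that] by auto
  qed
  ultimately show ?case by simp
qed

lemma C_on_const: "open S \<Longrightarrow> C_on k S (\<lambda>u. c)"
proof (induction k arbitrary: c)
  case (Suc k)
  show ?case
    by (rule C_on_SucI[OF Suc.prems, where D = "\<lambda>u h. 0"]) (simp_all add: Suc del: C_on.simps)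
qed simp

lemma C_on_linear:
  assumes "open S" "bounded_linear L"
  shows "C_on k S L"
proof (cases k)
  case 0
  then show ?thesis using assms by (simp add: linear_continuous_on)
next
  case (Suc m)
  show ?thesis unfolding Suc
    by (rule C_on_SucI[OF assms(1), where D = "\<lambda>u. L"])
       (simp_all add: assms bounded_linear_imp_has_derivative C_on_const del: C_on.simps)
qed

lemma C_on_add:
  "open S \<Longrightarrow> C_on k S f \<Longrightarrow> C_on k S g \<Longrightarrow> C_on k S (\<lambda>u. f u + g u)"
proof (induction k arbitrary: f g)
  case (Suc k)
  show ?case
  proof (rule C_on_SucI[OF Suc.prems(1)])
    show "((\<lambda>u. f u + g u) has_derivative
        (\<lambda>h. frechet_derivative f (at u) h + frechet_derivative g (at u) h)) (at u)" if "u \<in> S" for u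
      by (rule has_derivative_add[OF C_on_has_derivative[OF Suc.prems(1,2) that]
            C_on_has_derivative[OF Suc.prems(1,3) that]])
    show "C_on k S (\<lambda>u. frechet_derivative f (at u) h + frechet_derivative g (at u) h)" for h
      using Suc.prems by (intro Suc.IH) auto
  qed
qed (auto intro: continuous_intros)

lemma C_on_sum:
  assumes "open S" "\<And>i. i \<in> I \<Longrightarrow> C_on k S (f i)"
  shows "C_on k S (\<lambda>u. \<Sum>i\<in>I. f i u)"
proof (cases "finite I")
  case True
  then show ?thesis using assms(2)
    by induction (auto simp: assms(1) C_on_const C_on_add)
qed (simp add: assms(1) C_on_const)

lemma C_on_bilinear:
  assumes "bounded_bilinear p" "open S"
  shows "C_on k S f \<Longrightarrow> C_on k S g \<Longrightarrow> C_on k S (\<lambda>u. p (f u) (g u))"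
proof (induction k arbitrary: f g)
  case 0
  then show ?case by (simp add: bounded_bilinear.continuous_on[OF assms(1)])
next
  case (Suc k)
  show ?case
  proof (rule C_on_SucI[OF assms(2)])
    show "((\<lambda>u. p (f u) (g u)) has_derivative
        (\<lambda>h. p (f u) (frechet_derivative g (at u) h) + p (frechet_derivative f (at u) h) (g u))) (at u)"
      if "u \<in> S" for u
      by (rule bounded_bilinear.FDERIV[OF assms(1) C_on_has_derivative[OF assms(2) Suc.prems(1) that]
            C_on_has_derivative[OF assms(2) Suc.prems(2) that]])
    show "C_on k S (\<lambda>u. p (f u) (frechet_derivative g (at u) h) + p (frechet_derivative f (at u) h)
      (g u))"
      for h
      using Suc.prems
      by (intro C_on_add assms(2) Suc.IH C_on_SucD[OF Suc.prems(1)] C_on_SucD[OF Suc.prems(2)]) auto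
  qed
qed

text \<open>
  The chain rule gives \<open>D(g \<circ> f) u h = \<Sum>b. (Df u h \<bullet> b) Dg (f u) b\<close>.  Expanding in a basis
  leaves the directional derivatives of \<open>g\<close> in the fixed directions \<open>b\<close>, to which the
  induction hypothesis applies.
\<close>

lemma C_on_compose:
  fixes f :: "'e::euclidean_space \<Rightarrow> 'f::euclidean_space" and g :: "'f \<Rightarrow> 'g::real_normed_vector"
  assumes "open S" "open T" "f ` S \<subseteq> T"
  shows "C_on k S f \<Longrightarrow> C_on k T g \<Longrightarrow> C_on k S (\<lambda>u. g (f u))"
proof (induction k arbitrary: g)
  case 0
  then show ?case using assms(3) by (auto intro: continuous_on_compose2)
next
  case (Suc k)
  have Dg: "(g has_derivative frechet_derivative g (at (f u))) (at (f u))" if "u \<in> S" for u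
    using that assms(3) by (intro C_on_has_derivative[OF assms(2) Suc.prems(2)]) auto
  show ?case
  proof (rule C_on_SucI[OF assms(1), where D = "\<lambda>u h. \<Sum>b\<in>Basis.
      (frechet_derivative f (at u) h \<bullet> b) *\<^sub>R frechet_derivative g (at (f u)) b"])
    fix u assume u: "u \<in> S"
    have L: "linear (frechet_derivative g (at (f u)))" by (rule has_derivative_linear[OF Dg[OF u]])
    have expand: "frechet_derivative g (at (f u)) w
        = (\<Sum>b\<in>Basis. (w \<bullet> b) *\<^sub>R frechet_derivative g (at (f u)) b)" for w
    proof -
      have "frechet_derivative g (at (f u)) (\<Sum>b\<in>Basis. (w \<bullet> b) *\<^sub>R b)
          = (\<Sum>b\<in>Basis. (w \<bullet> b) *\<^sub>R frechet_derivative g (at (f u)) b)"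
        by (simp add: linear_sum[OF L] linear_scale[OF L])
      then show ?thesis by (simp add: euclidean_representation)
    qed
    show "((\<lambda>u. g (f u)) has_derivative
        (\<lambda>h. \<Sum>b\<in>Basis. (frechet_derivative f (at u) h \<bullet> b) *\<^sub>R frechet_derivative g (at (f u))
          b)) (at u)"
      using has_derivative_compose[OF C_on_has_derivative[OF assms(1) Suc.prems(1) u] Dg[OF u]]
      by (subst (asm) expand)
  next
    fix h
    have "C_on k S (\<lambda>u. frechet_derivative g (at (f u)) b)" for b
      using Suc.prems by (intro Suc.IH[where g = "\<lambda>v. frechet_derivative g (at v) b"]
          C_on_SucD[OF Suc.prems(1)]) auto
    moreover have "C_on k S (\<lambda>u. frechet_derivative f (at u) h \<bullet> b)" for b
      using Suc.prems by (intro C_on_bilinear[OF bounded_bilinear_inner] C_on_const assms(1)) auto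
    ultimately show "C_on k S
        (\<lambda>u. \<Sum>b\<in>Basis. (frechet_derivative f (at u) h \<bullet> b) *\<^sub>R frechet_derivative g (at (f u)) b)"
      by (intro C_on_sum assms(1) C_on_bilinear[OF bounded_bilinear_scaleR])
  qed
qed

lemma C_on_inverse:
  fixes f :: "'e::euclidean_space \<Rightarrow> real"
  assumes "open S" "\<And>u. u \<in> S \<Longrightarrow> f u \<noteq> 0"
  shows "C_on k S f \<Longrightarrow> C_on k S (\<lambda>u. inverse (f u))"
proof (induction k)
  case 0
  then show ?case using assms(2) by (auto intro: continuous_on_inverse)
next
  case (Suc k)
  show ?case
  proof (rule C_on_SucI[OF assms(1)])
    show "((\<lambda>u. inverse (f u)) has_derivative
        (\<lambda>h. - 1 * (inverse (f u) * frechet_derivative f (at u) h * inverse (f u)))) (at u)"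
      if "u \<in> S" for u
      using Deriv.has_derivative_inverse[OF assms(2)[OF that]
        C_on_has_derivative[OF assms(1) Suc.prems that]]
      by simp
    show "C_on k S (\<lambda>u. - 1 * (inverse (f u) * frechet_derivative f (at u) h * inverse (f u)))" for h
      using Suc by (intro C_on_bilinear[OF bounded_bilinear_mult] C_on_const assms(1) Suc.IH
          C_on_SucD[OF Suc.prems]) auto
  qed
qed

lemma smooth_on_cong:
  "open S \<Longrightarrow> smooth_on S f \<Longrightarrow> (\<And>u. u \<in> S \<Longrightarrow> f u = g u) \<Longrightarrow> smooth_on S g"
  unfolding smooth_on_def using C_on_cong by blast

lemma smooth_on_subset: "smooth_on S f \<Longrightarrow> T \<subseteq> S \<Longrightarrow> smooth_on T f"
  unfolding smooth_on_def using C_on_subset by blast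

lemma smooth_on_local:
  assumes "\<And>u. u \<in> S \<Longrightarrow> \<exists>T. open T \<and> u \<in> T \<and> smooth_on T f"
  shows "smooth_on S f"
  using assms unfolding smooth_on_def by (meson C_on_local)

lemma smooth_on_continuous: "smooth_on S f \<Longrightarrow> continuous_on S f"
  unfolding smooth_on_def using C_on.simps(1) by blast

lemma smooth_on_has_derivative:
  "open S \<Longrightarrow> smooth_on S f \<Longrightarrow> u \<in> S \<Longrightarrow> (f has_derivative frechet_derivative f (at u)) (at u)"
  unfolding smooth_on_def by (meson C_on_has_derivative)

lemma smooth_on_const: "open S \<Longrightarrow> smooth_on S (\<lambda>u. c)"
  by (simp add: smooth_on_def C_on_const)

lemma smooth_on_add: "open S \<Longrightarrow> smooth_on S f \<Longrightarrow> smooth_on S g \<Longrightarrow> smooth_on S (\<lambda>u. f u + g u)"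
  by (simp add: smooth_on_def C_on_add)

lemma smooth_on_sum:
  "open S \<Longrightarrow> (\<And>i. i \<in> I \<Longrightarrow> smooth_on S (f i)) \<Longrightarrow> smooth_on S (\<lambda>u. \<Sum>i\<in>I. f i u)"
  by (simp add: smooth_on_def C_on_sum)

lemma smooth_on_bilinear:
  "bounded_bilinear p \<Longrightarrow> open S \<Longrightarrow> smooth_on S f \<Longrightarrow> smooth_on S g \<Longrightarrow> smooth_on S (\<lambda>u. p (f u) (g u))"
  by (simp add: smooth_on_def C_on_bilinear)

lemmas smooth_on_scaleR = smooth_on_bilinear[OF bounded_bilinear_scaleR]
lemmas smooth_on_mult = smooth_on_bilinear[OF bounded_bilinear_mult]
lemmas smooth_on_inner = smooth_on_bilinear[OF bounded_bilinear_inner]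

lemma smooth_on_compose:
  fixes f :: "'e::euclidean_space \<Rightarrow> 'f::euclidean_space"
  assumes "open S" "open T" "smooth_on S f" "smooth_on T g" "\<And>u. u \<in> S \<Longrightarrow> f u \<in> T"
  shows "smooth_on S (\<lambda>u. g (f u))"
proof -
  have "f ` S \<subseteq> T" using assms(5) by auto
  then show ?thesis
    unfolding smooth_on_def
    using C_on_compose[OF assms(1,2)] assms(3,4)[unfolded smooth_on_def] by blast
qed

lemma smooth_on_linear: "open S \<Longrightarrow> linear L \<Longrightarrow> smooth_on S L"
  for L :: "'e::euclidean_space \<Rightarrow> 'f::real_normed_vector"
  by (simp add: smooth_on_def C_on_linear linear_conv_bounded_linear)

lemma smooth_on_linear_compose:
  fixes f :: "'e::euclidean_space \<Rightarrow> 'f::euclidean_space"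
  shows "linear L \<Longrightarrow> open S \<Longrightarrow> smooth_on S f \<Longrightarrow> smooth_on S (\<lambda>u. L (f u))"
  by (rule smooth_on_compose[where T = UNIV]) (auto simp: smooth_on_linear)

lemma smooth_on_id: "open S \<Longrightarrow> smooth_on S (\<lambda>u. u)"
  by (rule smooth_on_linear) (auto simp: linear_iff)

lemma smooth_on_fst: "open S \<Longrightarrow> smooth_on S f \<Longrightarrow> smooth_on S (\<lambda>u. fst (f u))"
  for f :: "'e::euclidean_space \<Rightarrow> 'f::euclidean_space \<times> 'g::euclidean_space"
  by (rule smooth_on_linear_compose[OF linear_fst])

lemma smooth_on_snd: "open S \<Longrightarrow> smooth_on S f \<Longrightarrow> smooth_on S (\<lambda>u. snd (f u))"
  for f :: "'e::euclidean_space \<Rightarrow> 'f::euclidean_space \<times> 'g::euclidean_space"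
  by (rule smooth_on_linear_compose[OF linear_snd])

lemma smooth_on_Pair:
  fixes f :: "'e::euclidean_space \<Rightarrow> 'f::euclidean_space" and g :: "'e \<Rightarrow> 'g::euclidean_space"
  assumes "open S" "smooth_on S f" "smooth_on S g"
  shows "smooth_on S (\<lambda>u. (f u, g u))"
proof -
  have "smooth_on S (\<lambda>u. (f u, 0) + (0, g u))"
    by (intro smooth_on_add smooth_on_linear_compose[where L = "\<lambda>v. (v, 0)"]
        smooth_on_linear_compose[where L = "\<lambda>v. (0, v)"] assms) (auto simp: linear_iff)
  then show ?thesis by simp
qed

lemma smooth_on_inverse:
  fixes f :: "'e::euclidean_space \<Rightarrow> real"
  shows "open S \<Longrightarrow> smooth_on S f \<Longrightarrow> (\<And>u. u \<in> S \<Longrightarrow> f u \<noteq> 0) \<Longrightarrow> smooth_on S (\<lambda>u. inverse (f u))"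
  by (simp add: smooth_on_def C_on_inverse)

lemma smooth_on_divide:
  fixes f g :: "'e::euclidean_space \<Rightarrow> real"
  shows "open S \<Longrightarrow> smooth_on S f \<Longrightarrow> smooth_on S g \<Longrightarrow> (\<And>u. u \<in> S \<Longrightarrow> g u \<noteq> 0) \<Longrightarrow>
    smooth_on S (\<lambda>u. f u / g u)"
  by (simp add: divide_inverse smooth_on_mult smooth_on_inverse)

lemma smooth_on_uminus: "open S \<Longrightarrow> smooth_on S f \<Longrightarrow> smooth_on S (\<lambda>u. - f u)"
  using smooth_on_scaleR[OF _ smooth_on_const, of S f "- 1"] by simp

lemma smooth_on_diff: "open S \<Longrightarrow> smooth_on S f \<Longrightarrow> smooth_on S g \<Longrightarrow> smooth_on S (\<lambda>u. f u - g u)"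
  using smooth_on_add[OF _ _ smooth_on_uminus, of S f g] by simp

lemma smooth_on_frechet_derivative: "smooth_on S f \<Longrightarrow> smooth_on S (\<lambda>u. frechet_derivative f (at u) h)"
  unfolding smooth_on_def by (metis C_on.simps(2))

lemmas smooth_intros = smooth_on_const smooth_on_id smooth_on_add smooth_on_diff smooth_on_uminus
  smooth_on_sum smooth_on_scaleR smooth_on_mult smooth_on_inner smooth_on_fst smooth_on_snd
  smooth_on_Pair smooth_on_inverse smooth_on_divide

lemma open_preimage_smooth:
  "open S \<Longrightarrow> smooth_on S f \<Longrightarrow> open T \<Longrightarrow> open {u \<in> S. f u \<in> T}"
  using continuous_open_preimage[OF smooth_on_continuous, of S f T]
  by (simp add: vimage_def Int_def)

section \<open>Atlases\<close>

text \<open>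
  The differentiable structure of a manifold alone.  Cotangent bundles and quotients have it for
  formal reasons; the topology of a quotient is a separate matter that takes real arguments.
\<close>

definition diff_atlas :: "('a, 'e::euclidean_space) atlas \<Rightarrow> bool" where
  "diff_atlas A \<longleftrightarrow> (\<forall>(V, x)\<in>A. open V \<and> inj_on x V) \<and> (\<forall>c\<in>A. \<forall>d\<in>A. compatible c d)"

text \<open>
  Smoothness of the transition map from \<open>x\<close> to \<open>y\<close> near \<open>u\<close>, with the transition map given as
  a local lift \<open>\<phi>\<close> of \<open>x\<close> through \<open>y\<close> in place of \<open>inv_into W y \<circ> x\<close>: such lifts compose and form
  products without any choice of inverses.
\<close>

definition change_at ::
  "'e::euclidean_space set \<Rightarrow> ('e \<Rightarrow> 'a) \<Rightarrow> 'f::euclidean_space set \<Rightarrow> ('f \<Rightarrow> 'a) \<Rightarrow> 'e \<Rightarrow> bool" where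
  "change_at V x W y u \<longleftrightarrow> (\<exists>T \<phi>. open T \<and> u \<in> T \<and> T \<subseteq> V \<and> smooth_on T \<phi> \<and>
     (\<forall>t\<in>T. \<phi> t \<in> W \<and> x t = y (\<phi> t)))"

lemma change_atI:
  "open T \<Longrightarrow> u \<in> T \<Longrightarrow> T \<subseteq> V \<Longrightarrow> smooth_on T \<phi> \<Longrightarrow>
   (\<And>t. t \<in> T \<Longrightarrow> \<phi> t \<in> W) \<Longrightarrow> (\<And>t. t \<in> T \<Longrightarrow> x t = y (\<phi> t)) \<Longrightarrow> change_at V x W y u"
  unfolding change_at_def by blast

lemma change_at_trans:
  assumes "change_at V x W y u" "change_at W y U z w" "inj_on y W" "w \<in> W" "x u = y w"
  shows "change_at V x U z u"
proof -
  obtain T \<phi> where T: "open T" "u \<in> T" "T \<subseteq> V" "smooth_on T \<phi>" "\<And>t. t \<in> T \<Longrightarrow> \<phi> t \<in> W"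
    "\<And>t. t \<in> T \<Longrightarrow> x t = y (\<phi> t)"
    using assms(1) unfolding change_at_def by blast
  obtain S \<psi> where S: "open S" "w \<in> S" "S \<subseteq> W" "smooth_on S \<psi>" "\<And>t. t \<in> S \<Longrightarrow> \<psi> t \<in> U"
    "\<And>t. t \<in> S \<Longrightarrow> y t = z (\<psi> t)"
    using assms(2) unfolding change_at_def by blast
  let ?N = "{t \<in> T. \<phi> t \<in> S}"
  have "open ?N" by (rule open_preimage_smooth[OF T(1,4) S(1)])
  moreover have "\<phi> u = w"
    using assms(3,4,5) T(2,5,6) by (metis inj_onD)
  moreover have "smooth_on ?N (\<lambda>t. \<psi> (\<phi> t))"
    by (rule smooth_on_compose[OF \<open>open ?N\<close> S(1) _ S(4)]) (auto intro: smooth_on_subset[OF T(4)])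
  ultimately show ?thesis
    using T S by (intro change_atI[where T = ?N and \<phi> = "\<lambda>t. \<psi> (\<phi> t)"]) auto
qed

lemma change_at_imp:
  assumes "inj_on y W" "\<And>u. u \<in> V \<Longrightarrow> x u \<in> y ` W \<Longrightarrow> change_at V x W y u"
  shows "open {u \<in> V. x u \<in> y ` W}" "smooth_on {u \<in> V. x u \<in> y ` W} (inv_into W y \<circ> x)"
proof -
  have *: "\<exists>T. open T \<and> u \<in> T \<and> T \<subseteq> {u \<in> V. x u \<in> y ` W} \<and> smooth_on T (inv_into W y \<circ> x)"
    if u: "u \<in> V" "x u \<in> y ` W" for u
  proof -
    obtain T \<phi> where T: "open T" "u \<in> T" "T \<subseteq> V" "smooth_on T \<phi>" "\<And>t. t \<in> T \<Longrightarrow> \<phi> t \<in> W"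
      "\<And>t. t \<in> T \<Longrightarrow> x t = y (\<phi> t)"
      using assms(2)[OF u] unfolding change_at_def by blast
    have "smooth_on T (inv_into W y \<circ> x)"
      by (rule smooth_on_cong[OF T(1,4)]) (simp add: T(5,6) assms(1))
    then show ?thesis using T by blast
  qed
  show "open {u \<in> V. x u \<in> y ` W}" by (subst open_subopen) (use * in blast)
  show "smooth_on {u \<in> V. x u \<in> y ` W} (inv_into W y \<circ> x)"
    by (rule smooth_on_local) (use * in blast)
qed

lemma compatible_iff:
  assumes "inj_on x V" "inj_on y W"
  shows "compatible (V, x) (W, y) \<longleftrightarrow>
    (\<forall>u\<in>V. x u \<in> y ` W \<longrightarrow> change_at V x W y u) \<and> (\<forall>w\<in>W. y w \<in> x ` V \<longrightarrow> change_at W y V x w)"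
proof
  have *: "change_at V x W y u"
    if "open {u \<in> V. x u \<in> y ` W}" "smooth_on {u \<in> V. x u \<in> y ` W} (inv_into W y \<circ> x)"
      "u \<in> V" "x u \<in> y ` W"
    for V x W y and u
    by (rule change_atI[OF that(1) _ _ that(2)])
       (use that(3,4) in \<open>auto simp: f_inv_into_f inv_into_into\<close>)
  assume "compatible (V, x) (W, y)"
  then show "(\<forall>u\<in>V. x u \<in> y ` W \<longrightarrow> change_at V x W y u) \<and>
      (\<forall>w\<in>W. y w \<in> x ` V \<longrightarrow> change_at W y V x w)"
    unfolding compatible_def by (auto intro!: *)
next
  assume "(\<forall>u\<in>V. x u \<in> y ` W \<longrightarrow> change_at V x W y u) \<and>
      (\<forall>w\<in>W. y w \<in> x ` V \<longrightarrow> change_at W y V x w)"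
  then show "compatible (V, x) (W, y)"
    using change_at_imp[OF assms(2), of V x] change_at_imp[OF assms(1), of W y]
    by (simp add: compatible_def)
qed

lemma diff_atlasI:
  assumes "\<And>V x. (V, x) \<in> A \<Longrightarrow> open V" "\<And>V x. (V, x) \<in> A \<Longrightarrow> inj_on x V"
    "\<And>V x W y u w. (V, x) \<in> A \<Longrightarrow> (W, y) \<in> A \<Longrightarrow> u \<in> V \<Longrightarrow> w \<in> W \<Longrightarrow> x u = y w \<Longrightarrow>
       change_at V x W y u"
  shows "diff_atlas A"
proof -
  have "compatible (V, x) (W, y)" if "(V, x) \<in> A" "(W, y) \<in> A" for V x W y
    unfolding compatible_iff[OF assms(2)[OF that(1)] assms(2)[OF that(2)]]
    by (auto intro!: assms(3)[OF that] assms(3)[OF that(2,1)])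
  then show ?thesis using assms(1,2) unfolding diff_atlas_def by auto
qed

lemma smooth_manifold_diff_atlas: "smooth_manifold A \<Longrightarrow> diff_atlas A"
  by (auto simp: smooth_manifold_def diff_atlas_def)

lemma max_atlasD:
  assumes "(V, x) \<in> max_atlas A"
  shows "open V" "inj_on x V" "x ` V \<subseteq> points A"
  using assms by (auto simp: max_atlas_def)

lemma pointsE:
  assumes "p \<in> points A"
  obtains V x u where "(V, x) \<in> A" "u \<in> V" "p = x u"
  using assms by (auto simp: points_def)

lemma max_atlas_pointE:
  assumes "(V, x) \<in> max_atlas A" "u \<in> V"
  obtains W y w where "(W, y) \<in> A" "w \<in> W" "x u = y w"
proof -
  have "x u \<in> points A" using max_atlasD(3)[OF assms(1)] assms(2) by auto
  then show thesis by (rule pointsE) (rule that)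
qed

lemma max_atlas_change_atlas:
  assumes "diff_atlas A" "(V, x) \<in> max_atlas A" "(W, y) \<in> A" "u \<in> V" "w \<in> W" "x u = y w"
  shows "change_at V x W y u" "change_at W y V x w"
proof -
  have "inj_on x V" "inj_on y W" "compatible (V, x) (W, y)"
    using assms(1,2,3) by (auto simp: max_atlas_def diff_atlas_def)
  then show "change_at V x W y u" "change_at W y V x w"
    using assms(4-6) compatible_iff[of x V y W]
    by (metis imageI)+
qed

lemma atlas_subset_max_atlas: "diff_atlas A \<Longrightarrow> A \<subseteq> max_atlas A"
  unfolding diff_atlas_def max_atlas_def points_def by blast

text \<open>
  Both charts are compatible with every chart of \<open>A\<close>, so a chart of \<open>A\<close> around the common point
  mediates between them.
\<close>

lemma max_atlas_change:
  assumes "diff_atlas A" "(V, x) \<in> max_atlas A" "(W, y) \<in> max_atlas A" "u \<in> V" "w \<in> W" "x u = y w"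
  shows "change_at V x W y u"
proof -
  obtain U z v where z: "(U, z) \<in> A" "v \<in> U" "x u = z v"
    using max_atlas_pointE[OF assms(2,4)] .
  have "inj_on z U" using assms(1) z(1) by (auto simp: diff_atlas_def)
  show ?thesis
    by (rule change_at_trans[OF max_atlas_change_atlas(1)[OF assms(1,2) z(1) assms(4) z(2,3)]
          max_atlas_change_atlas(2)[OF assms(1,3) z(1) assms(5) z(2)] \<open>inj_on z U\<close> z(2,3)])
       (use assms(6) z(3) in simp)
qed

text \<open>
  The way in which atlases of products, relabelled manifolds and cotangent bundles are treated: the
  construction that turns charts of \<open>A\<close> into charts of the new atlas \<open>B\<close> is applied to all of
  \<open>max_atlas A\<close>, and coherence of the larger family \<open>\<Gamma>\<close> shows at once that \<open>B\<close> is an atlas and that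
  the new charts belong to its maximal atlas.
\<close>

lemma coherent_charts:
  assumes "B \<subseteq> \<Gamma>" "\<And>V x. (V, x) \<in> \<Gamma> \<Longrightarrow> open V \<and> inj_on x V \<and> x ` V \<subseteq> points B"
    and change: "\<And>V x W y u w. (V, x) \<in> \<Gamma> \<Longrightarrow> (W, y) \<in> \<Gamma> \<Longrightarrow> u \<in> V \<Longrightarrow> w \<in> W \<Longrightarrow> x u = y w \<Longrightarrow>
       change_at V x W y u"
  shows "diff_atlas B \<and> \<Gamma> \<subseteq> max_atlas B"
proof -
  have comp: "compatible (V, x) (W, y)" if *: "(V, x) \<in> \<Gamma>" "(W, y) \<in> \<Gamma>" for V x W y
  proof -
    have inj: "inj_on x V" "inj_on y W" using assms(2) * by auto
    show ?thesis unfolding compatible_iff[OF inj] by (auto intro!: change[OF *] change[OF *(2,1)])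
  qed
  have "diff_atlas B"
    unfolding diff_atlas_def using comp assms(2) subsetD[OF assms(1)]
      by (metis (no_types, lifting) case_prodI2 surj_pair)
  moreover have "(V, x) \<in> max_atlas B" if V: "(V, x) \<in> \<Gamma>" for V x
    using comp[OF V] assms(2)[OF V] subsetD[OF assms(1)]
      by (auto simp only: max_atlas_def mem_Collect_eq prod.case)
  ultimately show ?thesis by auto
qed

lemma max_atlasI:
  assumes A: "diff_atlas A" and "open V" "inj_on x V"
    and loc: "\<And>u. u \<in> V \<Longrightarrow> \<exists>W y w. (W, y) \<in> max_atlas A \<and> w \<in> W \<and> x u = y w \<and>
      change_at V x W y u \<and> change_at W y V x w"
  shows "(V, x) \<in> max_atlas A"
proof -
  have "x ` V \<subseteq> points A" using loc max_atlasD(3) by fast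
  moreover have "compatible (V, x) (U, z)" if z: "(U, z) \<in> A" for U z
  proof -
    have zm: "(U, z) \<in> max_atlas A" using z atlas_subset_max_atlas[OF A] by auto
    have "change_at V x U z u \<and> change_at U z V x v"
      if u: "u \<in> V" "v \<in> U" "x u = z v" for u v
    proof -
      obtain W y w where y: "(W, y) \<in> max_atlas A" "w \<in> W" "x u = y w"
        "change_at V x W y u" "change_at W y V x w"
        using loc[OF u(1)] by blast
      have "z v = y w" "y w = z v" using u y by auto
      then show ?thesis
        using change_at_trans[OF y(4) max_atlas_change[OF A y(1) zm y(2) u(2)] max_atlasD(2)[OF y(1)]
          y(2,3)]
          change_at_trans[OF max_atlas_change[OF A zm y(1) u(2) y(2)] y(5) max_atlasD(2)[OF y(1)] y(2)]
        by blast
    qed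
    then show ?thesis
      unfolding compatible_iff[OF assms(3) max_atlasD(2)[OF zm]] by (metis imageE)
  qed
  ultimately show ?thesis using assms by (auto simp: max_atlas_def)
qed

text \<open>
  Precomposition with a diffeomorphism \<open>\<Psi>\<close> onto an open part \<open>U'\<close> of the domain.  The map \<open>y\<close> is
  specified only on \<open>U\<close>, because charts arising in practice agree with \<open>x \<circ> \<Psi>\<close> only there.
\<close>

lemma max_atlas_reparametrize:
  assumes A: "diff_atlas A" and x: "(V, x) \<in> max_atlas A"
    and "open U" "open U'" "U' \<subseteq> V" "smooth_on U \<Psi>" "smooth_on U' \<Theta>"
    and \<Psi>: "\<And>u. u \<in> U \<Longrightarrow> \<Psi> u \<in> U' \<and> \<Theta> (\<Psi> u) = u"
    and \<Theta>: "\<And>v. v \<in> U' \<Longrightarrow> \<Theta> v \<in> U \<and> \<Psi> (\<Theta> v) = v"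
    and y: "\<And>u. u \<in> U \<Longrightarrow> y u = x (\<Psi> u)"
  shows "(U, y) \<in> max_atlas A"
proof (rule max_atlasI[OF A \<open>open U\<close>])
  show "inj_on y U"
    by (rule inj_on_inverseI[where g = "\<lambda>p. \<Theta> (inv_into V x p)"])
       (use \<Psi> y max_atlasD(2)[OF x] \<open>U' \<subseteq> V\<close> in \<open>auto simp: subset_iff\<close>)
  fix u assume u: "u \<in> U"
  have "change_at U y V x u"
    by (rule change_atI[OF \<open>open U\<close> u _ \<open>smooth_on U \<Psi>\<close>]) (use \<Psi> \<open>U' \<subseteq> V\<close> y in auto)
  moreover have "change_at V x U y (\<Psi> u)"
    by (rule change_atI[OF \<open>open U'\<close> _ \<open>U' \<subseteq> V\<close> \<open>smooth_on U' \<Theta>\<close>]) (use u \<Psi> \<Theta> y in auto)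
  moreover have "\<Psi> u \<in> V" using \<Psi> u \<open>U' \<subseteq> V\<close> by blast
  ultimately show "\<exists>W z w. (W, z) \<in> max_atlas A \<and> w \<in> W \<and> y u = z w \<and>
      change_at U y W z u \<and> change_at W z U y w"
    using x y[OF u] by blast
qed

lemma max_atlas_restrict:
  assumes "diff_atlas A" "(V, x) \<in> max_atlas A" "open U" "U \<subseteq> V"
  shows "(U, x) \<in> max_atlas A"
  by (rule max_atlas_reparametrize[OF assms(1,2,3,3,4), where \<Psi> = "\<lambda>u. u" and \<Theta> = "\<lambda>u. u"])
     (use assms in \<open>auto intro: smooth_on_id\<close>)

lemma topspace_atlas_topology:
  assumes "diff_atlas A"
  shows "topspace (atlas_topology A) = points A"
proof -
  have "openin (atlas_topology A) (points A)"
  proof -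
    have "{u \<in> V. x u \<in> points A} = V" if "(V, x) \<in> A" for V x
      using that by (auto simp: points_def)
    then show ?thesis using assms by (auto simp: openin_atlas_topology diff_atlas_def)
  qed
  then show ?thesis
    by (meson openin_atlas_topology openin_subset openin_topspace subset_antisym)
qed

lemma open_chart_preimage:
  assumes "diff_atlas A" "(V, x) \<in> max_atlas A" "openin (atlas_topology A) U"
  shows "open {u \<in> V. x u \<in> U}"
proof (subst open_subopen, clarify)
  fix u assume u: "u \<in> V" "x u \<in> U"
  obtain W y w where y: "(W, y) \<in> A" "w \<in> W" "x u = y w"
    using max_atlas_pointE[OF assms(2) u(1)] .
  obtain T \<phi> where T: "open T" "u \<in> T" "T \<subseteq> V" "smooth_on T \<phi>" "\<And>t. t \<in> T \<Longrightarrow> \<phi> t \<in> W"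
      "\<And>t. t \<in> T \<Longrightarrow> x t = y (\<phi> t)"
    using max_atlas_change_atlas(1)[OF assms(1,2) y(1) u(1) y(2,3)] unfolding change_at_def by blast
  have "open {v \<in> W. y v \<in> U}" using assms(3) y(1) by (auto simp: openin_atlas_topology)
  then have "open {t \<in> T. \<phi> t \<in> {v \<in> W. y v \<in> U}}"
    by (rule open_preimage_smooth[OF T(1,4)])
  moreover have "{t \<in> T. \<phi> t \<in> {v \<in> W. y v \<in> U}} \<subseteq> {u \<in> V. x u \<in> U}"
    using T(3,6) by auto
  moreover have "u \<in> {t \<in> T. \<phi> t \<in> {v \<in> W. y v \<in> U}}"
    using T u by auto
  ultimately show "\<exists>T. open T \<and> u \<in> T \<and> T \<subseteq> {u \<in> V. x u \<in> U}" by blast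
qed

lemma openin_chart_image:
  assumes "diff_atlas A" "(V, x) \<in> max_atlas A"
  shows "openin (atlas_topology A) (x ` V)"
proof -
  have "open {w \<in> W. y w \<in> x ` V}" if y: "(W, y) \<in> A" for W y
    by (rule change_at_imp(1)[OF max_atlasD(2)[OF assms(2)]])
       (use max_atlas_change_atlas(2)[OF assms y] in auto)
  then show ?thesis using max_atlasD(3)[OF assms(2)] by (auto simp: openin_atlas_topology)
qed

text \<open>
  Openness may be tested in one chart around each point, which can be chosen to suit the set.
\<close>

lemma openin_atlas_topologyI:
  assumes "diff_atlas A"
    and "\<And>p. p \<in> U \<Longrightarrow> \<exists>V x. (V, x) \<in> max_atlas A \<and> p \<in> x ` V \<and> open {u \<in> V. x u \<in> U}"
  shows "openin (atlas_topology A) U"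
proof (subst openin_subopen, intro ballI)
  fix p assume p: "p \<in> U"
  obtain V x where x: "(V, x) \<in> max_atlas A" "p \<in> x ` V" "open {u \<in> V. x u \<in> U}"
    using assms(2)[OF p] by blast
  have "({u \<in> V. x u \<in> U}, x) \<in> max_atlas A"
    by (rule max_atlas_restrict[OF assms(1) x(1,3)]) auto
  then have "openin (atlas_topology A) (x ` {u \<in> V. x u \<in> U})"
    by (rule openin_chart_image[OF assms(1)])
  then show "\<exists>T. openin (atlas_topology A) T \<and> p \<in> T \<and> T \<subseteq> U"
    using x(2) p by (intro exI[of _ "x ` {u \<in> V. x u \<in> U}"]) auto
qed

abbreviation separated :: "'a topology \<Rightarrow> 'a \<Rightarrow> 'a \<Rightarrow> bool" where
  "separated X p q \<equiv> \<exists>P Q. openin X P \<and> openin X Q \<and> p \<in> P \<and> q \<in> Q \<and> disjnt P Q"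

lemma separate_in_chart:
  assumes A: "diff_atlas A" and x: "(V, x) \<in> max_atlas A" and "u \<in> V" "v \<in> V" "u \<noteq> v"
  shows "separated (atlas_topology A) (x u) (x v)"
proof -
  obtain S T where S: "open S" "open T" "u \<in> S" "v \<in> T" "S \<inter> T = {}"
    using hausdorff[OF \<open>u \<noteq> v\<close>] by blast
  have V: "open V" "inj_on x V" using max_atlasD[OF x] by auto
  have "(V \<inter> S, x) \<in> max_atlas A" "(V \<inter> T, x) \<in> max_atlas A"
    by (rule max_atlas_restrict[OF A x]; use V S in auto)+
  then have "openin (atlas_topology A) (x ` (V \<inter> S))" "openin (atlas_topology A) (x ` (V \<inter> T))"
    using openin_chart_image[OF A] by auto
  moreover have "disjnt (x ` (V \<inter> S)) (x ` (V \<inter> T))"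
    using V(2) S(5) by (fastforce simp: disjnt_def dest: inj_onD)
  ultimately show ?thesis using S assms(3,4) by blast
qed

lemma second_countable_atlas_topology:
  fixes A :: "('a, 'e::euclidean_space) atlas"
  assumes A: "diff_atlas A" and K: "countable K" "K \<subseteq> max_atlas A" "points A \<subseteq> (\<Union>(V, x)\<in>K. x ` V)"
  shows "second_countable (atlas_topology A)"
proof -
  obtain B :: "'e set set" where B: "countable B" "topological_basis B"
    using ex_countable_basis by blast
  define \<B> where "\<B> = (\<lambda>((V, x), b). x ` (V \<inter> b)) ` (K \<times> B)"
  have "countable \<B>" unfolding \<B>_def using K(1) B(1) by (intro countable_image countable_SIGMA) auto
  moreover have "openin (atlas_topology A) P" if P: "P \<in> \<B>" for P
  proof -
    obtain V x b where b: "(V, x) \<in> K" "b \<in> B" "P = x ` (V \<inter> b)" using P by (auto simp: \<B>_def)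
    have x: "(V, x) \<in> max_atlas A" using b K(2) by auto
    have "(V \<inter> b, x) \<in> max_atlas A"
      by (rule max_atlas_restrict[OF A x])
         (use max_atlasD(1)[OF x] topological_basis_open[OF B(2) b(2)] in auto)
    then show ?thesis using openin_chart_image[OF A] b(3) by auto
  qed
  moreover have "\<exists>P\<in>\<B>. p \<in> P \<and> P \<subseteq> U" if U: "openin (atlas_topology A) U" "p \<in> U" for U p
  proof -
    have "p \<in> points A" using U by (auto simp: openin_atlas_topology)
    then obtain V x u where x: "(V, x) \<in> K" "u \<in> V" "p = x u" using K(3) by auto
    have "open {u \<in> V. x u \<in> U}" using open_chart_preimage[OF A _ U(1)] x(1) K(2) by auto
    then obtain b where b: "b \<in> B" "u \<in> b" "b \<subseteq> {u \<in> V. x u \<in> U}"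
      using topological_basisE[OF B(2)] x U(2) by (metis (mono_tags, lifting) mem_Collect_eq)
    have "x ` (V \<inter> b) \<in> \<B>" unfolding \<B>_def using x(1) b(1) by force
    then show ?thesis using x b by (intro bexI[of _ "x ` (V \<inter> b)"]) auto
  qed
  ultimately show ?thesis unfolding second_countable_def by blast
qed

text \<open>
  The Lindeloef property, for a family of charts that carry additional data: \<open>chart\<close> extracts
  the parametrization from an element of the family.
\<close>

lemma countable_chart_cover:
  assumes A: "diff_atlas A" and sc: "second_countable (atlas_topology A)"
    and cov: "\<And>p. p \<in> points A \<Longrightarrow> \<exists>c\<in>F. chart c \<in> max_atlas A \<and> p \<in> snd (chart c) ` fst (chart c)"
  shows "\<exists>K. countable K \<and> K \<subseteq> F \<and> (\<forall>c\<in>K. chart c \<in> max_atlas A) \<and>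
    points A \<subseteq> (\<Union>c\<in>K. snd (chart c) ` fst (chart c))"
proof -
  obtain \<B> where \<B>: "countable \<B>" "\<And>P. P \<in> \<B> \<Longrightarrow> openin (atlas_topology A) P"
    "\<And>U p. openin (atlas_topology A) U \<Longrightarrow> p \<in> U \<Longrightarrow> \<exists>P\<in>\<B>. p \<in> P \<and> P \<subseteq> U"
    using sc unfolding second_countable_def by meson
  let ?Q = "\<lambda>P c. c \<in> F \<and> chart c \<in> max_atlas A \<and> P \<subseteq> snd (chart c) ` fst (chart c)"
  define K where "K = (\<lambda>P. SOME c. ?Q P c) ` {P \<in> \<B>. \<exists>c. ?Q P c}"
  have Q: "?Q P (SOME c. ?Q P c)" if "\<exists>c. ?Q P c" for P
    using someI_ex[OF that] by blast
  have "countable K" unfolding K_def using \<B>(1) by auto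
  moreover have "K \<subseteq> F" "\<forall>c\<in>K. chart c \<in> max_atlas A" unfolding K_def using Q by blast+
  moreover have "p \<in> (\<Union>c\<in>K. snd (chart c) ` fst (chart c))" if p: "p \<in> points A" for p
  proof -
    obtain c where c: "c \<in> F" "chart c \<in> max_atlas A" "p \<in> snd (chart c) ` fst (chart c)"
      using cov[OF p] by blast
    obtain P where P: "P \<in> \<B>" "p \<in> P" "P \<subseteq> snd (chart c) ` fst (chart c)"
      using \<B>(3)[OF _ c(3)] openin_chart_image[OF A, of "fst (chart c)" "snd (chart c)"] c(2) by auto
    have ex: "\<exists>c. ?Q P c" using c P by blast
    then have "(SOME c. ?Q P c) \<in> K" unfolding K_def using P(1) by blast
    then show ?thesis using Q[OF ex] P(2) by blast
  qed
  ultimately have "countable K \<and> K \<subseteq> F \<and> (\<forall>c\<in>K. chart c \<in> max_atlas A) \<and>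
      points A \<subseteq> (\<Union>c\<in>K. snd (chart c) ` fst (chart c))"
    by (simp add: subset_iff)
  then show ?thesis by (rule exI)
qed

section \<open>Tangent vectors in coordinates\<close>

lemma smooth_at_iff:
  fixes A :: "('a, 'e::euclidean_space) atlas"
  assumes A: "diff_atlas A" and x: "(V, x) \<in> max_atlas A" and u: "u \<in> V"
  shows "smooth_at A (x u) f \<longleftrightarrow> (\<exists>T. open T \<and> u \<in> T \<and> T \<subseteq> V \<and> smooth_on T (f \<circ> x))"
proof -
  have transfer: "\<exists>T. open T \<and> u \<in> T \<and> T \<subseteq> V \<and> smooth_on T (f \<circ> x)"
    if c: "change_at V x W y u" and y: "inj_on y W" "x u = y w" "open T" "w \<in> T" "T \<subseteq> W"
      "smooth_on T (f \<circ> y)"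
    for V u W w T and x y :: "'e \<Rightarrow> 'a"
  proof -
    obtain S \<phi> where S: "open S" "u \<in> S" "S \<subseteq> V" "smooth_on S \<phi>" "\<And>t. t \<in> S \<Longrightarrow> \<phi> t \<in> W"
      "\<And>t. t \<in> S \<Longrightarrow> x t = y (\<phi> t)"
      using c unfolding change_at_def by blast
    let ?N = "{t \<in> S. \<phi> t \<in> T}"
    have N: "open ?N" by (rule open_preimage_smooth[OF S(1,4) y(3)])
    have "\<phi> u = w" using inj_onD[OF y(1), of "\<phi> u" w] S(2,5,6) y by auto
    moreover have "smooth_on ?N (\<lambda>t. (f \<circ> y) (\<phi> t))"
      by (rule smooth_on_compose[OF N y(3) _ y(6)]) (auto intro: smooth_on_subset[OF S(4)])
    then have "smooth_on ?N (f \<circ> x)"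
      by (rule smooth_on_cong[OF N]) (auto simp: S(6))
    ultimately show ?thesis using S y(4) N by (intro exI[of _ ?N]) auto
  qed
  show ?thesis
  proof
    assume "smooth_at A (x u) f"
    then obtain W y T where y: "(W, y) \<in> A" "open T" "T \<subseteq> W" "x u \<in> y ` T" "smooth_on T (f \<circ> y)"
      unfolding smooth_at_def by blast
    then obtain w where w: "w \<in> T" "x u = y w" by blast
    have "inj_on y W" using A y(1) by (auto simp: diff_atlas_def)
    then show "\<exists>T. open T \<and> u \<in> T \<and> T \<subseteq> V \<and> smooth_on T (f \<circ> x)"
      using transfer[OF max_atlas_change_atlas(1)[OF A x y(1) u _ w(2)] _ w(2) y(2) w(1)
        y(3,5)] w(1) y(3)
      by blast
  next
    assume "\<exists>T. open T \<and> u \<in> T \<and> T \<subseteq> V \<and> smooth_on T (f \<circ> x)"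
    then obtain T where T: "open T" "u \<in> T" "T \<subseteq> V" "smooth_on T (f \<circ> x)" by blast
    obtain W y w where y: "(W, y) \<in> A" "w \<in> W" "x u = y w"
      using max_atlas_pointE[OF x u] .
    obtain S where S: "open S" "w \<in> S" "S \<subseteq> W" "smooth_on S (f \<circ> y)"
      using transfer[OF max_atlas_change_atlas(2)[OF A x y(1) u y(2,3)] max_atlasD(2)[OF x]
        y(3)[symmetric]
          T] by blast
    then show "smooth_at A (x u) f" unfolding smooth_at_def using y by blast
  qed
qed

text \<open>
  The chain rule.  It identifies the velocity of \<open>x \<circ> g\<close> with the derivative of \<open>g\<close>, even when
  \<open>g\<close> is only differentiable at \<open>0\<close>.
\<close>

lemma velocity_in_chart:
  assumes A: "diff_atlas A" and x: "(V, x) \<in> max_atlas A" and u: "g 0 \<in> V"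
    and g: "(g has_vector_derivative h) (at 0)" and c: "\<forall>\<^sub>F t in nhds 0. c t = x (g t)"
  shows "velocity A c =
    (\<lambda>f. if smooth_at A (x (g 0)) f then frechet_derivative (f \<circ> x) (at (g 0)) h else 0)"
proof
  fix f
  have c0: "c 0 = x (g 0)" using c by (rule eventually_nhds_x_imp_x)
  show "velocity A c f = (if smooth_at A (x (g 0)) f then frechet_derivative (f \<circ> x) (at (g 0)) h else
    0)"
  proof (cases "smooth_at A (x (g 0)) f")
    case True
    then obtain T where T: "open T" "g 0 \<in> T" "T \<subseteq> V" "smooth_on T (f \<circ> x)"
      using smooth_at_iff[OF A x u] by blast
    let ?D = "frechet_derivative (f \<circ> x) (at (g 0))"
    have D: "(f \<circ> x has_derivative ?D) (at (g 0))"
      by (rule smooth_on_has_derivative[OF T(1,4,2)])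
    have "((\<lambda>t. (f \<circ> x) (g t)) has_derivative (\<lambda>t. ?D (t *\<^sub>R h))) (at 0)"
      by (rule has_derivative_compose[OF g[unfolded has_vector_derivative_def] D])
    moreover have "(\<lambda>t. ?D (t *\<^sub>R h)) = (*) (?D h)"
      using linear_scale[OF has_derivative_linear[OF D]] by (auto simp: fun_eq_iff mult.commute)
    ultimately have "((\<lambda>t. (f \<circ> x) (g t)) has_field_derivative ?D h) (at 0)"
      by (simp add: has_field_derivative_def)
    moreover have "\<forall>\<^sub>F t in nhds 0. (f \<circ> c) t = (f \<circ> x) (g t)"
      using c by eventually_elim simp
    ultimately have "((f \<circ> c) has_field_derivative ?D h) (at 0)"
      using DERIV_cong_ev[OF refl, of "f \<circ> c" "\<lambda>t. (f \<circ> x) (g t)" 0 "?D h" "?D h"] by simp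
    then show ?thesis using True c0 by (simp add: velocity_def DERIV_imp_deriv)
  next
    case False
    then show ?thesis by (simp add: velocity_def c0)
  qed
qed

lemma coord_vec_eq:
  assumes "diff_atlas A" "(V, x) \<in> max_atlas A" "u \<in> V"
  shows "coord_vec A x u h =
    (\<lambda>f. if smooth_at A (x u) f then frechet_derivative (f \<circ> x) (at u) h else 0)"
proof -
  have "((\<lambda>t. u + t *\<^sub>R h) has_vector_derivative h) (at 0)"
    by (auto intro!: derivative_eq_intros simp: has_vector_derivative_def)
  from velocity_in_chart[OF assms(1,2) _ this, of "\<lambda>t. x (u + t *\<^sub>R h)"]
  have "velocity A (\<lambda>t. x (u + t *\<^sub>R h)) = (\<lambda>f. if smooth_at A (x (u + 0 *\<^sub>R h)) f
      then frechet_derivative (f \<circ> x) (at (u + 0 *\<^sub>R h)) h else 0)"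
    using assms(3) by simp
  moreover have "u + 0 *\<^sub>R h = u" by simp
  ultimately
  show ?thesis by (simp only: coord_vec_def)
qed

lemma velocity_eq_coord_vec:
  assumes "diff_atlas A" "(V, x) \<in> max_atlas A" "g 0 \<in> V"
    "(g has_vector_derivative h) (at 0)" "\<forall>\<^sub>F t in nhds 0. c t = x (g t)"
  shows "velocity A c = coord_vec A x (g 0) h"
  by (simp add: velocity_in_chart[OF assms] coord_vec_eq[OF assms(1-3)])

lemma
  assumes A: "diff_atlas A" "(V, x) \<in> max_atlas A" "u \<in> V"
  shows coord_vec_add: "coord_vec A x u (h + k) = (\<lambda>f. coord_vec A x u h f + coord_vec A x u k f)"
    and coord_vec_scale: "coord_vec A x u (r *\<^sub>R h) = (\<lambda>f. r * coord_vec A x u h f)"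
proof -
  have L: "linear (frechet_derivative (f \<circ> x) (at u))" if f: "smooth_at A (x u) f" for f
  proof -
    obtain T where T: "open T" "u \<in> T" "smooth_on T (f \<circ> x)"
      using f smooth_at_iff[OF A] by blast
    show ?thesis by (rule has_derivative_linear[OF smooth_on_has_derivative[OF T(1,3,2)]])
  qed
  show "coord_vec A x u (h + k) = (\<lambda>f. coord_vec A x u h f + coord_vec A x u k f)"
    by (auto simp: coord_vec_eq[OF A] linear_add[OF L])
  show "coord_vec A x u (r *\<^sub>R h) = (\<lambda>f. r * coord_vec A x u h f)"
    by (auto simp: coord_vec_eq[OF A] linear_scale[OF L])
qed

text \<open>
  The coordinate functions of the chart are smooth near \<open>x u\<close>, and the tangent vector evaluates to
  the components of \<open>h\<close> on them.
\<close>

lemma coord_vec_inject: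
  fixes A :: "('a, 'e::euclidean_space) atlas"
  assumes A: "diff_atlas A" "(V, x) \<in> max_atlas A"
    "u \<in> V" and eq: "coord_vec A x u h = coord_vec A x u k"
  shows "h = k"
proof (rule euclidean_eqI)
  fix b :: 'e assume "b \<in> Basis"
  define f where "f p = inv_into V x p \<bullet> b" for p
  have V: "open V" "inj_on x V" using max_atlasD[OF A(2)] by auto
  have fx: "(f \<circ> x) v = v \<bullet> b" if "v \<in> V" for v
    using that V(2) by (simp add: f_def)
  have "smooth_on V (\<lambda>v. v \<bullet> b)" using V(1) by (intro smooth_intros)
  then have "smooth_on V (f \<circ> x)"
    by (rule smooth_on_cong[OF V(1)]) (simp only: fx)
  then have "smooth_at A (x u) f" using smooth_at_iff[OF A] V(1) A(3) by blast
  moreover have "((\<lambda>v. v \<bullet> b) has_derivative (\<lambda>v. v \<bullet> b)) (at u)"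
    by (auto intro!: derivative_eq_intros)
  then have "((f \<circ> x) has_derivative (\<lambda>v. v \<bullet> b)) (at u)"
    by (rule has_derivative_transform_within_open[OF _ V(1) A(3)]) (simp only: fx)
  then have "frechet_derivative (f \<circ> x) (at u) = (\<lambda>v. v \<bullet> b)"
    by (rule frechet_derivative_at[symmetric])
  ultimately have "coord_vec A x u h f = h \<bullet> b" "coord_vec A x u k f = k \<bullet> b"
    by (auto simp: coord_vec_eq[OF A])
  then show "h \<bullet> b = k \<bullet> b" using eq by simp
qed

lemma smooth_curve_in_chart:
  assumes A: "diff_atlas A" and x: "(V, x) \<in> max_atlas A" and u: "u \<in> V"
    and c: "smooth_curve A c" "c 0 = x u"
  shows "\<exists>e g. e > 0 \<and> smooth_on {-e<..<e} g \<and> g 0 = u \<and>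
    (\<forall>t\<in>{-e<..<e}. g t \<in> V \<and> c t = x (g t))"
proof -
  obtain W y d g where y: "(W, y) \<in> A" "d > 0" "smooth_on {-d<..<d} g"
    "\<And>t. t \<in> {-d<..<d} \<Longrightarrow> g t \<in> W" "\<And>t. t \<in> {-d<..<d} \<Longrightarrow> c t = y (g t)"
    using c(1) unfolding smooth_curve_def by blast
  have g0: "g 0 \<in> W" "y (g 0) = x u" using y(2) y(4)[of 0] y(5)[of 0] c(2) by auto
  obtain T \<phi> where T: "open T" "g 0 \<in> T" "T \<subseteq> W" "smooth_on T \<phi>" "\<And>t. t \<in> T \<Longrightarrow> \<phi> t \<in> V"
      "\<And>t. t \<in> T \<Longrightarrow> y t = x (\<phi> t)"
    using max_atlas_change_atlas(2)[OF A x y(1) u g0(1) g0(2)[symmetric]] unfolding change_at_def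
      by blast
  have "open {t \<in> {-d<..<d}. g t \<in> T}" by (rule open_preimage_smooth[OF _ y(3) T(1)]) auto
  moreover have "0 \<in> {t \<in> {-d<..<d}. g t \<in> T}" using y(2) T(2) by auto
  ultimately obtain e where e: "e > 0" "ball 0 e \<subseteq> {t \<in> {-d<..<d}. g t \<in> T}"
    by (meson open_contains_ball)
  have be: "ball 0 e = {-e<..<e}" by (auto simp: dist_real_def)
  have sub: "t \<in> {-d<..<d} \<and> g t \<in> T" if "t \<in> {-e<..<e}" for t
    using that e(2) unfolding be by blast
  have "smooth_on {-e<..<e} (\<lambda>t. \<phi> (g t))"
    by (rule smooth_on_compose[OF _ T(1) smooth_on_subset[OF y(3)] T(4)]) (use sub in auto)
  moreover have "\<phi> (g 0) = u"
    by (rule inj_onD[OF max_atlasD(2)[OF x]]) (use T(2,5,6) g0 u in auto)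
  moreover have "\<forall>t\<in>{-e<..<e}. \<phi> (g t) \<in> V \<and> c t = x (\<phi> (g t))"
    using T(5,6) sub y(5) by auto
  ultimately show ?thesis using e(1) by blast
qed

lemma smooth_curveI:
  assumes A: "diff_atlas A" and x: "(V, x) \<in> max_atlas A"
    and e: "e > 0" and g: "smooth_on {-e<..<e} g"
    "\<And>t. t \<in> {-e<..<e} \<Longrightarrow> g t \<in> V" "\<And>t. t \<in> {-e<..<e} \<Longrightarrow> c t = x (g t)"
  shows "smooth_curve A c"
proof -
  have g0: "g 0 \<in> V" using e g(2) by auto
  obtain W y w where y: "(W, y) \<in> A" "w \<in> W" "x (g 0) = y w"
    using max_atlas_pointE[OF x g0] .
  obtain T \<phi> where T: "open T" "g 0 \<in> T" "T \<subseteq> V" "smooth_on T \<phi>" "\<And>t. t \<in> T \<Longrightarrow> \<phi> t \<in> W"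
      "\<And>t. t \<in> T \<Longrightarrow> x t = y (\<phi> t)"
    using max_atlas_change_atlas(1)[OF A x y(1) g0 y(2,3)] unfolding change_at_def by blast
  have "open {t \<in> {-e<..<e}. g t \<in> T}" by (rule open_preimage_smooth[OF _ g(1) T(1)]) auto
  moreover have "0 \<in> {t \<in> {-e<..<e}. g t \<in> T}" using e T(2) by auto
  ultimately obtain d where d: "d > 0" "ball 0 d \<subseteq> {t \<in> {-e<..<e}. g t \<in> T}"
    by (meson open_contains_ball)
  have be: "ball 0 d = {-d<..<d}" by (auto simp: dist_real_def)
  have sub: "t \<in> {-e<..<e} \<and> g t \<in> T" if "t \<in> {-d<..<d}" for t
    using that d(2) unfolding be by blast
  have "smooth_on {-d<..<d} (\<lambda>t. \<phi> (g t))"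
    by (rule smooth_on_compose[OF _ T(1) smooth_on_subset[OF g(1)] T(4)]) (use sub in auto)
  moreover have "\<forall>t\<in>{-d<..<d}. \<phi> (g t) \<in> W \<and> c t = y (\<phi> (g t))"
    using sub T(5,6) g(3) by auto
  ultimately show ?thesis unfolding smooth_curve_def using y(1) d(1) by blast
qed

text \<open>
  The coordinates, in the parametrization \<open>x\<close> around \<open>u\<close>, of the tangent vectors of \<open>S\<close>.
\<close>

definition curve_directions :: "'e::euclidean_space set \<Rightarrow> ('e \<Rightarrow> 'a) \<Rightarrow> 'e \<Rightarrow> 'a set \<Rightarrow> 'e set" where
  "curve_directions V x u S = {h. \<exists>g e. e > 0 \<and> smooth_on {-e<..<e} g \<and> g 0 = u \<and>
     (\<forall>t\<in>{-e<..<e}. g t \<in> V) \<and> (g has_vector_derivative h) (at 0) \<and> (\<forall>\<^sub>F t in nhds 0. x (g t) \<in> S)}"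

lemma smooth_on_has_vector_derivative:
  fixes g :: "real \<Rightarrow> 'e::real_normed_vector"
  assumes "open S" "smooth_on S g" "t \<in> S"
  shows "\<exists>h. (g has_vector_derivative h) (at t)"
  using differentiableI[OF smooth_on_has_derivative[OF assms]] vector_derivative_works by blast

lemma eventually_nhds_interval: "e > 0 \<Longrightarrow> \<forall>\<^sub>F t in nhds 0. t \<in> {-e<..<e::real}"
  by (rule eventually_nhds_in_open) auto

lemma tangent_eq_coord_vec_directions:
  assumes A: "diff_atlas A" and x: "(V, x) \<in> max_atlas A" and u: "u \<in> V"
  shows "tangent A S (x u) = coord_vec A x u ` curve_directions V x u S"
proof (intro equalityI subsetI)
  fix v assume "v \<in> tangent A S (x u)"
  then obtain c where c: "v = velocity A c" "smooth_curve A c" "c 0 = x u" "\<forall>\<^sub>F t in nhds 0. c t \<in> S"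
    unfolding tangent_def by blast
  obtain e g where g: "e > 0" "smooth_on {-e<..<e} g" "g 0 = u"
    "\<And>t. t \<in> {-e<..<e} \<Longrightarrow> g t \<in> V" "\<And>t. t \<in> {-e<..<e} \<Longrightarrow> c t = x (g t)"
    using smooth_curve_in_chart[OF A x u c(2,3)] by blast
  obtain h where h: "(g has_vector_derivative h) (at 0)"
    using smooth_on_has_vector_derivative[OF _ g(2), of 0] g(1) by auto
  have ev: "\<forall>\<^sub>F t in nhds 0. c t = x (g t)"
    using eventually_nhds_interval[OF g(1)] by eventually_elim (rule g(5))
  have "\<forall>\<^sub>F t in nhds 0. x (g t) \<in> S" using ev c(4) by eventually_elim simp
  then have "h \<in> curve_directions V x u S"
    unfolding curve_directions_def using g h by blast
  moreover have "v = coord_vec A x u h"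
    using velocity_eq_coord_vec[OF A x _ h ev] c(1) g(3) u by simp
  ultimately show "v \<in> coord_vec A x u ` curve_directions V x u S" by blast
next
  fix v assume "v \<in> coord_vec A x u ` curve_directions V x u S"
  then obtain h g e where h: "v = coord_vec A x u h"
    and g: "e > 0" "smooth_on {-e<..<e} g" "g 0 = u" "\<And>t. t \<in> {-e<..<e} \<Longrightarrow> g t \<in> V"
      "(g has_vector_derivative h) (at 0)" "\<forall>\<^sub>F t in nhds 0. x (g t) \<in> S"
    unfolding curve_directions_def by blast
  have "smooth_curve A (\<lambda>t. x (g t))"
    by (rule smooth_curveI[OF A x g(1,2,4)]) auto
  moreover have "v = velocity A (\<lambda>t. x (g t))"
    using velocity_eq_coord_vec[OF A x _ g(5)] g(3) u h by simp
  ultimately show "v \<in> tangent A S (x u)"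
    unfolding tangent_def using g(3,6) by (intro CollectI exI[of _ "\<lambda>t. x (g t)"]) auto
qed

lemma curve_directions_total:
  assumes "open V" "u \<in> V" "x ` V \<subseteq> S"
  shows "curve_directions V x u S = UNIV"
proof -
  have "h \<in> curve_directions V x u S" for h
  proof -
    let ?g = "\<lambda>t::real. u + t *\<^sub>R h"
    have sm: "smooth_on UNIV ?g" by (intro smooth_intros) auto
    have "open {t \<in> UNIV. ?g t \<in> V}" by (rule open_preimage_smooth[OF _ sm assms(1)]) auto
    then obtain e where e: "e > 0" "ball 0 e \<subseteq> {t \<in> UNIV. ?g t \<in> V}"
      using assms(2) by (metis (mono_tags, lifting) UNIV_I add.right_neutral mem_Collect_eq
        open_contains_ball scaleR_zero_left)
    have be: "ball 0 e = {-e<..<e}" by (auto simp: dist_real_def)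
    have V: "?g t \<in> V" if "t \<in> {-e<..<e}" for t using that e(2) unfolding be by blast
    have "\<forall>\<^sub>F t in nhds 0. x (?g t) \<in> S"
      using eventually_nhds_interval[OF e(1)] by eventually_elim (use V assms(3) in blast)
    moreover have "(?g has_vector_derivative h) (at 0)"
      by (auto intro!: derivative_eq_intros simp: has_vector_derivative_def)
    ultimately show ?thesis
      unfolding curve_directions_def
      using e(1) V smooth_on_subset[OF sm, of "{-e<..<e}"]
        by (intro CollectI exI[of _ ?g] exI[of _ e]) auto
  qed
  then show ?thesis by auto
qed

lemma tangent_space_eq_coord_vec:
  assumes "diff_atlas A" "(V, x) \<in> max_atlas A" "u \<in> V"
  shows "tangent_space A (x u) = range (coord_vec A x u)"
  using tangent_eq_coord_vec_directions[OF assms] curve_directions_total[of V u x "points A"]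
    max_atlasD[OF assms(2)] assms(3) by simp

text \<open>
  Transversality at a point becomes a statement about sums of vectors in the model space, because
  \<open>coord_vec\<close> is linear and injective.
\<close>

lemma transverse_at_iff:
  assumes A: "diff_atlas A" and x: "(V, x) \<in> max_atlas A" and u: "u \<in> V"
  shows "(\<forall>v \<in> tangent_space A (x u).
     \<exists>v1 \<in> tangent A S (x u). \<exists>v2 \<in> tangent A T (x u). v = (\<lambda>f. v1 f + v2 f)) \<longleftrightarrow>
    (\<forall>h. \<exists>h1\<in>curve_directions V x u S. \<exists>h2\<in>curve_directions V x u T. h = h1 + h2)"
    (is "?L \<longleftrightarrow> ?R")
proof -
  have "coord_vec A x u h = (\<lambda>f. coord_vec A x u h1 f + coord_vec A x u h2 f) \<longleftrightarrow> h = h1 + h2" for h h1 h2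
    using coord_vec_add[OF assms, of h1 h2] coord_vec_inject[OF assms, of h "h1 + h2"] by metis
  then show ?thesis
    unfolding tangent_eq_coord_vec_directions[OF assms]
    using curve_directions_total[OF max_atlasD(1)[OF x] u max_atlasD(3)[OF x]] by simp
qed

lemma push_velocity:
  assumes "\<And>g. smooth_at B q g \<Longrightarrow> smooth_at A (c 0) (g \<circ> F)" "q = F (c 0)"
  shows "push B q F (velocity A c) = velocity B (F \<circ> c)"
  using assms by (auto simp: push_def velocity_def fun_eq_iff o_assoc)

lemma smooth_at_compose:
  assumes A: "diff_atlas A" "(V, x) \<in> max_atlas A" and B: "diff_atlas B" "(W, y) \<in> max_atlas B"
    and u: "u \<in> V" and \<phi>: "smooth_on V \<phi>" "\<And>t. t \<in> V \<Longrightarrow> \<phi> t \<in> W" "\<And>t. t \<in> V \<Longrightarrow> F (x t) = y (\<phi> t)"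
    and g: "smooth_at B (F (x u)) g"
  shows "smooth_at A (x u) (g \<circ> F)"
proof -
  have V: "open V" using max_atlasD[OF A(2)] by auto
  have "smooth_at B (y (\<phi> u)) g" using g \<phi>(3)[OF u] by simp
  then obtain T where T: "open T" "\<phi> u \<in> T" "T \<subseteq> W" "smooth_on T (g \<circ> y)"
    using smooth_at_iff[OF B \<phi>(2)[OF u]] by blast
  let ?N = "{t \<in> V. \<phi> t \<in> T}"
  have N: "open ?N" by (rule open_preimage_smooth[OF V \<phi>(1) T(1)])
  have "smooth_on ?N (\<lambda>t. (g \<circ> y) (\<phi> t))"
    by (rule smooth_on_compose[OF N T(1) _ T(4)]) (auto intro: smooth_on_subset[OF \<phi>(1)])
  then have "smooth_on ?N (g \<circ> F \<circ> x)"
    by (rule smooth_on_cong[OF N]) (auto simp: \<phi>(3))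
  then show ?thesis using smooth_at_iff[OF A u] N u T(2) by blast
qed

text \<open>
  The differential of \<open>F\<close> in coordinates is the derivative of its coordinate expression \<open>\<phi>\<close>.
  Besides projections this is applied to \<open>F = id\<close>, where it compares tangent vectors with respect to
  two atlases.
\<close>

lemma push_coord_vec:
  assumes A: "diff_atlas A" "(V, x) \<in> max_atlas A" and B: "diff_atlas B" "(W, y) \<in> max_atlas B"
    and u: "u \<in> V" and \<phi>: "smooth_on V \<phi>" "\<And>t. t \<in> V \<Longrightarrow> \<phi> t \<in> W" "\<And>t. t \<in> V \<Longrightarrow> F (x t) = y (\<phi> t)"
    and D: "(\<phi> has_derivative D) (at u)"
  shows "push B (F (x u)) F (coord_vec A x u h) = coord_vec B y (\<phi> u) (D h)"
proof -
  have V: "open V" using max_atlasD[OF A(2)] by auto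
  let ?c = "\<lambda>t. u + t *\<^sub>R h"
  have c: "(?c has_derivative (\<lambda>t. t *\<^sub>R h)) (at 0)"
    by (auto intro!: derivative_eq_intros)
  have "push B (F (x u)) F (velocity A (\<lambda>t. x (?c t))) = velocity B (F \<circ> (\<lambda>t. x (?c t)))"
    by (rule push_velocity) (auto intro: smooth_at_compose[OF A B u \<phi>])
  also have "\<dots> = coord_vec B y (\<phi> (?c 0)) (D h)"
  proof (rule velocity_eq_coord_vec[OF B, where g = "\<lambda>t. \<phi> (?c t)"])
    have "((\<lambda>t. \<phi> (?c t)) has_derivative (\<lambda>t. D (t *\<^sub>R h))) (at 0)"
      by (rule has_derivative_compose[OF c]) (use D in simp)
    then show "((\<lambda>t. \<phi> (?c t)) has_vector_derivative D h) (at 0)"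
      using linear_scale[OF has_derivative_linear[OF D]] by (simp add: has_vector_derivative_def)
    have "\<forall>\<^sub>F t in nhds 0. ?c t \<in> V"
    proof -
      have "(?c \<longlongrightarrow> ?c 0) (nhds 0)"
        using has_derivative_continuous[OF c] isCont_def tendsto_at_iff_tendsto_nhds by blast
      then show ?thesis using V u by (intro topological_tendstoD) auto
    qed
    then show "\<forall>\<^sub>F t in nhds 0. (F \<circ> (\<lambda>t. x (?c t))) t = y (\<phi> (?c t))"
      by eventually_elim (simp add: \<phi>(3))
  qed (use \<phi>(2) u in simp)
  finally show ?thesis by (simp add: coord_vec_def)
qed

section \<open>Products and relabelled model spaces\<close>

lemma change_at_prod:
  assumes "change_at V x W y u" "change_at V' x' W' y' u'"
  shows "change_at (V \<times> V') (map_prod x x') (W \<times> W') (map_prod y y') (u, u')"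
proof -
  obtain T \<phi> where T: "open T" "u \<in> T" "T \<subseteq> V" "smooth_on T \<phi>" "\<And>t. t \<in> T \<Longrightarrow> \<phi> t \<in> W"
      "\<And>t. t \<in> T \<Longrightarrow> x t = y (\<phi> t)"
    using assms(1) unfolding change_at_def by blast
  obtain T' \<phi>' where T': "open T'" "u' \<in> T'" "T' \<subseteq> V'" "smooth_on T' \<phi>'" "\<And>t. t \<in> T' \<Longrightarrow> \<phi>' t \<in> W'"
      "\<And>t. t \<in> T' \<Longrightarrow> x' t = y' (\<phi>' t)"
    using assms(2) unfolding change_at_def by blast
  have op: "open (T \<times> T')" using T(1) T'(1) by (rule open_Times)
  have "smooth_on (T \<times> T') (\<lambda>p. (\<phi> (fst p), \<phi>' (snd p)))"
    by (intro smooth_on_Pair op smooth_on_compose[OF op T(1) _ T(4)]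
      smooth_on_compose[OF op T'(1) _ T'(4)]
        smooth_intros) auto
  then show ?thesis
    using T T' by (intro change_atI[OF op, where \<phi> = "\<lambda>p. (\<phi> (fst p), \<phi>' (snd p))"]) auto
qed

lemma points_prod_atlas: "points (prod_atlas A B) = points A \<times> points B"
proof (intro equalityI subsetI)
  fix p assume "p \<in> points A \<times> points B"
  then obtain V x u W y w where *: "(V, x) \<in> A" "u \<in> V" "(W, y) \<in> B" "w \<in> W" "p = (x u, y w)"
    by (auto simp: points_def)
  have "(V \<times> W, map_prod x y) \<in> prod_atlas A B" using * by (auto simp: prod_atlas_def)
  moreover have "p \<in> map_prod x y ` (V \<times> W)" using * by (auto intro: image_eqI[of _ _ "(u, w)"])
  ultimately show "p \<in> points (prod_atlas A B)" unfolding points_def by blast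
qed (auto simp: points_def prod_atlas_def)

lemma prod_atlas_coherent:
  assumes A: "diff_atlas A" and B: "diff_atlas B"
  shows "diff_atlas (prod_atlas A B) \<and>
    prod_atlas (max_atlas A) (max_atlas B) \<subseteq> max_atlas (prod_atlas A B)"
proof (rule coherent_charts)
  show "prod_atlas A B \<subseteq> prod_atlas (max_atlas A) (max_atlas B)"
    using atlas_subset_max_atlas[OF A] atlas_subset_max_atlas[OF B]
    unfolding prod_atlas_def by blast
  fix V x assume *: "(V, x) \<in> prod_atlas (max_atlas A) (max_atlas B)"
  then obtain V1 x1 V2 x2 where "(V1, x1) \<in> max_atlas A" "(V2, x2) \<in> max_atlas B"
    "V = V1 \<times> V2" "x = map_prod x1 x2" by (auto simp: prod_atlas_def)
  then show "open V \<and> inj_on x V \<and> x ` V \<subseteq> points (prod_atlas A B)"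
    unfolding points_prod_atlas using max_atlasD[of V1 x1 A] max_atlasD[of V2 x2 B]
    by (auto intro!: open_Times map_prod_inj_on)
  fix W y u w assume "(W, y) \<in> prod_atlas (max_atlas A) (max_atlas B)" "u \<in> V" "w \<in> W" "x u = y w"
  then show "change_at V x W y u"
    using * by (auto simp: prod_atlas_def intro!: change_at_prod max_atlas_change[OF A]
      max_atlas_change[OF B])
qed

lemmas diff_atlas_prod = prod_atlas_coherent[THEN conjunct1]

lemma max_atlas_prod:
  assumes "diff_atlas A" "(V, x) \<in> max_atlas A" "diff_atlas B" "(W, y) \<in> max_atlas B"
  shows "(V \<times> W, map_prod x y) \<in> max_atlas (prod_atlas A B)"
proof -
  have "(V \<times> W, map_prod x y) \<in> prod_atlas (max_atlas A) (max_atlas B)"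
    using assms(2,4) by (auto simp: prod_atlas_def)
  then show ?thesis using prod_atlas_coherent[OF assms(1,3)] by blast
qed

text \<open>
  Change of the model space by a linear isomorphism \<open>j\<close>, as in the definition of \<open>prod_cone\<close>.
\<close>

definition relabel_atlas :: "('f \<Rightarrow> 'e) \<Rightarrow> ('a, 'e) atlas \<Rightarrow> ('a, 'f) atlas" where
  "relabel_atlas j A = (\<lambda>(V, x). (j -` V, x \<circ> j)) ` A"

lemma points_relabel_atlas:
  fixes j :: "'f \<Rightarrow> 'e" and A :: "('a, 'e) atlas"
  assumes j: "surj j"
  shows "points (relabel_atlas j A) = points A"
proof -
  have "(x \<circ> j) ` (j -` V) = x ` V" for V and x :: "'e \<Rightarrow> 'a"
    by (metis image_comp surj_image_vimage_eq j)
  then show ?thesis by (simp add: points_def relabel_atlas_def case_prod_beta)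
qed

lemma open_vimage_linear: "linear j \<Longrightarrow> open V \<Longrightarrow> open (j -` V)"
  for j :: "'f::euclidean_space \<Rightarrow> 'e::euclidean_space"
  using open_preimage_smooth[OF open_UNIV smooth_on_linear[OF open_UNIV], of j V]
    by (simp add: vimage_def)

lemma relabel_atlas_coherent:
  fixes j :: "'f::euclidean_space \<Rightarrow> 'e::euclidean_space" and i :: "'e \<Rightarrow> 'f"
  assumes A: "diff_atlas A" and j: "linear j" "linear i" "\<And>v. j (i v) = v" "\<And>v. i (j v) = v"
  shows "diff_atlas (relabel_atlas j A) \<and>
    relabel_atlas j (max_atlas A) \<subseteq> max_atlas (relabel_atlas j A)"
proof (rule coherent_charts)
  show "relabel_atlas j A \<subseteq> relabel_atlas j (max_atlas A)"
    unfolding relabel_atlas_def by (rule image_mono[OF atlas_subset_max_atlas[OF A]])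
  fix V x assume "(V, x) \<in> relabel_atlas j (max_atlas A)"
  then obtain V0 x0 where x0: "(V0, x0) \<in> max_atlas A" "V = j -` V0" "x = x0 \<circ> j"
    by (auto simp: relabel_atlas_def)
  have "surj j" "inj j" by (metis j(3) surjI, metis j(4) injI)
  then show "open V \<and> inj_on x V \<and> x ` V \<subseteq> points (relabel_atlas j A)"
    using open_vimage_linear[OF j(1)] max_atlasD[OF x0(1)]
      unfolding x0(2,3) points_relabel_atlas[OF \<open>surj j\<close>]
    by (auto simp: inj_on_def)
  fix W y u w assume "(W, y) \<in> relabel_atlas j (max_atlas A)" and uw: "u \<in> V" "w \<in> W" "x u = y w"
  then obtain W0 y0 where y0: "(W0, y0) \<in> max_atlas A" "W = j -` W0" "y = y0 \<circ> j"
    by (auto simp: relabel_atlas_def)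
  obtain T \<phi> where T: "open T" "j u \<in> T" "T \<subseteq> V0" "smooth_on T \<phi>" "\<And>t. t \<in> T \<Longrightarrow> \<phi> t \<in> W0"
      "\<And>t. t \<in> T \<Longrightarrow> x0 t = y0 (\<phi> t)"
    using max_atlas_change[OF A x0(1) y0(1), of "j u" "j w"] uw x0(2,3) y0(2,3) unfolding change_at_def
      by auto
  have op: "open (j -` T)" by (rule open_vimage_linear[OF j(1) T(1)])
  have "smooth_on (j -` T) (\<lambda>t. i (\<phi> (j t)))"
    by (rule smooth_on_linear_compose[OF j(2) op smooth_on_compose[OF op T(1) _ T(4)]])
       (auto intro: smooth_on_linear[OF op j(1)])
  then show "change_at V x W y u"
    using T j(3) x0(2,3) y0(2,3) by (intro change_atI[OF op, where \<phi> = "\<lambda>t. i (\<phi> (j t))"]) auto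
qed

section \<open>Contact forms\<close>

definition contact_form :: "'e::euclidean_space set \<Rightarrow> ('e \<Rightarrow> 'e) \<Rightarrow> bool" where
  "contact_form V a \<longleftrightarrow> smooth_on V a \<and> (\<forall>u\<in>V. a u \<noteq> 0 \<and>
     (\<forall>h. a u \<bullet> h = 0 \<and>
        (\<forall>k. a u \<bullet> k = 0 \<longrightarrow>
           frechet_derivative a (at u) h \<bullet> k - frechet_derivative a (at u) k \<bullet> h = 0) \<longrightarrow> h = 0))"

lemma contact_form_uminus:
  assumes "open V" "contact_form V a"
  shows "contact_form V (\<lambda>u. - a u)"
proof -
  have D: "frechet_derivative (\<lambda>u. - a u) (at u) = (\<lambda>h. - frechet_derivative a (at u) h)"
    if "u \<in> V" for u
  proof -
    have "(a has_derivative frechet_derivative a (at u)) (at u)"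
      using assms(2) by (intro smooth_on_has_derivative[OF assms(1)
        _ that]) (simp add: contact_form_def)
    then have "((\<lambda>u. - a u) has_derivative (\<lambda>h. - frechet_derivative a (at u) h)) (at u)"
      by (rule has_derivative_minus)
    then show ?thesis by (rule frechet_derivative_at[symmetric])
  qed
  have *: "- (x::real) - - y = 0 \<longleftrightarrow> x - y = 0" for x y by auto
  have "smooth_on V a" using assms(2) by (simp add: contact_form_def)
  then show ?thesis
    using assms(2) smooth_on_uminus[OF assms(1), of a] by (simp add: contact_form_def D *)
qed

text \<open>
  The 1-form \<open>r \<alpha> + \<beta>\<close> on \<open>V \<times> W \<times> R+\<close>.
\<close>

definition product_form :: "('h \<Rightarrow> 'h) \<Rightarrow> ('k \<Rightarrow> 'k) \<Rightarrow> 'h::real_vector \<times> 'k \<times> real \<Rightarrow> 'h \<times> 'k \<times> real" where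
  "product_form a b = (\<lambda>(h, k, r). (r *\<^sub>R a h, b k, 0))"

text \<open>
  Here \<open>d(r \<alpha> + \<beta>) = dr \<and> \<alpha> + r d\<alpha> + d\<beta>\<close>.  Let \<open>v = (h1, k1, r1)\<close> be in the kernel of the form, and in
  the kernel of its differential restricted to that hyperplane.  Pairing with \<open>\<partial>/\<partial>r\<close> gives
  \<open>\<alpha>(h1) = 0\<close>, hence also \<open>\<beta>(k1) = 0\<close>; pairing with \<open>ker \<alpha>\<close> and \<open>ker \<beta>\<close> gives \<open>h1 = 0\<close> and \<open>k1 = 0\<close>
  by nondegeneracy of the factors; and then \<open>r1 = 0\<close> follows by pairing with a vector of the
  hyperplane on which \<open>\<alpha>\<close> does not vanish.
\<close>

lemma contact_form_product:
  fixes a :: "'h::euclidean_space \<Rightarrow> 'h" and b :: "'k::euclidean_space \<Rightarrow> 'k"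
  assumes V: "open V" "contact_form V a" and W: "open W" "contact_form W b"
  shows "contact_form (V \<times> W \<times> {0<..}) (product_form a b)"
proof -
  let ?N = "V \<times> W \<times> {0<..} :: ('h \<times> 'k \<times> real) set"
  have N: "open ?N" using V(1) W(1) by (intro open_Times) auto
  have sm: "smooth_on V a" "smooth_on W b" using V(2) W(2) by (auto simp: contact_form_def)
  have "smooth_on ?N (\<lambda>p. (snd (snd p) *\<^sub>R a (fst p), b (fst (snd p)), 0::real))"
    by (intro smooth_on_Pair smooth_on_scaleR N smooth_on_compose[OF N V(1) _ sm(1)]
        smooth_on_compose[OF N W(1) _ sm(2)] smooth_intros) auto
  then have "smooth_on ?N (product_form a b)"
    by (simp add: product_form_def case_prod_unfold)
  moreover have "product_form a b (h, k, r) \<noteq> 0 \<and>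
    (\<forall>v. product_form a b (h, k, r) \<bullet> v = 0 \<and>
      (\<forall>w. product_form a b (h, k, r) \<bullet> w = 0 \<longrightarrow>
         frechet_derivative (product_form a b) (at (h, k, r)) v \<bullet> w -
         frechet_derivative (product_form a b) (at (h, k, r)) w \<bullet> v = 0) \<longrightarrow> v = 0)"
    if p: "h \<in> V" "k \<in> W" "r > 0" for h k r
  proof -
    let ?Da = "frechet_derivative a (at h)" and ?Db = "frechet_derivative b (at k)"
    have Da: "(a has_derivative ?Da) (at h)" and Db: "(b has_derivative ?Db) (at k)"
      using smooth_on_has_derivative V(1) W(1) sm p by blast+
    have lin: "linear ?Da" "linear ?Db" using Da Db has_derivative_linear by blast+
    have d0: "?Da 0 = 0" "?Db 0 = 0" using linear_0[OF lin(1)] linear_0[OF lin(2)] by auto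
    have 1: "((\<lambda>p. a (fst p)) has_derivative (\<lambda>v. ?Da (fst v))) (at (h, k, r))"
      by (rule has_derivative_compose[of fst fst]) (use Da in \<open>auto intro: derivative_intros\<close>)
    have "((\<lambda>p. fst (snd p)) has_derivative (\<lambda>v. fst (snd v))) (at (h, k, r))"
      by (auto intro!: derivative_eq_intros)
    from has_derivative_compose[OF this]
    have 2: "((\<lambda>p. b (fst (snd p))) has_derivative (\<lambda>v. ?Db (fst (snd v)))) (at (h, k, r))"
      using Db by fastforce
    have 3: "((\<lambda>p. snd (snd p)) has_derivative (\<lambda>v. snd (snd v))) (at (h, k, r))"
      by (auto intro!: derivative_eq_intros)
    have "((\<lambda>p. (snd (snd p) *\<^sub>R a (fst p), b (fst (snd p)), 0::real)) has_derivative
       (\<lambda>v. (r *\<^sub>R ?Da (fst v) + snd (snd v) *\<^sub>R a h, ?Db (fst (snd v)), 0))) (at (h, k, r))"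
      using has_derivative_Pair[OF has_derivative_scaleR[OF 3 1]
        has_derivative_Pair[OF 2 has_derivative_const]]
      by simp
    then have "frechet_derivative (product_form a b) (at (h, k, r)) =
       (\<lambda>v. (r *\<^sub>R ?Da (fst v) + snd (snd v) *\<^sub>R a h, ?Db (fst (snd v)), 0))"
      by (intro frechet_derivative_at[symmetric]) (simp add: product_form_def case_prod_unfold)
    note D = this
    have a0: "a h \<noteq> 0" "b k \<noteq> 0" using V(2) W(2) p by (auto simp: contact_form_def)
    have "v = 0"
      if v: "product_form a b (h, k, r) \<bullet> v = 0"
        and ker: "\<And>w. product_form a b (h, k, r) \<bullet> w = 0 \<Longrightarrow>
         frechet_derivative (product_form a b) (at (h, k, r)) v \<bullet> w -
         frechet_derivative (product_form a b) (at (h, k, r)) w \<bullet> v = 0" for v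
    proof -
      obtain h1 k1 r1 where v_eq: "v = (h1, k1, r1)" by (metis surj_pair)
      have v': "r * (a h \<bullet> h1) + b k \<bullet> k1 = 0"
        using v by (simp add: v_eq product_form_def)
      have ker': "r * (?Da h1 \<bullet> h2) + r1 * (a h \<bullet> h2) + ?Db k1 \<bullet> k2
          - (r * (?Da h2 \<bullet> h1) + r2 * (a h \<bullet> h1) + ?Db k2 \<bullet> k1) = 0"
        if "r * (a h \<bullet> h2) + b k \<bullet> k2 = 0" for h2 k2 r2
        using ker[of "(h2, k2, r2)"] that unfolding D
        by (simp add: v_eq product_form_def inner_add_left inner_diff_left)
      \<comment> \<open>The vector \<open>\<partial>/\<partial>r\<close>, that is \<open>(0, 0, 1)\<close>, always lies in the hyperplane.\<close>
      have ah: "a h \<bullet> h1 = 0" using ker'[of 0 0 1] by (simp add: d0)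
      then have bk: "b k \<bullet> k1 = 0" using v' by simp
      have "h1 = 0"
      proof -
        have "?Da h1 \<bullet> h2 - ?Da h2 \<bullet> h1 = 0" if "a h \<bullet> h2 = 0" for h2
        proof -
          have "r * (?Da h1 \<bullet> h2 - ?Da h2 \<bullet> h1) = 0"
            using ker'[of h2 0 0] that by (simp add: d0 algebra_simps)
          then show ?thesis using p(3) by simp
        qed
        then show ?thesis using V(2) p(1) ah by (auto simp: contact_form_def)
      qed
      moreover have "k1 = 0"
      proof -
        have "?Db k1 \<bullet> k2 - ?Db k2 \<bullet> k1 = 0" if "b k \<bullet> k2 = 0" for k2
          using ker'[of 0 k2 0] that by (simp add: d0 algebra_simps)
        then show ?thesis using W(2) p(2) bk by (auto simp: contact_form_def)
      qed
      moreover have "r1 = 0"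
      proof -
        \<comment> \<open>The \<open>k\<close>-component is chosen such that \<open>r \<alpha> + \<beta>\<close> vanishes on the test vector.\<close>
        have "r1 * (a h \<bullet> a h) = 0"
          using ker'[of "a h" "- (r * (a h \<bullet> a h) / (b k \<bullet> b k)) *\<^sub>R b k" 0] \<open>h1 = 0\<close> \<open>k1 = 0\<close> a0
          by (simp add: d0)
        then show ?thesis using a0 by simp
      qed
      ultimately show ?thesis by (simp add: v_eq zero_prod_def)
    qed
    moreover have "product_form a b (h, k, r) \<noteq> 0"
      using a0 by (simp add: product_form_def zero_prod_def)
    ultimately show ?thesis by blast
  qed
  ultimately show ?thesis unfolding contact_form_def by auto
qed

section \<open>Liouville cones\<close>

definition section_chart :: "('s, 'h) cone \<Rightarrow> ('h \<Rightarrow> 's) \<Rightarrow> 'h \<times> real \<Rightarrow> 's" where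
  "section_chart C \<sigma> = (\<lambda>(u, r). scale C r (\<sigma> u))"

lemma section_chart_simp [simp]: "section_chart C \<sigma> (u, r) = scale C r (\<sigma> u)"
  by (simp add: section_chart_def)

text \<open>
  A local section \<open>\<sigma>\<close> of the projection to the quotient that trivializes the action and pulls the
  1-form back to \<open>r \<alpha>\<close>, with \<open>\<alpha>\<close> a contact form given by its coefficients \<open>a\<close>.  That the
  1-form has no \<open>dr\<close>-component says that it vanishes along the orbits.
\<close>

definition contact_section ::
  "('s, 'h::euclidean_space) cone \<Rightarrow> 'h set \<Rightarrow> ('h \<Rightarrow> 's) \<Rightarrow> ('h \<Rightarrow> 'h) \<Rightarrow> bool" where
  "contact_section C V \<sigma> a \<longleftrightarrow>
     (V \<times> {0<..}, section_chart C \<sigma>) \<in> max_atlas (cone_atlas C) \<and> contact_form V a \<and>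
     (\<forall>u\<in>V. \<forall>r>0. \<forall>h \<rho>. form C (scale C r (\<sigma> u))
        (coord_vec (cone_atlas C) (section_chart C \<sigma>) (u, r) (h, \<rho>)) = r * (a u \<bullet> h))"

text \<open>
  Countability of the cover is what makes the quotient second countable.
\<close>

definition liouville_cone :: "('s, 'h::euclidean_space) cone \<Rightarrow> bool" where
  "liouville_cone C \<longleftrightarrow> diff_atlas (cone_atlas C) \<and>
     (\<forall>s. scale C 1 s = s) \<and> (\<forall>r t s. scale C r (scale C t s) = scale C (r * t) s) \<and>
     (\<exists>K. countable K \<and> (\<forall>(V, \<sigma>, a)\<in>K. contact_section C V \<sigma> a) \<and>
        points (cone_atlas C) \<subseteq> (\<Union>(V, \<sigma>, a)\<in>K. section_chart C \<sigma> ` (V \<times> {0<..})))"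

lemma liouville_coneD:
  assumes "liouville_cone C"
  shows "diff_atlas (cone_atlas C)" "scale C 1 s = s" "scale C r (scale C t s) = scale C (r * t) s"
  using assms by (auto simp: liouville_cone_def)

lemma liouville_coneE:
  assumes "liouville_cone C" "s \<in> points (cone_atlas C)"
  obtains V \<sigma> a u r where "contact_section C V \<sigma> a" "u \<in> V" "r > 0" "s = scale C r (\<sigma> u)"
proof -
  obtain K where K: "\<forall>(V, \<sigma>, a)\<in>K. contact_section C V \<sigma> a"
      "points (cone_atlas C) \<subseteq> (\<Union>(V, \<sigma>, a)\<in>K. section_chart C \<sigma> ` (V \<times> {0<..}))"
    using assms(1) unfolding liouville_cone_def by blast
  obtain V \<sigma> a where "(V, \<sigma>, a) \<in> K" "s \<in> section_chart C \<sigma> ` (V \<times> {0<..})"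
    using subsetD[OF K(2) assms(2)] by (rule UN_E) (simp split: prod.splits)
  then show thesis using that K(1) by auto
qed

lemma open_section_domain:
  assumes "contact_section C V \<sigma> a"
  shows "open V"
proof -
  have "open (V \<times> {0<..} :: (_ \<times> real) set)"
    using assms max_atlasD(1) by (auto simp: contact_section_def)
  then have "open (fst ` (V \<times> {0<..} :: (_ \<times> real) set))" by (rule open_image_fst)
  then show ?thesis by simp
qed

lemma contact_section_points:
  "contact_section C V \<sigma> a \<Longrightarrow> u \<in> V \<Longrightarrow> r > 0 \<Longrightarrow> scale C r (\<sigma> u) \<in> points (cone_atlas C)"
  using max_atlasD(3)[of "V \<times> {0<..}" "section_chart C \<sigma>" "cone_atlas C"]
  by (auto simp: contact_section_def image_subset_iff)

text \<open>
  Each point lies on a ray that is contained in a section chart.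
\<close>

lemma scale_in_points:
  assumes C: "liouville_cone C" and "s \<in> points (cone_atlas C)" "r > 0"
  shows "scale C r s \<in> points (cone_atlas C)"
proof -
  obtain V \<sigma> a u t where s: "contact_section C V \<sigma> a" "u \<in> V" "t > 0" "s = scale C t (\<sigma> u)"
    using liouville_coneE[OF assms(1,2)] .
  have "scale C r s = scale C (r * t) (\<sigma> u)" using s(4) liouville_coneD(3)[OF C] by simp
  then show ?thesis using contact_section_points[OF s(1,2), of "r * t"] s(3) assms(3) by simp
qed

lemma neg_cone_simps [simp]:
  "cone_atlas (neg_cone C) = cone_atlas C" "scale (neg_cone C) = scale C"
  "form (neg_cone C) s v = - form C s v" "section_chart (neg_cone C) = section_chart C"
  by (auto simp: neg_cone_def section_chart_def fun_eq_iff)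

lemma contact_section_neg:
  assumes "contact_section C V \<sigma> a"
  shows "contact_section (neg_cone C) V \<sigma> (\<lambda>u. - a u)"
  using assms contact_form_uminus[OF open_section_domain[OF assms]]
  by (auto simp: contact_section_def)

lemma liouville_cone_neg:
  assumes "liouville_cone C"
  shows "liouville_cone (neg_cone C)"
proof -
  obtain K where K: "countable K" "\<forall>(V, \<sigma>, a)\<in>K. contact_section C V \<sigma> a"
      "points (cone_atlas C) \<subseteq> (\<Union>(V, \<sigma>, a)\<in>K. section_chart C \<sigma> ` (V \<times> {0<..}))"
    using assms unfolding liouville_cone_def by blast
  let ?K = "(\<lambda>(V, \<sigma>, a). (V, \<sigma>, \<lambda>u. - a u)) ` K"
  have "countable ?K" using K(1) by simp
  moreover have "\<forall>(V, \<sigma>, a)\<in>?K. contact_section (neg_cone C) V \<sigma> a"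
    using K(2) contact_section_neg by fastforce
  moreover have "points (cone_atlas (neg_cone C)) \<subseteq>
      (\<Union>(V, \<sigma>, a)\<in>?K. section_chart (neg_cone C) \<sigma> ` (V \<times> {0<..}))"
    using K(3) by (simp add: case_prod_beta)
  ultimately have "\<exists>K. countable K \<and> (\<forall>(V, \<sigma>, a)\<in>K. contact_section (neg_cone C) V \<sigma> a) \<and>
      points (cone_atlas (neg_cone C)) \<subseteq>
      (\<Union>(V, \<sigma>, a)\<in>K. section_chart (neg_cone C) \<sigma> ` (V \<times> {0<..}))"
    by blast
  then show ?thesis using liouville_coneD[OF assms] unfolding liouville_cone_def by simp
qed

text \<open>
  The reordering of coordinates of the model space in the definition of \<open>prod_cone\<close>.
\<close>

definition interleave :: "('h \<times> 'k \<times> real) \<times> real \<Rightarrow> ('h \<times> real) \<times> ('k \<times> real)" where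
  "interleave = (\<lambda>((h, k, r), s). ((h, r), (k, s)))"

definition deinterleave :: "('h \<times> real) \<times> ('k \<times> real) \<Rightarrow> ('h \<times> 'k \<times> real) \<times> real" where
  "deinterleave = (\<lambda>((h, r), (k, s)). ((h, k, r), s))"

lemma interleave_inverse: "interleave (deinterleave v) = v" "deinterleave (interleave w) = w"
  by (auto simp: interleave_def deinterleave_def split: prod.splits)

lemma linear_interleave:
  "linear (interleave :: ('h::real_vector \<times> 'k::real_vector \<times> real) \<times> real \<Rightarrow> _)"
  "linear (deinterleave :: ('h::real_vector \<times> real) \<times> ('k::real_vector \<times> real) \<Rightarrow> _)"
  by (auto simp: linear_iff interleave_def deinterleave_def)

lemma prod_cone_simps [simp]:
  "cone_atlas (prod_cone C D) = relabel_atlas interleave (prod_atlas (cone_atlas C) (cone_atlas D))"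
  "scale (prod_cone C D) r (s, t) = (scale C r s, scale D r t)"
  "form (prod_cone C D) (s, t) v =
     form C s (push (cone_atlas C) s fst v) + form D t (push (cone_atlas D) t snd v)"
  by (auto simp: prod_cone_def relabel_atlas_def interleave_def Let_def)

lemma diff_atlas_prod_cone:
  assumes "diff_atlas (cone_atlas C)" "diff_atlas (cone_atlas D)"
  shows "diff_atlas (cone_atlas (prod_cone C D))"
  unfolding prod_cone_simps
  by (rule relabel_atlas_coherent[THEN conjunct1, OF diff_atlas_prod[OF assms] linear_interleave
    interleave_inverse])

lemma max_atlas_prod_cone:
  assumes C: "diff_atlas (cone_atlas C)" "(V, x) \<in> max_atlas (cone_atlas C)"
    and D: "diff_atlas (cone_atlas D)" "(W, y) \<in> max_atlas (cone_atlas D)"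
  shows "(interleave -` (V \<times> W), map_prod x y \<circ> interleave) \<in> max_atlas (cone_atlas (prod_cone C D))"
proof -
  have "(interleave -` (V \<times> W), map_prod x y \<circ> interleave) \<in>
      relabel_atlas interleave (max_atlas (prod_atlas (cone_atlas C) (cone_atlas D)))"
    unfolding relabel_atlas_def using max_atlas_prod[OF C D]
    by (intro image_eqI[of _ _ "(V \<times> W, map_prod x y)"]) auto
  then show ?thesis
    unfolding prod_cone_simps
    using relabel_atlas_coherent[OF diff_atlas_prod[OF C(1) D(1)] linear_interleave interleave_inverse]
      by blast
qed

lemma points_prod_cone [simp]:
  fixes C :: "('s, 'h::euclidean_space) cone" and D :: "('t, 'k::euclidean_space) cone"
  shows "points (cone_atlas (prod_cone C D)) = points (cone_atlas C) \<times> points (cone_atlas D)"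
proof -
  have "surj (interleave :: ('h \<times> 'k \<times> real) \<times> real \<Rightarrow> _)" by (metis interleave_inverse(1) surjI)
  then show ?thesis by (simp add: points_relabel_atlas points_prod_atlas)
qed

text \<open>
  The diagonal action is used up by normalizing the scale of the second component; the relative scale
  \<open>r\<close> of the first component becomes a coordinate of the quotient.
\<close>

definition product_section :: "('s, 'h) cone \<Rightarrow> ('h \<Rightarrow> 's) \<Rightarrow> ('k \<Rightarrow> 't) \<Rightarrow> 'h \<times> 'k \<times> real \<Rightarrow> 's \<times> 't" where
  "product_section C \<sigma> \<tau> = (\<lambda>(h, k, r). (scale C r (\<sigma> h), \<tau> k))"

text \<open>
  The section chart is \<open>((h, k, r), t) \<mapsto> (t r \<cdot> \<sigma> h, t \<cdot> \<tau> k)\<close>, and the 1-forms of the factors at this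
  point are \<open>t r \<alpha>\<close> and \<open>t \<beta>\<close>, with sum \<open>t (r \<alpha> + \<beta>)\<close>.
\<close>

lemma contact_section_prod:
  fixes C :: "('s, 'h::euclidean_space) cone" and D :: "('t, 'k::euclidean_space) cone"
  assumes C: "liouville_cone C" "contact_section C V \<sigma> a" and D: "liouville_cone D"
    "contact_section D W \<tau> b"
  shows "contact_section (prod_cone C D) (V \<times> W \<times> {0<..}) (product_section C \<sigma> \<tau>) (product_form a b)"
proof -
  note V = open_section_domain[OF C(2)] and W = open_section_domain[OF D(2)]
  let ?P = "cone_atlas (prod_cone C D)"
  let ?X = "section_chart C \<sigma>" and ?Y = "section_chart D \<tau>"
  let ?Z = "section_chart (prod_cone C D) (product_section C \<sigma> \<tau>)"
  let ?N = "(V \<times> W \<times> {0<..}) \<times> {0<..} :: (('h \<times> 'k \<times> real) \<times> real) set"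
  have N: "open ?N" using V W by (intro open_Times) auto
  have X: "(V \<times> {0<..}, ?X) \<in> max_atlas (cone_atlas C)" and Y: "(W \<times> {0<..}, ?Y) \<in>
    max_atlas (cone_atlas D)"
    using C(2) D(2) by (auto simp: contact_section_def)
  note dC = liouville_coneD(1)[OF C(1)] and dD = liouville_coneD(1)[OF D(1)]
  note dP = diff_atlas_prod_cone[OF dC dD]
  have "(interleave -` ((V \<times> {0<..}) \<times> (W \<times> {0<..})), map_prod ?X ?Y \<circ> interleave) \<in> max_atlas ?P"
    by (rule max_atlas_prod_cone[OF dC X dD Y])
  moreover have "interleave -` ((V \<times> {0<..}) \<times> (W \<times> {0<..})) = ?N"
    by (auto simp: interleave_def)
  ultimately have XY: "(?N, map_prod ?X ?Y \<circ> interleave) \<in> max_atlas ?P" by simp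
  \<comment> \<open>From \<open>((h, k, r), t)\<close> to the scales \<open>(t r, t)\<close> of the two factors, and back.\<close>
  let ?\<Psi> = "\<lambda>p. ((fst (fst p), fst (snd (fst p)), snd p * snd (snd (fst p))), snd p)"
  let ?\<Theta> = "\<lambda>p. ((fst (fst p), fst (snd (fst p)), snd (snd (fst p)) / snd p), snd p)"
  have Z: "(?N, ?Z) \<in> max_atlas ?P"
  proof (rule max_atlas_reparametrize[OF dP XY N N order_refl, where \<Psi> = ?\<Psi> and \<Theta> = ?\<Theta>])
    show "smooth_on ?N ?\<Psi>" "smooth_on ?N ?\<Theta>" by (intro smooth_intros N; auto)+
  qed (auto simp: interleave_def product_section_def liouville_coneD(3)[OF C(1)])
  have form: "form (prod_cone C D) (scale (prod_cone C D) t (product_section C \<sigma> \<tau> (h, k, r)))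
      (coord_vec ?P ?Z ((h, k, r), t) ((h', k', r'), t')) = t * (product_form a b (h, k, r) \<bullet>
        (h', k', r'))"
    if p: "h \<in> V" "k \<in> W" "r > 0" "t > 0" for h k r t h' k' r' t'
  proof -
    let ?p = "((h, k, r), t)"
    have pN: "?p \<in> ?N" using p by auto
    have 1: "((\<lambda>p. fst (fst p)) has_derivative (\<lambda>v. fst (fst v))) (at ?p)"
      "((\<lambda>p. snd p) has_derivative (\<lambda>v. snd v)) (at ?p)"
      "((\<lambda>p. snd (snd (fst p))) has_derivative (\<lambda>v. snd (snd (fst v)))) (at ?p)"
      "((\<lambda>p. fst (snd (fst p))) has_derivative (\<lambda>v. fst (snd (fst v)))) (at ?p)"
      by (auto intro!: derivative_eq_intros)
    let ?\<phi> = "\<lambda>p::(('h \<times> 'k \<times> real) \<times> real). (fst (fst p), snd p * snd (snd (fst p)))"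
    have "push (cone_atlas C) (fst (?Z ?p)) fst (coord_vec ?P ?Z ?p ((h', k', r'), t'))
       = coord_vec (cone_atlas C) ?X (?\<phi>
         ?p) ((\<lambda>v. (fst (fst v), snd ?p * snd (snd (fst v)) + snd v * snd (snd (fst ?p)))) ((h', k',
         r'), t'))"
    proof (rule push_coord_vec[OF dP Z dC X pN])
      show "smooth_on ?N ?\<phi>" by (intro smooth_intros N)
      show "(?\<phi> has_derivative
        (\<lambda>v. (fst (fst v), snd ?p * snd (snd (fst v)) + snd v * snd (snd (fst ?p))))) (at ?p)"
        by (rule has_derivative_Pair[OF 1(1) has_derivative_mult[OF 1(2,3)]])
    qed (auto simp: product_section_def liouville_coneD(3)[OF C(1)])
    moreover have "push (cone_atlas D) (snd (?Z ?p)) snd (coord_vec ?P ?Z ?p ((h', k', r'), t'))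
       = coord_vec (cone_atlas D) ?Y (fst (snd (fst ?p)), snd ?p) ((\<lambda>v. (fst (snd (fst v)), snd v))
         ((h', k', r'), t'))"
    proof (rule push_coord_vec[OF dP Z dD Y pN])
      show "smooth_on ?N (\<lambda>p. (fst (snd (fst p)), snd p))" by (intro smooth_intros N)
      show "((\<lambda>p. (fst (snd (fst p)), snd p)) has_derivative (\<lambda>v. (fst (snd (fst v)), snd v))) (at ?p)"
        by (rule has_derivative_Pair[OF 1(4,2)])
    qed (auto simp: product_section_def)
    moreover have "form C (scale C (t * r) (\<sigma> h))
      (coord_vec (cone_atlas C) ?X (h, t * r) (h', t * r' + t' * r)) = t * r * (a h \<bullet> h')"
      using C(2) p by (simp add: contact_section_def)
    moreover have "form D (scale D t (\<tau> k)) (coord_vec (cone_atlas D) ?Y (k, t) (k', t')) = t *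
      (b k \<bullet> k')"
      using D(2) p by (simp add: contact_section_def)
    ultimately show ?thesis
      by (simp del: prod_cone_simps(1) add: product_section_def product_form_def
        liouville_coneD(3)[OF C(1)] algebra_simps)
  qed
  show ?thesis
    unfolding contact_section_def
    using Z contact_form_product[OF V _ W] C(2) D(2) form
    by (auto simp: contact_section_def simp del: prod_cone_simps)
qed

text \<open>
  The point \<open>(r \<cdot> \<sigma> u, \<rho> \<cdot> \<tau> w)\<close> is \<open>\<rho>\<close> times the value of the product section at \<open>(u, w, r / \<rho>)\<close>, so
  the product sections over pairs of charts from two countable covers cover the product.
\<close>

lemma liouville_cone_prod:
  assumes C: "liouville_cone C" and D: "liouville_cone D"
  shows "liouville_cone (prod_cone C D)"
proof -
  obtain K where K: "countable K" "\<forall>(V, \<sigma>, a)\<in>K. contact_section C V \<sigma> a"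
      "points (cone_atlas C) \<subseteq> (\<Union>(V, \<sigma>, a)\<in>K. section_chart C \<sigma> ` (V \<times> {0<..}))"
    using C unfolding liouville_cone_def by blast
  obtain L where L: "countable L" "\<forall>(W, \<tau>, b)\<in>L. contact_section D W \<tau> b"
      "points (cone_atlas D) \<subseteq> (\<Union>(W, \<tau>, b)\<in>L. section_chart D \<tau> ` (W \<times> {0<..}))"
    using D unfolding liouville_cone_def by blast
  let ?M = "(\<lambda>((V, \<sigma>, a), (W, \<tau>, b)). (V \<times> W \<times> {0<..}, product_section C \<sigma> \<tau>, product_form a b)) `
    (K \<times> L)"
  have "countable ?M" using K(1) L(1) by simp
  moreover have "\<forall>(V, \<sigma>, a)\<in>?M. contact_section (prod_cone C D) V \<sigma> a"
    using contact_section_prod[OF C _ D] K(2) L(2) by fastforce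
  moreover have "p \<in> (\<Union>(V, \<sigma>, a)\<in>?M. section_chart (prod_cone C D) \<sigma> ` (V \<times> {0<..}))"
    if p: "p \<in> points (cone_atlas (prod_cone C D))" for p
  proof -
    obtain s t where st: "p = (s, t)" "s \<in> points (cone_atlas C)" "t \<in> points (cone_atlas D)"
      using p unfolding points_prod_cone by auto
    obtain V \<sigma> a W \<tau> b where VW: "(V, \<sigma>, a) \<in> K" "s \<in> section_chart C \<sigma> ` (V \<times> {0<..})"
      "(W, \<tau>, b) \<in> L" "t \<in> section_chart D \<tau> ` (W \<times> {0<..})"
      by (rule UN_E[OF subsetD[OF K(3) st(2)]], rule UN_E[OF subsetD[OF L(3) st(3)]])
         (simp split: prod.splits)
    obtain u r where s: "(V, \<sigma>, a) \<in> K" "u \<in> V" "r > 0" "s = scale C r (\<sigma> u)"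
      using VW(1,2) by auto
    obtain w \<rho> where t: "(W, \<tau>, b) \<in> L" "w \<in> W" "\<rho> > 0" "t = scale D \<rho> (\<tau> w)"
      using VW(3,4) by auto
    have "(V \<times> W \<times> {0<..}, product_section C \<sigma> \<tau>, product_form a b) \<in> ?M"
      using s(1) t(1) by (intro image_eqI[of _ _ "((V, \<sigma>, a), (W, \<tau>, b))"]) auto
    moreover have "p = section_chart (prod_cone C D) (product_section C \<sigma> \<tau>) ((u, w, r / \<rho>), \<rho>)"
      using s t st(1) by (simp add: product_section_def liouville_coneD(3)[OF C])
    moreover have "((u, w, r / \<rho>), \<rho>) \<in> (V \<times> W \<times> {0<..}) \<times> {0<..}" using s t by simp
    ultimately show ?thesis by blast
  qed
  ultimately have "\<exists>K. countable K \<and> (\<forall>(V, \<sigma>, a)\<in>K. contact_section (prod_cone C D) V \<sigma> a) \<and>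
      points (cone_atlas (prod_cone C D)) \<subseteq>
      (\<Union>(V, \<sigma>, a)\<in>K. section_chart (prod_cone C D) \<sigma> ` (V \<times> {0<..}))"
    by (intro exI[of _ ?M] conjI subsetI)
  moreover have "scale (prod_cone C D) 1 p = p"
    "scale (prod_cone C D) r (scale (prod_cone C D) t p) = scale (prod_cone C D) (r * t) p" for r t p
    using liouville_coneD(2,3)[OF C] liouville_coneD(2,3)[OF D] by (cases p; simp)+
  ultimately show ?thesis
    using diff_atlas_prod_cone[OF liouville_coneD(1)[OF C] liouville_coneD(1)[OF D]]
    unfolding liouville_cone_def by (intro conjI allI)
qed

section \<open>The quotient of a Liouville cone\<close>

lemma orbit_scale:
  assumes C: "liouville_cone C" and r: "r > 0"
  shows "orbit C (scale C r s) = orbit C s"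
proof (intro equalityI subsetI)
  fix t assume "t \<in> orbit C (scale C r s)"
  then obtain q where "q > 0" "t = scale C (q * r) s"
    by (auto simp: orbit_def liouville_coneD(3)[OF C])
  then show "t \<in> orbit C s" using r unfolding orbit_def by (intro CollectI exI[of _ "q * r"]) simp
next
  fix t assume "t \<in> orbit C s"
  then obtain q where "q > 0" "t = scale C q s" by (auto simp: orbit_def)
  then show "t \<in> orbit C (scale C r s)"
    using r unfolding orbit_def liouville_coneD(3)[OF C] by (intro CollectI exI[of _ "q / r"]) simp
qed

lemma orbit_eq_iff:
  assumes C: "liouville_cone C"
  shows "orbit C s = orbit C t \<longleftrightarrow> (\<exists>r>0. s = scale C r t)"
proof
  have "s \<in> orbit C s" unfolding orbit_def using liouville_coneD(2)[OF C]
    by (intro CollectI exI[of _ 1]) simp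
  moreover assume "orbit C s = orbit C t"
  ultimately show "\<exists>r>0. s = scale C r t" unfolding orbit_def by auto
qed (use orbit_scale[OF C] in auto)

abbreviation quotient_topology :: "('s, 'h::euclidean_space) cone \<Rightarrow> 's set topology" where
  "quotient_topology C \<equiv> atlas_topology (quotient_atlas C)"

lemma quotient_atlas_iff:
  "(V, y) \<in> quotient_atlas C \<longleftrightarrow>
    (\<exists>\<sigma>. y = (\<lambda>u. orbit C (\<sigma> u)) \<and> (V \<times> {0<..}, section_chart C \<sigma>) \<in> max_atlas (cone_atlas C))"
  by (auto simp: quotient_atlas_def section_chart_def)

text \<open>
  If \<open>\<sigma> u\<close> and \<open>\<tau> w\<close> lie on the same orbit, then a transition map between the two section charts
  is defined near \<open>(u, 1)\<close>, and its first component, restricted to \<open>r = 1\<close>, is the transition map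
  between the charts of the quotient.
\<close>

lemma diff_atlas_quotient:
  assumes C: "liouville_cone C"
  shows "diff_atlas (quotient_atlas C)"
proof (rule diff_atlasI)
  note dC = liouville_coneD(1)[OF C]
  have orb: "\<exists>r>0. section_chart C \<sigma> (u, 1) = section_chart C \<tau> (w, r)"
    if "orbit C (\<sigma> u) = orbit C (\<tau> w)" for \<sigma> \<tau> :: "'b \<Rightarrow> 'a" and u w
    using that by (simp add: orbit_eq_iff[OF C] liouville_coneD(2)[OF C])
  { fix V y assume "(V, y) \<in> quotient_atlas C"
    then obtain \<sigma> where \<sigma>: "y = (\<lambda>u. orbit C (\<sigma> u))"
        "(V \<times> {0<..}, section_chart C \<sigma>) \<in> max_atlas (cone_atlas C)"
      by (auto simp: quotient_atlas_iff)
    have "open (fst ` (V \<times> {0<..} :: (_ \<times> real) set))"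
      by (rule open_image_fst[OF max_atlasD(1)[OF \<sigma>(2)]])
    then show "open V" by simp
    show "inj_on y V"
    proof (rule inj_onI)
      fix u w assume uw: "u \<in> V" "w \<in> V" "y u = y w"
      then obtain r where "r > 0" "section_chart C \<sigma> (u, 1) = section_chart C \<sigma> (w, r)"
        using orb[of \<sigma> u \<sigma> w] \<sigma>(1) by auto
      then have "(u, 1) = (w, r)"
        using inj_onD[OF max_atlasD(2)[OF \<sigma>(2)], of "(u, 1)" "(w, r)"] uw(1,2) by simp
      then show "u = w" by simp
    qed }
  fix V y W z u w
  assume *: "(V, y) \<in> quotient_atlas C" "(W, z) \<in> quotient_atlas C" "u \<in> V" "w \<in> W" "y u = z w"
  obtain \<sigma> where \<sigma>: "y = (\<lambda>u. orbit C (\<sigma> u))"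
      "(V \<times> {0<..}, section_chart C \<sigma>) \<in> max_atlas (cone_atlas C)"
    using *(1) by (auto simp: quotient_atlas_iff)
  obtain \<tau> where \<tau>: "z = (\<lambda>u. orbit C (\<tau> u))"
      "(W \<times> {0<..}, section_chart C \<tau>) \<in> max_atlas (cone_atlas C)"
    using *(2) by (auto simp: quotient_atlas_iff)
  obtain r where r: "r > 0" "section_chart C \<sigma> (u, 1) = section_chart C \<tau> (w, r)"
    using orb[of \<sigma> u \<tau> w] \<sigma>(1) \<tau>(1) *(5) by auto
  have "change_at (V \<times> {0<..}) (section_chart C \<sigma>) (W \<times> {0<..}) (section_chart C \<tau>) (u, 1)"
    by (rule max_atlas_change[OF dC \<sigma>(2) \<tau>(2) _ _ r(2)]) (use * r(1) in auto)
  then obtain T \<phi> where T: "open T" "(u, 1) \<in> T" "T \<subseteq> V \<times> {0<..}" "smooth_on T \<phi>"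
      "\<And>t. t \<in> T \<Longrightarrow> \<phi> t \<in> W \<times> {0<..}"
      "\<And>t. t \<in> T \<Longrightarrow> section_chart C \<sigma> t = section_chart C \<tau> (\<phi> t)"
    unfolding change_at_def by blast
  let ?N = "{v \<in> UNIV. (v, 1) \<in> T}"
  have sm: "smooth_on UNIV (\<lambda>v. (v, 1::real))" by (intro smooth_intros) auto
  have N: "open ?N" by (rule open_preimage_smooth[OF open_UNIV sm T(1)])
  have smN: "smooth_on ?N (\<lambda>v. fst (\<phi> (v, 1)))"
    by (rule smooth_on_fst[OF N smooth_on_compose[OF N T(1) _ T(4)]])
       (use smooth_on_subset[OF sm] in auto)
  show "change_at V y W z u"
  proof (rule change_atI[OF N _ _ smN])
    fix v assume "v \<in> ?N"
    then have v: "(v, 1) \<in> T" by simp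
    obtain w' r' where w': "\<phi> (v, 1) = (w', r')" by (cases "\<phi> (v, 1)")
    then have "w' \<in> W" "r' > 0" using T(5)[OF v] by auto
    moreover have "\<sigma> v = scale C r' (\<tau> w')"
      using T(6)[OF v] w' liouville_coneD(2)[OF C] by simp
    ultimately show "fst (\<phi> (v, 1)) \<in> W" "y v = z (fst (\<phi> (v, 1)))"
      using w' by (auto simp: \<sigma>(1) \<tau>(1) orbit_scale[OF C])
  qed (use T(2,3) in auto)
qed

lemma contact_section_quotient_chart:
  assumes "contact_section C V \<sigma> a"
  shows "(V, \<lambda>u. orbit C (\<sigma> u)) \<in> quotient_atlas C"
  using assms by (auto simp: quotient_atlas_iff contact_section_def)

lemma contact_section_quotient_max:
  assumes "liouville_cone C" "contact_section C V \<sigma> a"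
  shows "(V, \<lambda>u. orbit C (\<sigma> u)) \<in> max_atlas (quotient_atlas C)"
  using contact_section_quotient_chart[OF assms(2)]
    atlas_subset_max_atlas[OF diff_atlas_quotient[OF assms(1)]]
  by blast

lemma points_quotient_atlas:
  assumes C: "liouville_cone C"
  shows "points (quotient_atlas C) = orbit C ` points (cone_atlas C)"
proof (intro equalityI subsetI)
  fix P assume "P \<in> points (quotient_atlas C)"
  then obtain V y u where y: "(V, y) \<in> quotient_atlas C" "u \<in> V" "P = y u" by (rule pointsE)
  obtain \<sigma> where \<sigma>: "y = (\<lambda>u. orbit C (\<sigma> u))"
      "(V \<times> {0<..}, section_chart C \<sigma>) \<in> max_atlas (cone_atlas C)"
    using y(1) by (auto simp: quotient_atlas_iff)
  have "section_chart C \<sigma> (u, 1) \<in> points (cone_atlas C)"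
    by (rule subsetD[OF max_atlasD(3)[OF \<sigma>(2)] imageI]) (use y(2) in simp)
  then show "P \<in> orbit C ` points (cone_atlas C)"
    using y(3) \<sigma>(1) liouville_coneD(2)[OF C] by auto
next
  fix P assume "P \<in> orbit C ` points (cone_atlas C)"
  then obtain s where s: "s \<in> points (cone_atlas C)" "P = orbit C s" by blast
  obtain V \<sigma> a u r where \<sigma>: "contact_section C V \<sigma> a" "u \<in> V" "r > 0" "s = scale C r (\<sigma> u)"
    using liouville_coneE[OF C s(1)] .
  have "P = orbit C (\<sigma> u)" using \<sigma>(3,4) s(2) by (simp add: orbit_scale[OF C])
  then show "P \<in> points (quotient_atlas C)"
    unfolding points_def using contact_section_quotient_chart[OF \<sigma>(1)] \<sigma>(2)
    by (intro UN_I[of "(V, \<lambda>u. orbit C (\<sigma> u))"]) auto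
qed

lemma quotient_pointE:
  assumes C: "liouville_cone C" and "P \<in> points (quotient_atlas C)"
  obtains V \<sigma> a u where "contact_section C V \<sigma> a" "u \<in> V" "P = orbit C (\<sigma> u)"
proof -
  obtain s where s: "s \<in> points (cone_atlas C)" "P = orbit C s"
    using assms(2) points_quotient_atlas[OF C] by blast
  obtain V \<sigma> a u r where "contact_section C V \<sigma> a" "u \<in> V" "r > 0" "s = scale C r (\<sigma> u)"
    using liouville_coneE[OF C s(1)] .
  then show thesis using that[of V \<sigma> a u] orbit_scale[OF C] s(2) by simp
qed

lemma contact_quotient_simps [simp]: "atlas (contact_quotient C) = quotient_atlas C"
  by (simp add: contact_quotient_def)

text \<open>
  By \<open>contact_section\<close> the 1-form of the cone at \<open>r \<cdot> \<sigma> u\<close> is \<open>r \<alpha>\<close>, and the projection to the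
  quotient is \<open>(u, r) \<mapsto> u\<close> in coordinates.  The hyperplane therefore does not depend on the point of the orbit at
  which it is computed.
\<close>

lemma hyperplane_contact_quotient:
  assumes C: "liouville_cone C" and \<sigma>: "contact_section C V \<sigma> a" and u: "u \<in> V"
  shows "hyperplane (contact_quotient C) (orbit C (\<sigma> u)) =
    {coord_vec (quotient_atlas C) (\<lambda>u. orbit C (\<sigma> u)) u h | h. a u \<bullet> h = 0}"
proof -
  note dC = liouville_coneD(1)[OF C] and dQ = diff_atlas_quotient[OF C]
  let ?X = "section_chart C \<sigma>" and ?y = "\<lambda>u. orbit C (\<sigma> u)"
  have X: "(V \<times> {0<..}, ?X) \<in> max_atlas (cone_atlas C)" using \<sigma> by (simp add: contact_section_def)
  note y = contact_section_quotient_max[OF C \<sigma>]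
  have push: "push (quotient_atlas C) (orbit C (\<sigma> u)) (orbit C)
    (coord_vec (cone_atlas C) ?X (u, r) (h, \<rho>))
      = coord_vec (quotient_atlas C) ?y u h" if "r > 0" for r h \<rho>
  proof -
    have "push (quotient_atlas C) (orbit C (?X (u, r))) (orbit C)
      (coord_vec (cone_atlas C) ?X (u, r) (h, \<rho>))
      = coord_vec (quotient_atlas C) ?y (fst (u, r)) (fst (h, \<rho>))"
    proof (rule push_coord_vec[OF dC X dQ y])
      show "(u, r) \<in> V \<times> {0<..}" using u that by simp
      show "smooth_on (V \<times> {0<..} :: (_ \<times> real) set) fst"
        by (intro smooth_on_linear linear_fst max_atlasD(1)[OF X])
      show "(fst has_derivative fst) (at (u, r))" by (auto intro!: derivative_eq_intros)
    qed (auto simp: orbit_scale[OF C])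
    then show ?thesis using that by (simp add: orbit_scale[OF C])
  qed
  have form: "form C (?X (u, r)) (coord_vec (cone_atlas C) ?X (u, r) (h, \<rho>)) = r * (a u \<bullet> h)"
    if "r > 0" for r h \<rho>
    using \<sigma> u that by (simp add: contact_section_def)
  have ts: "tangent_space (cone_atlas C) (?X (u, r)) = range (coord_vec (cone_atlas C) ?X (u, r))"
    if "r > 0" for r
    by (rule tangent_space_eq_coord_vec[OF dC X]) (use u that in simp)
  show ?thesis
  proof (intro equalityI subsetI)
    fix v assume "v \<in> hyperplane (contact_quotient C) (orbit C (\<sigma> u))"
    then obtain s w where sw: "v = push (quotient_atlas C) (orbit C (\<sigma> u)) (orbit C) w"
      "orbit C s = orbit C (\<sigma> u)" "w \<in> tangent_space (cone_atlas C) s" "form C s w = 0"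
      unfolding contact_quotient_def by auto
    obtain r where r: "r > 0" "s = ?X (u, r)" using sw(2) orbit_eq_iff[OF C] by auto
    obtain h \<rho> where w: "w = coord_vec (cone_atlas C) ?X (u, r) (h, \<rho>)"
      using sw(3) ts[OF r(1)] r(2) by auto
    have "a u \<bullet> h = 0" using sw(4) form[OF r(1)] r w by simp
    then show "v \<in> {coord_vec (quotient_atlas C) ?y u h | h. a u \<bullet> h = 0}"
      using push[OF r(1)] sw(1) w by auto
  next
    fix v assume "v \<in> {coord_vec (quotient_atlas C) ?y u h | h. a u \<bullet> h = 0}"
    then obtain h where h: "v = coord_vec (quotient_atlas C) ?y u h" "a u \<bullet> h = 0" by blast
    let ?w = "coord_vec (cone_atlas C) ?X (u, 1) (h, 0)"
    have "?X (u, 1) \<in> points (cone_atlas C)" using contact_section_points[OF \<sigma> u, of 1] by simp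
    moreover have "orbit C (?X (u, 1)) = orbit C (\<sigma> u)" by (simp add: orbit_scale[OF C])
    moreover have "?w \<in> tangent_space (cone_atlas C) (?X (u, 1))" using ts[of 1] by simp
    moreover have "form C (?X (u, 1)) ?w = 0" using form[of 1] h by simp
    moreover have "v = push (quotient_atlas C) (orbit C (\<sigma> u)) (orbit C) ?w" using push[of 1] h by simp
    ultimately show "v \<in> hyperplane (contact_quotient C) (orbit C (\<sigma> u))"
      unfolding contact_quotient_def contact.simps by blast
  qed
qed

lemma second_countable_quotient:
  assumes C: "liouville_cone C"
  shows "second_countable (quotient_topology C)"
proof -
  obtain K where K: "countable K" "\<forall>(V, \<sigma>, a)\<in>K. contact_section C V \<sigma> a"
      "points (cone_atlas C) \<subseteq> (\<Union>(V, \<sigma>, a)\<in>K. section_chart C \<sigma> ` (V \<times> {0<..}))"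
    using C unfolding liouville_cone_def by blast
  let ?L = "(\<lambda>(V, \<sigma>, a). (V, \<lambda>u. orbit C (\<sigma> u))) ` K"
  show ?thesis
  proof (rule second_countable_atlas_topology[OF diff_atlas_quotient[OF C]])
    show "countable ?L" using K(1) by simp
    show "?L \<subseteq> max_atlas (quotient_atlas C)"
      using K(2) contact_section_quotient_max[OF C] by fastforce
    show "points (quotient_atlas C) \<subseteq> (\<Union>(V, y)\<in>?L. y ` V)"
    proof
      fix P assume "P \<in> points (quotient_atlas C)"
      then obtain s where s: "s \<in> points (cone_atlas C)" "P = orbit C s"
        using points_quotient_atlas[OF C] by blast
      obtain V \<sigma> a where \<sigma>: "(V, \<sigma>, a) \<in> K" "s \<in> section_chart C \<sigma> ` (V \<times> {0<..})"
        using subsetD[OF K(3) s(1)] by (rule UN_E) (simp split: prod.splits)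
      then obtain u where "u \<in> V" "P = orbit C (\<sigma> u)" using s(2) orbit_scale[OF C] by auto
      then show "P \<in> (\<Union>(V, y)\<in>?L. y ` V)" using \<sigma>(1) by force
    qed
  qed
qed

lemma contact_manifold_contact_quotient:
  fixes C :: "('s, 'h::euclidean_space) cone"
  assumes C: "liouville_cone C" and "odd DIM('h)" and H: "Hausdorff_space (quotient_topology C)"
  shows "contact_manifold (contact_quotient C)"
proof -
  have "smooth_manifold (quotient_atlas C)"
    using diff_atlas_quotient[OF C] second_countable_quotient[OF C] H
    by (simp add: smooth_manifold_def diff_atlas_def)
  moreover have "\<exists>(V, x) \<in> max_atlas (quotient_atlas C). P \<in> x ` V \<and>
        (\<exists>a :: 'h \<Rightarrow> 'h. smooth_on V a \<and> (\<forall>u\<in>V.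
           a u \<noteq> 0 \<and>
           hyperplane (contact_quotient C) (x u) = {coord_vec (quotient_atlas C) x u h | h. a u \<bullet> h
             = 0} \<and>
           (\<forall>h. a u \<bullet> h = 0 \<and>
                (\<forall>k. a u \<bullet> k = 0 \<longrightarrow>
                   frechet_derivative a (at u) h \<bullet> k - frechet_derivative a (at u) k \<bullet> h = 0)
                \<longrightarrow> h = 0)))"
    if P: "P \<in> points (quotient_atlas C)" for P
  proof -
    obtain V \<sigma> a u where \<sigma>: "contact_section C V \<sigma> a" "u \<in> V" "P = orbit C (\<sigma> u)"
      using quotient_pointE[OF C P] .
    have "contact_form V a" using \<sigma>(1) by (simp add: contact_section_def)
    then show ?thesis
      unfolding contact_form_def
      using contact_section_quotient_max[OF C \<sigma>(1)] hyperplane_contact_quotient[OF C \<sigma>(1)] \<sigma>(2,3)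
      by (intro bexI[of _ "(V, \<lambda>u. orbit C (\<sigma> u))"]) auto
  qed
  ultimately show ?thesis using assms(2) unfolding contact_manifold_def by simp
qed

text \<open>
  The function \<open>f\<close> descends to the quotient, where preimages of open sets under it are open because
  they are so in section charts.
\<close>

lemma separate_orbits_by_invariant:
  assumes P: "liouville_cone P" and inv: "\<And>r p. r > 0 \<Longrightarrow> f (scale P r p) = f p"
    and chart: "\<And>p. p \<in> points (cone_atlas P) \<Longrightarrow> \<exists>V \<sigma> a u r. contact_section P V \<sigma> a \<and> u \<in> V \<and> r > 0 \<and>
      p = scale P r (\<sigma> u) \<and> (\<forall>U. openin T U \<longrightarrow> open {u \<in> V. f (\<sigma> u) \<in> U})"
    and T: "Hausdorff_space T" "f ` points (cone_atlas P) \<subseteq> topspace T"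
    and pq: "p \<in> points (cone_atlas P)" "q \<in> points (cone_atlas P)" "f p \<noteq> f q"
  shows "separated (quotient_topology P) (orbit P p) (orbit P q)"
proof -
  let ?lift = "\<lambda>U. orbit P ` {p \<in> points (cone_atlas P). f p \<in> U}"
  have f_orbit: "f p = f q" if "orbit P p = orbit P q" for p q
    using that inv orbit_eq_iff[OF P] by metis
  have lift_op: "openin (quotient_topology P) (?lift U)" if U: "openin T U" for U
  proof (rule openin_atlas_topologyI[OF diff_atlas_quotient[OF P]])
    fix A assume "A \<in> ?lift U"
    then obtain p where p: "p \<in> points (cone_atlas P)" "f p \<in> U" "A = orbit P p" by blast
    obtain V \<sigma> a u r where \<sigma>: "contact_section P V \<sigma> a" "u \<in> V" "r > 0" "p = scale P r (\<sigma> u)"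
      "open {u \<in> V. f (\<sigma> u) \<in> U}"
      using chart[OF p(1)] U by blast
    have "orbit P (\<sigma> v) \<in> ?lift U \<longleftrightarrow> f (\<sigma> v) \<in> U" if v: "v \<in> V" for v
    proof
      assume "orbit P (\<sigma> v) \<in> ?lift U"
      then obtain p where "f p \<in> U" "orbit P (\<sigma> v) = orbit P p" by blast
      then show "f (\<sigma> v) \<in> U" using f_orbit[of "\<sigma> v" p] by simp
    next
      have "\<sigma> v \<in> points (cone_atlas P)"
        using contact_section_points[OF \<sigma>(1) v, of 1] liouville_coneD(2)[OF P] by simp
      moreover assume "f (\<sigma> v) \<in> U"
      ultimately show "orbit P (\<sigma> v) \<in> ?lift U" by blast
    qed
    then have "{u \<in> V. orbit P (\<sigma> u) \<in> ?lift U} = {u \<in> V. f (\<sigma> u) \<in> U}"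
      by (rule Collect_cong[OF conj_cong[OF refl]])
    moreover have "A \<in> (\<lambda>u. orbit P (\<sigma> u)) ` V"
      using \<sigma>(2-4) p(3) orbit_scale[OF P] by auto
    ultimately show "\<exists>V x. (V, x) \<in> max_atlas (quotient_atlas P) \<and> A \<in> x ` V \<and>
      open {u \<in> V. x u \<in> ?lift U}"
      using contact_section_quotient_max[OF P \<sigma>(1)] \<sigma>(5)
      by (intro exI[of _ V] exI[of _ "\<lambda>u. orbit P (\<sigma> u)"]) simp
  qed
  have "f p \<in> topspace T" "f q \<in> topspace T" using T(2) pq(1,2) by auto
  then obtain U U' where U: "openin T U" "openin T U'" "f p \<in> U" "f q \<in> U'" "disjnt U U'"
    using T(1)[unfolded Hausdorff_space_def, rule_format, of "f p" "f q"] pq(3) by auto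
  have "disjnt (?lift U) (?lift U')"
  proof (rule ccontr)
    assume "\<not> ?thesis"
    then obtain p q where "f p \<in> U" "f q \<in> U'" "orbit P p = orbit P q"
      unfolding disjnt_def by blast
    then show False using f_orbit[of p q] U(5) by (auto simp: disjnt_iff)
  qed
  then show ?thesis using lift_op[OF U(1)] lift_op[OF U(2)] U(3,4) pq by blast
qed

lemma prod_cone_pointE:
  assumes C: "liouville_cone C" and D: "liouville_cone D" and p: "p \<in>
    points (cone_atlas (prod_cone C D))"
  obtains V \<sigma> a W \<tau> b u w r \<rho> where "contact_section C V \<sigma> a" "contact_section D W \<tau> b"
    "u \<in> V" "w \<in> W" "r > 0" "\<rho> > 0" "p = (scale C r (\<sigma> u), scale D \<rho> (\<tau> w))"
proof -
  obtain s t where st: "p = (s, t)" "s \<in> points (cone_atlas C)" "t \<in> points (cone_atlas D)"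
    using p unfolding points_prod_cone by auto
  obtain V \<sigma> a u r where "contact_section C V \<sigma> a" "u \<in> V" "r > 0" "s = scale C r (\<sigma> u)"
    using liouville_coneE[OF C st(2)] .
  moreover obtain W \<tau> b w \<rho> where "contact_section D W \<tau> b" "w \<in> W" "\<rho> > 0" "t = scale D \<rho> (\<tau> w)"
    using liouville_coneE[OF D st(3)] .
  ultimately show thesis using that st(1) by blast
qed

lemma scale_product_section:
  assumes "liouville_cone C" "\<rho> > 0"
  shows "(scale C r (\<sigma> u), scale D \<rho> (\<tau> w)) =
    scale (prod_cone C D) \<rho> (product_section C \<sigma> \<tau> (u, w, r / \<rho>))"
  using assms(2) by (simp add: product_section_def liouville_coneD(3)[OF assms(1)])

lemma separate_product_orbits_by_invariant:
  assumes C: "liouville_cone C" and D: "liouville_cone D"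
    and inv: "\<And>r p. r > 0 \<Longrightarrow> f (scale (prod_cone C D) r p) = f p"
    and op: "\<And>V \<sigma> a W \<tau> b U. contact_section C V \<sigma> a \<Longrightarrow> contact_section D W \<tau> b \<Longrightarrow> openin T U \<Longrightarrow>
      open {v \<in> V \<times> W \<times> {0<..}. f (product_section C \<sigma> \<tau> v) \<in> U}"
    and T: "Hausdorff_space T" "f ` points (cone_atlas (prod_cone C D)) \<subseteq> topspace T"
    and pq: "p \<in> points (cone_atlas (prod_cone C D))" "q \<in> points (cone_atlas (prod_cone C D))"
      "f p \<noteq> f q"
  shows "separated (quotient_topology (prod_cone C D)) (orbit (prod_cone C D) p)
    (orbit (prod_cone C D) q)"
proof (rule separate_orbits_by_invariant[OF liouville_cone_prod[OF C D] inv _ T pq])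
  fix p assume "p \<in> points (cone_atlas (prod_cone C D))"
  then obtain V \<sigma> a W \<tau> b u w r \<rho> where *: "contact_section C V \<sigma> a" "contact_section D W \<tau> b"
    "u \<in> V" "w \<in> W" "r > 0" "\<rho> > 0" "p = (scale C r (\<sigma> u), scale D \<rho> (\<tau> w))"
    by (rule prod_cone_pointE[OF C D])
  show "\<exists>V \<sigma> a u r. contact_section (prod_cone C D) V \<sigma> a \<and> u \<in> V \<and> r > 0 \<and>
      p = scale (prod_cone C D) r (\<sigma> u) \<and> (\<forall>U. openin T U \<longrightarrow> open {u \<in> V. f (\<sigma> u) \<in> U})"
    using * op[OF *(1,2)] contact_section_prod[OF C *(1) D *(2)] scale_product_section[OF C *(6)]
    by (intro exI[of _ "V \<times> W \<times> {0<..}"] exI[of _ "product_section C \<sigma> \<tau>"] exI[of _ "product_form a b"]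
        exI[of _ "(u, w, r / \<rho>)"] exI[of _ \<rho>]) (simp del: prod_cone_simps)
qed

text \<open>
  Two orbits of \<open>C \<times> D\<close> whose projections to the quotient of \<open>C\<close>, or to that of \<open>D\<close>, differ are
  separated there.  Otherwise their points differ only by the relative scale of the components, so
  both orbits lie in the domain of one chart.
\<close>

lemma Hausdorff_quotient_prod:
  assumes C: "liouville_cone C" "Hausdorff_space (quotient_topology C)"
    and D: "liouville_cone D" "Hausdorff_space (quotient_topology D)"
  shows "Hausdorff_space (quotient_topology (prod_cone C D))"
proof -
  let ?P = "prod_cone C D"
  note P = liouville_cone_prod[OF C(1) D(1)]
  note dQ = diff_atlas_quotient[OF P] and dC = diff_atlas_quotient[OF C(1)] and dD
    = diff_atlas_quotient[OF D(1)]
  have "separated (quotient_topology ?P) (orbit ?P p) (orbit ?P q)"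
    if pq: "p \<in> points (cone_atlas ?P)" "q \<in> points (cone_atlas ?P)" "orbit ?P p \<noteq> orbit ?P q" for p q
  proof -
    consider "orbit C (fst p) \<noteq> orbit C (fst q)" | "orbit D (snd p) \<noteq> orbit D (snd q)"
      | "orbit C (fst q) = orbit C (fst p)" "orbit D (snd q) = orbit D (snd p)" by metis
    then show ?thesis
    proof cases
      case 1
      show ?thesis
      proof (rule separate_product_orbits_by_invariant[OF C(1) D(1) _ _ C(2) _ pq(1,2) 1])
        fix V \<sigma> a W \<tau> b U
        assume *: "contact_section C V \<sigma> a" "contact_section D W \<tau> b" "openin (quotient_topology C) U"
        have "{v \<in> V \<times> W \<times> {0<..}. orbit C (fst (product_section C \<sigma> \<tau> v)) \<in> U}
            = {h \<in> V. orbit C (\<sigma> h) \<in> U} \<times> W \<times> {0<..}"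
          by (auto simp: product_section_def orbit_scale[OF C(1)])
        then show "open {v \<in> V \<times> W \<times> {0<..}. orbit C (fst (product_section C \<sigma> \<tau> v)) \<in> U}"
          using open_chart_preimage[OF dC contact_section_quotient_max[OF C(1) *(1)] *(3)]
            open_section_domain[OF *(2)] by (simp add: open_Times)
      qed (auto simp: orbit_scale[OF C(1)] topspace_atlas_topology[OF dC] points_quotient_atlas[OF C(1)]
          simp del: prod_cone_simps(1))
    next
      case 2
      show ?thesis
      proof (rule separate_product_orbits_by_invariant[OF C(1) D(1) _ _ D(2) _ pq(1,2) 2])
        fix V \<sigma> a W \<tau> b U
        assume *: "contact_section C V \<sigma> a" "contact_section D W \<tau> b" "openin (quotient_topology D) U"
        have "{v \<in> V \<times> W \<times> {0<..}. orbit D (snd (product_section C \<sigma> \<tau> v)) \<in> U}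
            = V \<times> {k \<in> W. orbit D (\<tau> k) \<in> U} \<times> {0<..}"
          by (auto simp: product_section_def)
        then show "open {v \<in> V \<times> W \<times> {0<..}. orbit D (snd (product_section C \<sigma> \<tau> v)) \<in> U}"
          using open_chart_preimage[OF dD contact_section_quotient_max[OF D(1) *(2)] *(3)]
            open_section_domain[OF *(1)] by (simp add: open_Times)
      qed (auto simp: orbit_scale[OF D(1)] topspace_atlas_topology[OF dD] points_quotient_atlas[OF D(1)]
          simp del: prod_cone_simps(1))
    next
      case 3
      obtain V \<sigma> a W \<tau> b u w r \<rho> where *: "contact_section C V \<sigma> a" "contact_section D W \<tau> b"
        "u \<in> V" "w \<in> W" "r > 0" "\<rho> > 0" "p = (scale C r (\<sigma> u), scale D \<rho> (\<tau> w))"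
        by (rule prod_cone_pointE[OF C(1) D(1) pq(1)])
      obtain r' \<rho>' where r': "r' > 0" "\<rho>' > 0" "fst q = scale C r' (fst p)" "snd q = scale D \<rho>' (snd p)"
        using 3 orbit_eq_iff[OF C(1)] orbit_eq_iff[OF D(1)] by auto
      have q: "q = (scale C (r' * r) (\<sigma> u), scale D (\<rho>' * \<rho>) (\<tau> w))"
        using r'(3,4) *(7) liouville_coneD(3)[OF C(1)] liouville_coneD(3)[OF D(1)]
          by (intro prod_eqI) auto
      let ?y = "\<lambda>v. orbit ?P (product_section C \<sigma> \<tau> v)"
      let ?v = "(u, w, r / \<rho>)" and ?v' = "(u, w, r' * r / (\<rho>' * \<rho>))"
      have "orbit ?P p = ?y ?v" "orbit ?P q = ?y ?v'"
        using *(7) q scale_product_section[OF C(1)] orbit_scale[OF P] *(6) r'(2)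
          by (metis mult_pos_pos)+
      moreover have "?v \<in> V \<times> W \<times> {0<..}" "?v' \<in> V \<times> W \<times> {0<..}" using * r' by auto
      moreover have "?v \<noteq> ?v'" using calculation(1,2) pq(3) by metis
      ultimately show ?thesis
        using separate_in_chart[OF dQ
          contact_section_quotient_max[OF P contact_section_prod[OF C(1) *(1) D(1) *(2)]]]
        by metis
    qed
  qed
  then show ?thesis
    unfolding Hausdorff_space_def topspace_atlas_topology[OF dQ] points_quotient_atlas[OF P] by blast
qed

section \<open>The cotangent bundle and its submanifolds\<close>

lemma coord_covec_apply:
  assumes "diff_atlas A" "(V, x) \<in> max_atlas A" "u \<in> V"
  shows "coord_covec A x u w (coord_vec A x u h) = w \<bullet> h"
proof -
  have "(THE k. coord_vec A x u h = coord_vec A x u k) = h"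
    using coord_vec_inject[OF assms] by (intro the_equality) auto
  then show ?thesis
    by (simp add: coord_covec_def tangent_space_eq_coord_vec[OF assms])
qed

lemma coord_covec_outside: "v \<notin> tangent_space A (x u) \<Longrightarrow> coord_covec A x u w v = 0"
  by (simp add: coord_covec_def)

text \<open>
  Covectors are functions on all functionals, so their vanishing outside the tangent space
  is part of equality.
\<close>

lemma covec_eqI:
  assumes "diff_atlas A" "(V, x) \<in> max_atlas A" "u \<in> V"
    and "\<And>h. \<beta> (coord_vec A x u h) = \<gamma> (coord_vec A x u h)"
    and "\<And>v. v \<notin> tangent_space A (x u) \<Longrightarrow> \<beta> v = 0" "\<And>v. v \<notin> tangent_space A (x u) \<Longrightarrow> \<gamma> v = (0::real)"
  shows "\<beta> = \<gamma>"
proof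
  fix v show "\<beta> v = \<gamma> v"
  proof (cases "v \<in> tangent_space A (x u)")
    case True
    then show ?thesis using assms(4) unfolding tangent_space_eq_coord_vec[OF assms(1-3)] by auto
  qed (simp add: assms(5,6))
qed

lemma coord_covec_scale: "coord_covec A x u (r *\<^sub>R w) = (\<lambda>v. r * coord_covec A x u w v)"
  by (auto simp: coord_covec_def)

lemma coord_covec_inject:
  assumes "diff_atlas A" "(V, x) \<in> max_atlas A" "u \<in> V" "coord_covec A x u w = coord_covec A x u w'"
  shows "w = w'"
proof -
  have "w \<bullet> h = w' \<bullet> h" for h
    using coord_covec_apply[OF assms(1-3), of w h] coord_covec_apply[OF assms(1-3), of w' h] assms(4)
      by simp
  then show ?thesis by (metis vector_eq_rdot)
qed

lemma functional_eq_inner: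
  fixes L :: "'e::euclidean_space \<Rightarrow> real"
  assumes "linear L"
  shows "(\<Sum>b\<in>Basis. L b *\<^sub>R b) \<bullet> h = L h"
proof -
  have "L h = L (\<Sum>b\<in>Basis. (h \<bullet> b) *\<^sub>R b)" by (simp add: euclidean_representation)
  also have "\<dots> = (\<Sum>b\<in>Basis. (h \<bullet> b) * L b)" by (simp add: linear_sum[OF assms] linear_scale[OF assms])
  also have "\<dots> = (\<Sum>b\<in>Basis. L b *\<^sub>R b) \<bullet> h"
    by (simp add: inner_sum_left inner_commute[of h] mult.commute)
  finally show ?thesis by simp
qed

lemma cotangent_space_eq_coord_covec:
  assumes A: "diff_atlas A" "(V, x) \<in> max_atlas A" "u \<in> V"
  shows "cotangent_space A (x u) = range (coord_covec A x u)"
proof (intro equalityI subsetI)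
  fix \<beta> assume "\<beta> \<in> cotangent_space A (x u)"
  then have \<beta>: "\<And>h k. \<beta> (\<lambda>f. coord_vec A x u h f + coord_vec A x u k f) = \<beta> (coord_vec A x u h) + \<beta>
    (coord_vec A x u k)"
    "\<And>r h. \<beta> (\<lambda>f. r * coord_vec A x u h f) = r * \<beta> (coord_vec A x u h)"
    "\<And>v. v \<notin> tangent_space A (x u) \<Longrightarrow> \<beta> v = 0"
    unfolding cotangent_space_def tangent_space_eq_coord_vec[OF A] by auto
  define L where "L h = \<beta> (coord_vec A x u h)" for h
  have "linear L"
    unfolding linear_iff L_def coord_vec_add[OF A] coord_vec_scale[OF A] \<beta>(1,2) by simp
  have "\<beta> = coord_covec A x u (\<Sum>b\<in>Basis. L b *\<^sub>R b)"
    by (rule covec_eqI[OF A _ \<beta>(3) coord_covec_outside])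
       (simp_all add: coord_covec_apply[OF A] functional_eq_inner[OF \<open>linear L\<close>], simp add: L_def)
  then show "\<beta> \<in> range (coord_covec A x u)" by blast
next
  fix \<beta> assume "\<beta> \<in> range (coord_covec A x u)"
  then obtain w where w: "\<beta> = coord_covec A x u w" by blast
  show "\<beta> \<in> cotangent_space A (x u)"
    unfolding cotangent_space_def w using coord_covec_outside[of _ A x u w]
    by (auto simp: tangent_space_eq_coord_vec[OF A] coord_vec_add[OF A, symmetric]
      coord_vec_scale[OF A, symmetric]
        coord_covec_apply[OF A] inner_add_right)
qed

lemma coord_vec_change:
  assumes A: "diff_atlas A" and x: "(V, x) \<in> max_atlas A" and y: "(W, y) \<in> max_atlas A"
    and T: "open T" "T \<subseteq> V" "smooth_on T \<phi>" "\<And>t. t \<in> T \<Longrightarrow> \<phi> t \<in> W" "\<And>t. t \<in> T \<Longrightarrow> x t = y (\<phi> t)"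
    and u: "u \<in> T"
  shows "coord_vec A x u h = coord_vec A y (\<phi> u) (frechet_derivative \<phi> (at u) h)"
proof -
  have xT: "(T, x) \<in> max_atlas A" by (rule max_atlas_restrict[OF A x T(1,2)])
  have "push A (id (x u)) id (coord_vec A x u h) = coord_vec A y (\<phi> u) (frechet_derivative \<phi> (at u) h)"
    by (rule push_coord_vec[OF A xT A y u T(3,4)]) (auto simp: T(5)
      smooth_on_has_derivative[OF T(1,3) u])
  moreover have "push A (id (x u)) id (coord_vec A x u h) = coord_vec A x u h"
    by (auto simp: push_def coord_vec_eq[OF A xT u])
  ultimately show ?thesis by simp
qed

text \<open>
  The transpose of the derivative of \<open>\<psi>\<close> at \<open>v\<close>, applied to \<open>w\<close>.
\<close>

definition pullback_covec :: "('e::euclidean_space \<Rightarrow> 'e) \<Rightarrow> 'e \<Rightarrow> 'e \<Rightarrow> 'e" where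
  "pullback_covec \<psi> v w = (\<Sum>b\<in>Basis. (w \<bullet> frechet_derivative \<psi> (at v) b) *\<^sub>R b)"

lemma coord_covec_change:
  assumes A: "diff_atlas A" and x: "(V, x) \<in> max_atlas A" and y: "(W, y) \<in> max_atlas A"
    and T: "open T" "T \<subseteq> W" "smooth_on T \<psi>" "\<And>t. t \<in> T \<Longrightarrow> \<psi> t \<in> V" "\<And>t. t \<in> T \<Longrightarrow> y t = x (\<psi> t)"
    and v: "v \<in> T"
  shows "coord_covec A x (\<psi> v) w = coord_covec A y v (pullback_covec \<psi> v w)"
proof (rule covec_eqI[OF A y])
  show "v \<in> W" using v T(2) by auto
  have lin: "linear (\<lambda>k. w \<bullet> frechet_derivative \<psi> (at v) k)"
    using has_derivative_linear[OF smooth_on_has_derivative[OF T(1,3) v]]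
    by (auto simp: linear_iff inner_add_right)
  fix h
  have "coord_covec A y v (pullback_covec \<psi> v w) (coord_vec A y v h) = w \<bullet> frechet_derivative \<psi> (at v)
    h"
    unfolding coord_covec_apply[OF A y \<open>v \<in> W\<close>] pullback_covec_def functional_eq_inner[OF lin] ..
  also have "\<dots> = coord_covec A x (\<psi> v) w (coord_vec A x (\<psi> v) (frechet_derivative \<psi> (at v) h))"
    by (rule coord_covec_apply[OF A x T(4)[OF v], symmetric])
  also have "coord_vec A x (\<psi> v) (frechet_derivative \<psi> (at v) h) = coord_vec A y v h"
    by (rule coord_vec_change[OF A y x T v, symmetric])
  finally show "coord_covec A x (\<psi> v) w (coord_vec A y v h) = coord_covec A y v (pullback_covec \<psi> v w)
    (coord_vec A y v h)"
    by (rule sym)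
qed (auto simp: coord_covec_outside T(5)[OF v] coord_covec_outside[of _ A y v])

definition covec_chart :: "('a, 'e::euclidean_space) atlas \<Rightarrow> ('e \<Rightarrow> 'a) \<Rightarrow> 'e \<times> 'e \<Rightarrow> 'a \<times> 'a covec" where
  "covec_chart A x = (\<lambda>(u, w). (x u, coord_covec A x u w))"

lemma cotangent_bundle_eq: "cotangent_bundle A = {(V \<times> UNIV, covec_chart A x) | V x. (V, x) \<in> A}"
  by (simp add: cotangent_bundle_def covec_chart_def)

text \<open>
  The transition map is \<open>(t, z) \<mapsto> (\<phi> t, D\<psi>(\<phi> t)\<^sup>T z)\<close> with \<open>\<psi>\<close> the local inverse of \<open>\<phi>\<close>; it is smooth
  because its components are inner products of \<open>z\<close> with directional derivatives of \<open>\<psi>\<close>.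
\<close>

lemma covec_chart_change:
  fixes A :: "('a, 'e::euclidean_space) atlas"
  assumes A: "diff_atlas A" and x: "(V, x) \<in> max_atlas A" and y: "(W, y) \<in> max_atlas A"
    and u: "u \<in> V" "v \<in> W" "x u = y v"
  shows "change_at (V \<times> UNIV) (covec_chart A x) (W \<times> UNIV) (covec_chart A y) (u, w)"
proof -
  obtain T \<phi> where T: "open T" "u \<in> T" "T \<subseteq> V" "smooth_on T \<phi>" "\<And>t. t \<in> T \<Longrightarrow> \<phi> t \<in> W"
      "\<And>t. t \<in> T \<Longrightarrow> x t = y (\<phi> t)"
    using max_atlas_change[OF A x y u] unfolding change_at_def by blast
  obtain S \<psi> where S: "open S" "v \<in> S" "S \<subseteq> W" "smooth_on S \<psi>" "\<And>t. t \<in> S \<Longrightarrow> \<psi> t \<in> V"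
      "\<And>t. t \<in> S \<Longrightarrow> y t = x (\<psi> t)"
    using max_atlas_change[OF A y x u(2,1) u(3)[symmetric]] unfolding change_at_def by blast
  have "\<phi> u = v"
    by (rule inj_onD[OF max_atlasD(2)[OF y]]) (use T(2,5,6) u in auto)
  let ?N = "{t \<in> T. \<phi> t \<in> S}"
  have N: "open ?N" by (rule open_preimage_smooth[OF T(1,4) S(1)])
  have NU: "open (?N \<times> (UNIV :: 'e set))" by (intro open_Times N open_UNIV)
  have sm: "smooth_on (?N \<times> (UNIV :: 'e set)) (\<lambda>p. \<phi> (fst p))"
    by (rule smooth_on_compose[OF NU T(1) _ T(4)]) (auto intro!: smooth_intros NU)
  have smN: "smooth_on (?N \<times> UNIV) (\<lambda>p. (\<phi> (fst p), pullback_covec \<psi> (\<phi> (fst p)) (snd p)))"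
    unfolding pullback_covec_def
    by (intro smooth_intros NU sm
      smooth_on_compose[OF NU S(1) sm smooth_on_frechet_derivative[OF S(4)]]) auto
  show ?thesis
  proof (rule change_atI[OF NU _ _ smN])
    show "(u, w) \<in> ?N \<times> UNIV" using T(2) S(2) \<open>\<phi> u = v\<close> by simp
    fix p assume "p \<in> ?N \<times> (UNIV :: 'e set)"
    then obtain t z where p: "p = (t, z)" "t \<in> T" "\<phi> t \<in> S" by auto
    have "\<psi> (\<phi> t) = t"
      by (rule inj_onD[OF max_atlasD(2)[OF x]]) (use T(3,6) S(5,6) p in auto)
    then show "covec_chart A x p = covec_chart A y (\<phi> (fst p), pullback_covec \<psi> (\<phi> (fst p)) (snd p))"
      using coord_covec_change[OF A x y S(1,3,4,5,6) p(3), of z] T(6) p by (simp add: covec_chart_def)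
  qed (use T S in auto)
qed

lemma inj_on_covec_chart:
  assumes "diff_atlas A" "(V, x) \<in> max_atlas A"
  shows "inj_on (covec_chart A x) (V \<times> UNIV)"
  using max_atlasD(2)[OF assms(2)] coord_covec_inject[OF assms]
  by (auto simp: inj_on_def covec_chart_def)

text \<open>
  Contact charts are only required to lie in the maximal atlas of \<open>Q\<close>; by this lemma they still
  induce charts of the cotangent bundle.
\<close>

lemma cotangent_bundle_coherent:
  fixes A :: "('a, 'e::euclidean_space) atlas"
  assumes A: "diff_atlas A"
  shows "diff_atlas (cotangent_bundle A) \<and>
      {(V \<times> (UNIV :: 'e set), covec_chart A x) | V x. (V, x) \<in> max_atlas
        A} \<subseteq> max_atlas (cotangent_bundle A)"
proof (rule coherent_charts)
  let ?\<Gamma> = "{(V \<times> (UNIV :: 'e set), covec_chart A x) | V x. (V, x) \<in> max_atlas A}"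
  have max: "(V, x) \<in> A \<Longrightarrow> (V, x) \<in> max_atlas A" for V x using atlas_subset_max_atlas[OF A] by auto
  then show "cotangent_bundle A \<subseteq> ?\<Gamma>" by (auto simp: cotangent_bundle_eq)
  fix V x assume "(V, x) \<in> ?\<Gamma>"
  then obtain V0 x0 where x0: "(V0, x0) \<in> max_atlas A" "V = V0 \<times> UNIV" "x = covec_chart A x0" by auto
  have "covec_chart A x0 (u, z) \<in> points (cotangent_bundle A)" if u: "u \<in> V0" for u z
  proof -
    obtain W y v where y: "(W, y) \<in> A" "v \<in> W" "x0 u = y v" using max_atlas_pointE[OF x0(1) u] .
    have "coord_covec A x0 u z \<in> cotangent_space A (y v)"
      using cotangent_space_eq_coord_covec[OF A x0(1) u] y(3) by auto
    then obtain z' where "coord_covec A x0 u z = coord_covec A y v z'"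
      using cotangent_space_eq_coord_covec[OF A max[OF y(1)] y(2)] by auto
    then have "covec_chart A x0 (u, z) = covec_chart A y (v, z')" by (simp add: covec_chart_def y(3))
    moreover have "(W \<times> UNIV, covec_chart A y) \<in> cotangent_bundle A" using y(1)
      by (auto simp: cotangent_bundle_eq)
    ultimately show ?thesis
      unfolding points_def using y(2) by (intro UN_I[of "(W \<times> UNIV, covec_chart A y)"]) auto
  qed
  then show "open V \<and> inj_on x V \<and> x ` V \<subseteq> points (cotangent_bundle A)"
    using inj_on_covec_chart[OF A x0(1)] open_Times[OF max_atlasD(1)[OF x0(1)] open_UNIV] x0(2,3)
      by auto
  fix W y u w assume "(W, y) \<in> ?\<Gamma>" and uw: "u \<in> V" "w \<in> W" "x u = y w"
  then obtain W0 y0 where y0: "(W0, y0) \<in> max_atlas A" "W = W0 \<times> UNIV" "y = covec_chart A y0" by auto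
  obtain u1 u2 w1 w2 where "u = (u1, u2)" "w = (w1, w2)" by (metis surj_pair)
  then show "change_at V x W y u"
    using covec_chart_change[OF A x0(1) y0(1), of u1 w1 u2] uw x0(2,3) y0(2,3)
      by (simp add: covec_chart_def[of A])
qed

lemmas diff_atlas_cotangent_bundle = cotangent_bundle_coherent[THEN conjunct1]

lemma max_atlas_cotangent_bundle:
  assumes "diff_atlas A" "(V, x) \<in> max_atlas A"
  shows "(V \<times> UNIV, covec_chart A x) \<in> max_atlas (cotangent_bundle A)"
  using cotangent_bundle_coherent[OF assms(1)] assms(2) by blast

lemma sub_atlas_chart:
  fixes x :: "'f::euclidean_space \<Rightarrow> 'a"
  assumes "(V, x) \<in> sub_atlas B S"
  shows "\<exists>V0 x0 j. (V0, x0) \<in> max_atlas B \<and> linear j \<and> inj j \<and> V = j -` V0 \<and> x = x0 \<circ> j \<and>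
    x0 ` (V0 \<inter> range j) = S \<inter> x0 ` V0"
  using assms unfolding sub_atlas_def mem_Collect_eq prod.inject by (elim exE conjE) (intro exI conjI)

text \<open>
  On the slice \<open>range j\<close> the ambient transition map takes values in the slice \<open>range i\<close>, where a linear
  left inverse \<open>i'\<close> of \<open>i\<close> recovers the coordinates.
\<close>

lemma diff_atlas_sub_atlas:
  fixes B :: "('a, 'e::euclidean_space) atlas" and S :: "'a set"
  assumes B: "diff_atlas B"
  shows "diff_atlas (sub_atlas B S :: ('a, 'f::euclidean_space) atlas)"
proof (rule diff_atlasI)
  fix V and x :: "'f \<Rightarrow> 'a" assume "(V, x) \<in> sub_atlas B S"
  from sub_atlas_chart[OF this]
  obtain V0 x0 j where x0: "(V0, x0) \<in> max_atlas B" "linear j" "inj j" "V = j -` V0" "x = x0 \<circ> j"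
    "x0 ` (V0 \<inter> range j) = S \<inter> x0 ` V0" by (elim exE conjE)
  show "open V" unfolding x0(4) by (rule open_vimage_linear[OF x0(2) max_atlasD(1)[OF x0(1)]])
  show "inj_on x V"
    using max_atlasD(2)[OF x0(1)] x0(3) unfolding x0(4,5) by (auto simp: inj_on_def)
  fix W u w and y :: "'f \<Rightarrow> 'a"
  assume "(W, y) \<in> sub_atlas B S" and *: "u \<in> V" "w \<in> W" "x u = y w"
  from sub_atlas_chart[OF this(1)] obtain W0 y0 i
    where y0: "(W0, y0) \<in> max_atlas B" "linear i" "inj i" "W = i -` W0" "y = y0 \<circ> i"
    "y0 ` (W0 \<inter> range i) = S \<inter> y0 ` W0" by (elim exE conjE)
  obtain i' where i': "linear i'" "i' \<circ> i = id" using linear_injective_left_inverse[OF y0(2,3)] by blast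
  have "change_at V0 x0 W0 y0 (j u)"
    by (rule max_atlas_change[OF B x0(1) y0(1), of _ "i w"]) (use * x0(4,5) y0(4,5) in auto)
  then obtain T \<phi> where T: "open T" "j u \<in> T" "T \<subseteq> V0" "smooth_on T \<phi>" "\<And>t. t \<in> T \<Longrightarrow> \<phi> t \<in> W0"
      "\<And>t. t \<in> T \<Longrightarrow> x0 t = y0 (\<phi> t)"
    unfolding change_at_def by blast
  have op: "open (j -` T)" by (rule open_vimage_linear[OF x0(2) T(1)])
  have sm: "smooth_on (j -` T) (\<lambda>t. i' (\<phi> (j t)))"
    by (rule smooth_on_linear_compose[OF i'(1) op
      smooth_on_compose[OF op T(1) smooth_on_linear[OF op x0(2)] T(4)]])
       auto
  have ii': "i (i' (\<phi> (j t))) = \<phi> (j t)" if t: "j t \<in> T" for t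
  proof -
    have "x0 (j t) \<in> x0 ` (V0 \<inter> range j)" using t T(3) by auto
    then have "x0 (j t) \<in> S" using x0(6) by blast
    then have "y0 (\<phi> (j t)) \<in> S \<inter> y0 ` W0" using T(5,6) t by auto
    then obtain q where q: "q \<in> W0" "q \<in> range i" "y0 (\<phi> (j t)) = y0 q" using y0(6) by blast
    then have "\<phi> (j t) \<in> range i" using inj_onD[OF max_atlasD(2)[OF y0(1)], of "\<phi> (j t)" q] T(5)[OF t]
      by simp
    then show ?thesis using i'(2) by (metis comp_apply id_apply imageE)
  qed
  show "change_at V x W y u"
    by (rule change_atI[OF op _ _ sm]) (use T ii' x0(4,5) y0(4,5) in auto)
qed

section \<open>Symplectizations\<close>

text \<open>
  The component of the contact form along a fixed basis vector \<open>b\<close> is required not to vanish.  This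
  can be achieved by shrinking any chart, and it makes it possible to straighten the line bundle spanned
  by the contact form with explicit formulas (\<open>symp_slice_chart\<close>).
\<close>

definition contact_chart ::
  "('a, 'e::euclidean_space) contact \<Rightarrow> 'e set \<Rightarrow> ('e \<Rightarrow> 'a) \<Rightarrow> ('e \<Rightarrow> 'e) \<Rightarrow> 'e \<Rightarrow> bool" where
  "contact_chart Q V x a b \<longleftrightarrow> (V, x) \<in> max_atlas (atlas Q) \<and> contact_form V a \<and> b \<in> Basis \<and>
     (\<forall>u\<in>V. a u \<bullet> b \<noteq> 0 \<and> hyperplane Q (x u) = {coord_vec (atlas Q) x u h | h. a u \<bullet> h = 0})"

lemma contact_form_subset: "contact_form V a \<Longrightarrow> U \<subseteq> V \<Longrightarrow> contact_form U a"
  unfolding contact_form_def using smooth_on_subset by (meson subsetD)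

lemma contact_manifold_diff_atlas: "contact_manifold Q \<Longrightarrow> diff_atlas (atlas Q)"
  by (simp add: contact_manifold_def smooth_manifold_diff_atlas)

lemma ex_contact_chart:
  assumes Q: "contact_manifold Q" and p: "p \<in> points (atlas Q)"
  shows "\<exists>V x a b u. contact_chart Q V x a b \<and> u \<in> V \<and> p = x u"
proof -
  obtain c where c: "c \<in> max_atlas (atlas Q)"
    "case c of (V, x) \<Rightarrow> p \<in> x ` V \<and> (\<exists>a. smooth_on V a \<and> (\<forall>u\<in>V.
      a u \<noteq> 0 \<and> hyperplane Q (x u) = {coord_vec (atlas Q) x u h | h. a u \<bullet> h = 0} \<and>
      (\<forall>h. a u \<bullet> h = 0 \<and> (\<forall>k. a u \<bullet> k = 0 \<longrightarrow>
         frechet_derivative a (at u) h \<bullet> k - frechet_derivative a (at u) k \<bullet> h = 0) \<longrightarrow> h = 0)))"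
    using bspec[OF conjunct2[OF conjunct2[OF Q[unfolded contact_manifold_def]]] p] by (rule bexE)
  obtain V x where Vx: "c = (V, x)" by (cases c)
  obtain a where x: "(V, x) \<in> max_atlas (atlas Q)" "p \<in> x ` V" "contact_form V a"
    "\<forall>u\<in>V. hyperplane Q (x u) = {coord_vec (atlas Q) x u h | h. a u \<bullet> h = 0}"
    using c unfolding Vx contact_form_def prod.case by blast
  then obtain u where u: "u \<in> V" "p = x u" by blast
  have "a u \<noteq> 0" using x(3) u by (simp add: contact_form_def)
  then obtain b where b: "b \<in> Basis" "a u \<bullet> b \<noteq> 0" by (metis euclidean_all_zero_iff)
  let ?V = "{v \<in> V. a v \<bullet> b \<in> - {0}}"
  note V = max_atlasD(1)[OF x(1)]
  have "smooth_on V (\<lambda>v. a v \<bullet> b)"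
    using x(3) V by (intro smooth_intros) (auto simp: contact_form_def)
  then have "open ?V" by (rule open_preimage_smooth[OF V]) auto
  then have "(?V, x) \<in> max_atlas (atlas Q)"
    by (rule max_atlas_restrict[OF contact_manifold_diff_atlas[OF Q] x(1)]) auto
  moreover have "contact_form ?V a" by (rule contact_form_subset[OF x(3)]) auto
  ultimately have "contact_chart Q ?V x a b"
    using x(4) b(1) by (simp add: contact_chart_def)
  then show ?thesis using u b(2) by blast
qed

lemma symplectization_simps [simp]:
  "cone_atlas (symplectization Q) = sub_atlas (cotangent_bundle (atlas Q)) (symp_points Q)"
  "scale (symplectization Q) r (q, \<beta>) = (q, \<lambda>v. r * \<beta> v)"
  "form (symplectization Q) s v = liouville (atlas Q) s (push (cotangent_bundle (atlas Q)) s id v)"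
  by (simp_all add: symplectization_def)

lemma parallel_iff_annihilates:
  fixes a w :: "'e::euclidean_space"
  assumes "a \<noteq> 0"
  shows "(\<forall>h. a \<bullet> h = 0 \<longrightarrow> w \<bullet> h = 0) \<longleftrightarrow> (\<exists>r. w = r *\<^sub>R a)"
proof
  assume *: "\<forall>h. a \<bullet> h = 0 \<longrightarrow> w \<bullet> h = 0"
  let ?r = "(a \<bullet> w) / (a \<bullet> a)" and ?h = "w - ((a \<bullet> w) / (a \<bullet> a)) *\<^sub>R a"
  have "a \<bullet> ?h = 0" using assms by (simp add: inner_diff_right)
  moreover from this have "w \<bullet> ?h = 0" using * by blast
  ultimately have "?h \<bullet> ?h = 0" by (simp add: inner_diff_left)
  then show "\<exists>r. w = r *\<^sub>R a" by (intro exI[of _ ?r]) simp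
qed auto

lemma covec_chart_in_symp_points:
  assumes Q: "contact_manifold Q" and c: "contact_chart Q V x a b" and u: "u \<in> V"
  shows "covec_chart (atlas Q) x (u, w) \<in> symp_points Q \<longleftrightarrow> (\<exists>r. r \<noteq> 0 \<and> w = r *\<^sub>R a u)"
proof -
  note A = contact_manifold_diff_atlas[OF Q]
  have x: "(V, x) \<in> max_atlas (atlas Q)" "a u \<noteq> 0"
    "hyperplane Q (x u) = {coord_vec (atlas Q) x u h | h. a u \<bullet> h = 0}"
    using c u by (auto simp: contact_chart_def contact_form_def)
  have "x u \<in> points (atlas Q)" using max_atlasD(3)[OF x(1)] u by auto
  moreover have "coord_covec (atlas Q) x u w \<in> cotangent_space (atlas Q) (x u)"
    using cotangent_space_eq_coord_covec[OF A x(1) u] by simp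
  moreover have "coord_covec (atlas Q) x u w = (\<lambda>v. 0) \<longleftrightarrow> w = 0"
  proof -
    have "coord_covec (atlas Q) x u 0 = (\<lambda>v. 0)" by (auto simp: coord_covec_def)
    then show ?thesis using coord_covec_inject[OF A x(1) u, of w 0] by auto
  qed
  moreover have "(\<forall>v \<in> hyperplane Q (x u). coord_covec (atlas Q) x u w v = 0) \<longleftrightarrow> (\<exists>r. w = r *\<^sub>R a u)"
    unfolding x(3) parallel_iff_annihilates[OF x(2), symmetric]
    by (auto simp: coord_covec_apply[OF A x(1) u])
  ultimately show ?thesis using x(2) by (auto simp: covec_chart_def symp_points_def)
qed

text \<open>
  The section \<open>\<epsilon> \<alpha>\<close> over a contact chart with contact form \<open>\<alpha>\<close>; for \<open>\<epsilon> = 1\<close> and \<open>\<epsilon> = - 1\<close> the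
  positive multiples of these sections exhaust the symplectization over that chart.
\<close>

definition symp_section :: "('a, 'e::euclidean_space) contact \<Rightarrow> ('e \<Rightarrow> 'a) \<Rightarrow> ('e \<Rightarrow> 'e) \<Rightarrow> real \<Rightarrow> 'e \<Rightarrow> 'a \<times>
  'a covec" where
  "symp_section Q x a \<epsilon> = (\<lambda>u. covec_chart (atlas Q) x (u, \<epsilon> *\<^sub>R a u))"

lemma scale_symp_section:
  "scale (symplectization Q) r (symp_section Q x a \<epsilon> u) = covec_chart (atlas Q) x (u, (r * \<epsilon>) *\<^sub>R a u)"
  by (simp add: symp_section_def covec_chart_def coord_covec_scale mult.assoc)

text \<open>
  The fibrewise linear change of coordinates \<open>w \<mapsto> w + (w \<bullet> b) (a u - b)\<close> sends \<open>b\<close> to \<open>a u\<close> and fixes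
  the orthogonal complement of \<open>b\<close>.  In the new coordinates the multiples of the contact form are the
  multiples of \<open>b\<close>, so the symplectization is the slice spanned by \<open>b\<close> with the zero section
  removed.
\<close>

lemma symp_slice_chart:
  fixes Q :: "('a, 'e::euclidean_space) contact"
  assumes Q: "contact_manifold Q" and c: "contact_chart Q V x a b"
  shows "(V \<times> (- {0}), \<lambda>(u, r). covec_chart (atlas Q) x (u, r *\<^sub>R a u)) \<in>
    (cone_atlas (symplectization Q) :: ('a \<times> 'a covec, 'e \<times> real) atlas)"
proof -
  note A = contact_manifold_diff_atlas[OF Q]
  let ?B = "cotangent_bundle (atlas Q)"
  have x: "(V, x) \<in> max_atlas (atlas Q)" and a: "smooth_on V a" and b: "b \<in> Basis"
    and ab: "\<And>u. u \<in> V \<Longrightarrow> a u \<bullet> b \<noteq> 0"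
    using c by (auto simp: contact_chart_def contact_form_def)
  have bb: "b \<bullet> b = 1" "norm b = 1" using b by (auto simp: inner_Basis)
  note V = max_atlasD(1)[OF x]
  let ?N = "{p \<in> V \<times> UNIV. snd p \<bullet> b \<in> - {0}} :: ('e \<times> 'e) set"
  have VU: "open (V \<times> (UNIV :: 'e set))" using V by (simp add: open_Times)
  have N: "open ?N"
    by (rule open_preimage_smooth[OF VU]) (auto intro!: smooth_intros VU)
  have aN: "smooth_on ?N (\<lambda>p. a (fst p))"
    by (rule smooth_on_compose[OF N V _ a], intro smooth_intros N) auto
  let ?\<Psi> = "\<lambda>p::'e \<times> 'e. (fst p, (snd p \<bullet> b) *\<^sub>R a (fst p) + snd p - (snd p \<bullet> b) *\<^sub>R b)"
  \<comment> \<open>The coefficient \<open>w \<bullet> b\<close>, expressed by the image \<open>w'\<close> of \<open>w\<close>: it is \<open>(w' \<bullet> b) / (a u \<bullet> b)\<close>.\<close>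
  let ?q = "\<lambda>p::'e \<times> 'e. (snd p \<bullet> b) / (a (fst p) \<bullet> b)"
  let ?\<Theta> = "\<lambda>p::'e \<times> 'e. (fst p, snd p - ?q p *\<^sub>R a (fst p) + ?q p *\<^sub>R b)"
  let ?Z = "\<lambda>p. covec_chart (atlas Q) x (?\<Psi> p)"
  have Z: "(?N, ?Z) \<in> max_atlas ?B"
  proof (rule max_atlas_reparametrize[OF diff_atlas_cotangent_bundle[OF A]
    max_atlas_cotangent_bundle[OF A x] N N,
        where \<Psi> = ?\<Psi> and \<Theta> = ?\<Theta>])
    show "smooth_on ?N ?\<Psi>" by (intro smooth_intros aN N)
    show "smooth_on ?N ?\<Theta>" by (intro smooth_intros aN N) (auto simp: ab)
  qed (auto simp: ab bb inner_add_left inner_diff_left)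
  let ?j = "\<lambda>(u, r). (u, r *\<^sub>R b) :: 'e \<times> 'e"
  have j: "linear ?j" "inj ?j"
    using bb by (auto simp: linear_iff inj_def algebra_simps)
  have "?Z ` (?N \<inter> range ?j) = symp_points Q \<inter> ?Z ` ?N"
  proof (intro equalityI subsetI)
    fix p assume "p \<in> ?Z ` (?N \<inter> range ?j)"
    then obtain u r where ur: "u \<in> V" "r \<noteq> 0" "p = ?Z (u, r *\<^sub>R b)" "(u, r *\<^sub>R b) \<in> ?N"
      by (auto simp: bb)
    have "p \<in> symp_points Q"
      using covec_chart_in_symp_points[OF Q c ur(1)] ur(2,3) by (auto simp: bb)
    then show "p \<in> symp_points Q \<inter> ?Z ` ?N" using ur(3,4) by blast
  next
    fix p assume "p \<in> symp_points Q \<inter> ?Z ` ?N"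
    then obtain u w where uw: "u \<in> V" "w \<bullet> b \<noteq> 0" "p = ?Z (u, w)" "p \<in> symp_points Q" by auto
    then obtain r where "(w \<bullet> b) *\<^sub>R a u + w - (w \<bullet> b) *\<^sub>R b = r *\<^sub>R a u"
      using covec_chart_in_symp_points[OF Q c uw(1)] by auto
    moreover from this have "((w \<bullet> b) *\<^sub>R a u + w - (w \<bullet> b) *\<^sub>R b) \<bullet> b = (r *\<^sub>R a u) \<bullet> b" by simp
    then have "w \<bullet> b = r" using ab[OF uw(1)] by (simp add: inner_add_left inner_diff_left bb)
    ultimately have "w = (w \<bullet> b) *\<^sub>R b" by simp
    then have "(u, w) = ?j (u, w \<bullet> b)" by simp
    then have "(u, w) \<in> range ?j" by (rule range_eqI)
    moreover have "(u, w) \<in> ?N" using uw(1,2) by simp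
    ultimately have "(u, w) \<in> ?N \<inter> range ?j" by (rule IntI[rotated])
    then show "p \<in> ?Z ` (?N \<inter> range ?j)" using uw(3) by blast
  qed
  then have "(?j -` ?N, ?Z \<circ> ?j) \<in> (sub_atlas ?B (symp_points Q) :: ('a \<times> 'a covec, 'e \<times> real) atlas)"
    unfolding sub_atlas_def using Z j by blast
  moreover have "?j -` ?N = V \<times> (- {0})" by (auto simp: bb)
  moreover have "?Z \<circ> ?j = (\<lambda>(u, r). covec_chart (atlas Q) x (u, r *\<^sub>R a u))"
    by (auto simp: bb)
  ultimately show ?thesis by simp
qed

text \<open>
  At a covector \<open>r \<epsilon> \<alpha>\<close> the Liouville form is the pullback of this covector itself, so it is \<open>r \<epsilon> \<alpha>\<close> in
  section coordinates.
\<close>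

lemma contact_section_symplectization:
  fixes Q :: "('a, 'e::euclidean_space) contact"
  assumes Q: "contact_manifold Q" and c: "contact_chart Q V x a b" and \<epsilon>: "\<epsilon> = 1 \<or> \<epsilon> = - 1"
  shows "contact_section (symplectization Q) V (symp_section Q x a \<epsilon>) (\<lambda>u. \<epsilon> *\<^sub>R a u)"
proof -
  note A = contact_manifold_diff_atlas[OF Q]
  note B = diff_atlas_cotangent_bundle[OF A]
  let ?S = "cone_atlas (symplectization Q)"
  have S: "diff_atlas ?S" by (simp add: diff_atlas_sub_atlas[OF B])
  have x: "(V, x) \<in> max_atlas (atlas Q)" and a: "contact_form V a" "smooth_on V a"
    using c by (auto simp: contact_chart_def contact_form_def)
  note V = max_atlasD(1)[OF x]
  let ?N = "V \<times> {0<..} :: ('e \<times> real) set" and ?N' = "V \<times> {r. \<epsilon> * r > 0} :: ('e \<times> real) set"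
  have "open {r::real. \<epsilon> * r > 0}" using \<epsilon> by (intro open_Collect_less continuous_intros)
  then have N: "open ?N" "open ?N'" using V by (auto intro: open_Times)
  let ?X = "section_chart (symplectization Q) (symp_section Q x a \<epsilon>)"
  have X_eq: "?X (u, r) = covec_chart (atlas Q) x (u, (r * \<epsilon>) *\<^sub>R a u)" for u r
    unfolding section_chart_simp by (rule scale_symp_section)
  have slice: "(V \<times> (- {0}), \<lambda>(u, r). covec_chart (atlas Q) x (u, r *\<^sub>R a u)) \<in> max_atlas ?S"
    using symp_slice_chart[OF Q c] atlas_subset_max_atlas[OF S] by blast
  have X: "(?N, ?X) \<in> max_atlas ?S"
  proof (rule max_atlas_reparametrize[OF S slice N, where \<Psi> = "\<lambda>p. (fst p, snd p * \<epsilon>)" and \<Theta>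
    = "\<lambda>p. (fst p, snd p * \<epsilon>)"])
    show "smooth_on ?N (\<lambda>p. (fst p, snd p * \<epsilon>))" "smooth_on ?N' (\<lambda>p. (fst p, snd p * \<epsilon>))"
      by (intro smooth_intros N)+
  qed (use \<epsilon> in \<open>auto simp: scale_symp_section mult.commute\<close>)
  have "contact_form V (\<lambda>u. \<epsilon> *\<^sub>R a u)"
    using \<epsilon> a(1) contact_form_uminus[OF V a(1)] by auto
  moreover have "form (symplectization Q) (?X (u, r)) (coord_vec ?S ?X (u, r) (h, \<rho>)) = r *
    (\<epsilon> *\<^sub>R a u \<bullet> h)"
    if u: "u \<in> V" "r > 0" for u r h \<rho>
  proof -
    let ?\<phi> = "\<lambda>p. (fst p, (snd p * \<epsilon>) *\<^sub>R a (fst p))"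
    have aN: "smooth_on ?N (\<lambda>p. a (fst p))"
      by (rule smooth_on_compose[OF N(1) V _ a(2)]) (auto intro!: smooth_intros N)
    have sm: "smooth_on ?N (\<lambda>p. (snd p * \<epsilon>) *\<^sub>R a (fst p))" by (intro smooth_intros N aN)
    have up: "(u, r) \<in> ?N" using u by simp
    obtain D where D: "((\<lambda>p. (snd p * \<epsilon>) *\<^sub>R a (fst p)) has_derivative D) (at (u, r))"
      using smooth_on_has_derivative[OF N(1) sm up] by blast
    have "(fst has_derivative fst) (at (u, r))" by (auto intro!: derivative_eq_intros)
    then have D': "(?\<phi> has_derivative (\<lambda>v. (fst v, D v))) (at (u, r))"
      using has_derivative_Pair[OF _ D] by blast
    have "push (cotangent_bundle (atlas Q)) (id (?X (u, r))) id (coord_vec ?S ?X (u, r) (h, \<rho>))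
        = coord_vec (cotangent_bundle (atlas Q)) (covec_chart (atlas Q) x) (?\<phi> (u, r)) (fst (h, \<rho>), D
          (h, \<rho>))"
    proof (rule push_coord_vec[OF S X B max_atlas_cotangent_bundle[OF A x] up _ _ _ D'])
      show "smooth_on ?N ?\<phi>" by (intro smooth_on_Pair sm N smooth_intros)
    qed (auto simp: scale_symp_section)
    moreover have "push (atlas Q) (fst (covec_chart (atlas Q) x (?\<phi> (u, r)))) fst
        (coord_vec (cotangent_bundle (atlas Q)) (covec_chart (atlas Q) x) (?\<phi> (u, r)) (h, D (h, \<rho>)))
        = coord_vec (atlas Q) x (fst (?\<phi> (u, r))) (fst (h, D (h, \<rho>)))"
    proof (rule push_coord_vec[OF B max_atlas_cotangent_bundle[OF A x] A x])
      show "smooth_on (V \<times> (UNIV :: 'e set)) fst" using V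
        by (intro smooth_on_linear linear_fst open_Times) auto
      show "(fst has_derivative fst) (at (?\<phi> (u, r)))" by (auto intro!: derivative_eq_intros)
    qed (use u in \<open>auto simp: covec_chart_def\<close>)
    ultimately show ?thesis
      by (simp add: scale_symp_section liouville_def covec_chart_def coord_covec_apply[OF A x u(1)] del:
        symplectization_simps(1,2))
  qed
  ultimately show ?thesis unfolding contact_section_def using X by simp
qed

lemma points_sub_atlas_subset:
  fixes B :: "('a, 'e::euclidean_space) atlas"
  shows "points (sub_atlas B S :: ('a, 'f::euclidean_space) atlas) \<subseteq> S"
proof
  fix p assume "p \<in> points (sub_atlas B S :: ('a, 'f) atlas)"
  then obtain V u and x :: "'f \<Rightarrow> 'a" where x: "(V, x) \<in> sub_atlas B S" "u \<in> V" "p = x u"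
    by (rule pointsE)
  from sub_atlas_chart[OF x(1)]
  obtain V0 x0 j where "(V0, x0) \<in> max_atlas B" "linear j" "inj j" and
    x0: "V = j -` V0" "x = x0 \<circ> j" "x0 ` (V0 \<inter> range j) = S \<inter> x0 ` V0"
    by (elim exE conjE)
  have "p \<in> x0 ` (V0 \<inter> range j)" using x(2,3) x0(1,2) by auto
  then show "p \<in> S" using x0(3) by blast
qed

lemma symp_pointE:
  assumes Q: "contact_manifold Q" and s: "s \<in> points (cone_atlas (symplectization Q))"
    and x: "contact_chart Q V x a b" "u \<in> V" "fst s = x u"
  shows "\<exists>r \<epsilon>. r > 0 \<and> (\<epsilon> = 1 \<or> \<epsilon> = - 1) \<and> s = scale (symplectization Q) r (symp_section Q x a \<epsilon> u)"
proof -
  note A = contact_manifold_diff_atlas[OF Q]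
  have "s \<in> symp_points Q"
    using s subsetD[OF points_sub_atlas_subset] by (metis symplectization_simps(1))
  moreover obtain \<beta> where \<beta>: "s = (x u, \<beta>)" using x(3) by (metis prod.collapse)
  ultimately have "\<beta> \<in> cotangent_space (atlas Q) (x u)" by (simp add: symp_points_def)
  then obtain w where "\<beta> = coord_covec (atlas Q) x u w"
    using cotangent_space_eq_coord_covec[OF A _ x(2)] x(1) by (auto simp: contact_chart_def)
  then have s_eq: "s = covec_chart (atlas Q) x (u, w)" using \<beta> by (simp add: covec_chart_def)
  then obtain r where "r \<noteq> 0" "w = r *\<^sub>R a u"
    using covec_chart_in_symp_points[OF Q x(1,2)] \<open>s \<in> symp_points Q\<close> by auto
  then show ?thesis
    using s_eq by (intro exI[of _ "\<bar>r\<bar>"] exI[of _ "sgn r"]) (auto simp: scale_symp_section sgn_if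
      abs_if)
qed

lemma symp_point_base:
  assumes "s \<in> points (cone_atlas (symplectization Q))"
  shows "fst s \<in> points (atlas Q)"
proof -
  have "s \<in> symp_points Q"
    using assms subsetD[OF points_sub_atlas_subset] by (metis symplectization_simps(1))
  then show ?thesis by (auto simp: symp_points_def)
qed

lemma liouville_cone_symplectization:
  fixes Q :: "('a, 'e::euclidean_space) contact"
  assumes Q: "contact_manifold Q"
  shows "liouville_cone (symplectization Q)"
proof -
  note A = contact_manifold_diff_atlas[OF Q]
  let ?F = "{(V, x, a, b). contact_chart Q V x a b}"
  let ?chart = "\<lambda>(V, x, a::'e \<Rightarrow> 'e, b::'e). (V, x)"
  have sc: "second_countable (atlas_topology (atlas Q))"
    using Q by (simp add: contact_manifold_def smooth_manifold_def)
  have "\<exists>c\<in>?F. ?chart c \<in> max_atlas (atlas Q) \<and> p \<in> snd (?chart c) ` fst (?chart c)"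
    if p: "p \<in> points (atlas Q)" for p
  proof -
    obtain V x a b u where "contact_chart Q V x a b" "u \<in> V" "p = x u"
      using ex_contact_chart[OF Q p] by blast
    then show ?thesis
      by (intro bexI[of _ "(V, x, a, b)"]) (auto simp: contact_chart_def)
  qed
  then obtain K where K: "countable K" "K \<subseteq> ?F"
    "points (atlas Q) \<subseteq> (\<Union>c\<in>K. snd (?chart c) ` fst (?chart c))"
    using countable_chart_cover[OF A sc, of ?F ?chart] by blast
  let ?L = "(\<lambda>((V, x, a, b), \<epsilon>). (V, symp_section Q x a \<epsilon>, \<lambda>u. \<epsilon> *\<^sub>R a u)) ` (K \<times> {1, - 1})"
  let ?C = "symplectization Q"
  have "countable ?L" using K(1) by simp
  moreover have "\<forall>(V, \<sigma>, a)\<in>?L. contact_section ?C V \<sigma> a"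
    using K(2) contact_section_symplectization[OF Q] by fastforce
  moreover have "s \<in> (\<Union>(V, \<sigma>, a)\<in>?L. section_chart ?C \<sigma> ` (V \<times> {0<..}))"
    if s: "s \<in> points (cone_atlas ?C)" for s
  proof -
    have "fst s \<in> (\<Union>c\<in>K. snd (?chart c) ` fst (?chart c))"
      using symp_point_base[OF s] K(3) by blast
    then obtain V x a b u where x: "(V, x, a, b) \<in> K" "u \<in> V" "fst s = x u" by auto
    then have c: "contact_chart Q V x a b" using K(2) by auto
    obtain r \<epsilon> where r: "r > 0" "\<epsilon> = 1 \<or> \<epsilon> = - 1" "s = scale ?C r (symp_section Q x a \<epsilon> u)"
      using symp_pointE[OF Q s c x(2,3)] by blast
    have "(V, symp_section Q x a \<epsilon>, \<lambda>u. \<epsilon> *\<^sub>R a u) \<in> ?L"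
      using x(1) r(2) by (intro image_eqI[of _ _ "((V, x, a, b), \<epsilon>)"]) auto
    moreover have "s \<in> section_chart ?C (symp_section Q x a \<epsilon>) ` (V \<times> {0<..})"
      using r x(2) by (intro image_eqI[of _ _ "(u, r)"]) auto
    ultimately show ?thesis
      using UN_I[of "(V, symp_section Q x a \<epsilon>, \<lambda>u. \<epsilon> *\<^sub>R a u)" ?L s
          "\<lambda>(V, \<sigma>, a). section_chart ?C \<sigma> ` (V \<times> {0<..})"] by simp
  qed
  ultimately have "\<exists>K. countable K \<and> (\<forall>(V, \<sigma>, a)\<in>K. contact_section ?C V \<sigma> a) \<and>
      points (cone_atlas ?C) \<subseteq> (\<Union>(V, \<sigma>, a)\<in>K. section_chart ?C \<sigma> ` (V \<times> {0<..}))"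
    by (intro exI[of _ ?L] conjI subsetI)
  moreover have "diff_atlas (cone_atlas ?C)"
    by (simp add: diff_atlas_sub_atlas[OF diff_atlas_cotangent_bundle[OF A]])
  moreover have "scale ?C 1 s = s" "scale ?C r (scale ?C t s) = scale ?C (r * t) s" for r t s
    by (cases s; simp add: mult.assoc)+
  ultimately show ?thesis unfolding liouville_cone_def by blast
qed

text \<open>
  Orbits over different points of \<open>Q\<close> are separated in \<open>Q\<close>.  Over one point there are just two
  orbits, the positive and the negative multiples of the contact form, and the images of the
  corresponding charts are disjoint.
\<close>

lemma Hausdorff_quotient_symplectization:
  assumes Q: "contact_manifold Q"
  shows "Hausdorff_space (quotient_topology (symplectization Q))"
proof -
  let ?C = "symplectization Q" and ?T = "atlas_topology (atlas Q)"
  note A = contact_manifold_diff_atlas[OF Q] and C = liouville_cone_symplectization[OF Q]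
  note dQ = diff_atlas_quotient[OF C]
  have T: "Hausdorff_space ?T"
    using Q by (simp add: contact_manifold_def smooth_manifold_def)
  have "separated (quotient_topology ?C) (orbit ?C s) (orbit ?C t)"
    if st: "s \<in> points (cone_atlas ?C)" "t \<in> points (cone_atlas ?C)" "orbit ?C s \<noteq> orbit ?C t" for s t
  proof (cases "fst s = fst t")
    case False
    show ?thesis
    proof (rule separate_orbits_by_invariant[OF C _ _ T _ st(1,2) False])
      show "fst (scale ?C r p) = fst p" for r p by (cases p) simp
      show "fst ` points (cone_atlas ?C) \<subseteq> topspace ?T"
        using symp_point_base[of _ Q] unfolding topspace_atlas_topology[OF A] by blast
      fix p assume p: "p \<in> points (cone_atlas ?C)"
      obtain V x a b u where x: "contact_chart Q V x a b" "u \<in> V" "fst p = x u"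
        using ex_contact_chart[OF Q symp_point_base[OF p]] by blast
      obtain r \<epsilon> where r: "r > 0" "\<epsilon> = 1 \<or> \<epsilon> = - 1" "p = scale ?C r (symp_section Q x a \<epsilon> u)"
        using symp_pointE[OF Q p x] by blast
      have "open {u \<in> V. fst (symp_section Q x a \<epsilon> u) \<in> U}" if U: "openin ?T U" for U
        using open_chart_preimage[OF A _ U, of V x] x(1)
        by (simp add: contact_chart_def symp_section_def covec_chart_def)
      then show "\<exists>V \<sigma> a u r. contact_section ?C V \<sigma> a \<and> u \<in> V \<and> r > 0 \<and> p = scale ?C r (\<sigma> u) \<and>
          (\<forall>U. openin ?T U \<longrightarrow> open {u \<in> V. fst (\<sigma> u) \<in> U})"
        using contact_section_symplectization[OF Q x(1) r(2)] x(2) r(1,3) by blast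
    qed
  next
    case True
    obtain V x a b u where x: "contact_chart Q V x a b" "u \<in> V" "fst s = x u"
      using ex_contact_chart[OF Q symp_point_base[OF st(1)]] by blast
    obtain r \<epsilon> where r: "r > 0" "\<epsilon> = 1 \<or> \<epsilon> = - 1" "s = scale ?C r (symp_section Q x a \<epsilon> u)"
      using symp_pointE[OF Q st(1) x] by blast
    obtain r' \<epsilon>' where r': "r' > 0" "\<epsilon>' = 1 \<or> \<epsilon>' = - 1" "t = scale ?C r' (symp_section Q x a \<epsilon>' u)"
      using symp_pointE[OF Q st(2) x(1,2)] x(3) True by auto
    have orb: "orbit ?C s = orbit ?C (symp_section Q x a \<epsilon> u)"
      "orbit ?C t = orbit ?C (symp_section Q x a \<epsilon>' u)"
      using r r' orbit_scale[OF C] by blast+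
    have "\<epsilon>' = - \<epsilon>" using orb st(3) r(2) r'(2) by auto
    let ?P = "\<lambda>\<epsilon>. (\<lambda>u. orbit ?C (symp_section Q x a \<epsilon> u)) ` V"
    have op: "openin (quotient_topology ?C) (?P \<epsilon>)" if "\<epsilon> = 1 \<or> \<epsilon> = - 1" for \<epsilon>
      by (rule openin_chart_image[OF dQ contact_section_quotient_max[OF C
            contact_section_symplectization[OF Q x(1) that]]])
    have "disjnt (?P \<epsilon>) (?P \<epsilon>')"
    proof (rule ccontr)
      assume "\<not> ?thesis"
      then obtain v w where vw: "v \<in> V" "w \<in> V"
        "orbit ?C (symp_section Q x a \<epsilon> v) = orbit ?C (symp_section Q x a \<epsilon>' w)"
        unfolding disjnt_def by blast
      then obtain \<rho> where \<rho>: "\<rho> > 0" "symp_section Q x a \<epsilon> v = scale ?C \<rho> (symp_section Q x a \<epsilon>' w)"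
        using orbit_eq_iff[OF C] by blast
      have xm: "(V, x) \<in> max_atlas (atlas Q)" using x(1) by (simp add: contact_chart_def)
      have "covec_chart (atlas Q) x (v, \<epsilon> *\<^sub>R a v) = covec_chart (atlas Q) x (w, (\<rho> * \<epsilon>') *\<^sub>R a w)"
        using \<rho>(2) unfolding scale_symp_section by (simp add: symp_section_def)
      then have "v = w" "\<epsilon> *\<^sub>R a v = (\<rho> * \<epsilon>') *\<^sub>R a w"
        using inj_onD[OF inj_on_covec_chart[OF A xm]] vw by blast+
      then have "(\<epsilon> + \<rho> * \<epsilon>) *\<^sub>R a v = 0" using \<open>\<epsilon>' = - \<epsilon>\<close> by (simp add: scaleR_add_left)
      moreover have "a v \<noteq> 0" using x(1) vw(1) by (auto simp: contact_chart_def contact_form_def)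
      ultimately show False using \<rho>(1) r(2) by auto
    qed
    then show ?thesis using op[OF r(2)] op[OF r'(2)] orb x(2) by blast
  qed
  then show ?thesis
    unfolding Hausdorff_space_def topspace_atlas_topology[OF dQ] points_quotient_atlas[OF C] by blast
qed

lemma contact_manifold_contact_product:
  fixes Q :: "('a, 'e::euclidean_space) contact" and Q' :: "('b, 'f::euclidean_space) contact"
  assumes "contact_manifold Q" "contact_manifold Q'"
  shows "contact_manifold (contact_product Q Q')"
  unfolding contact_product_def
proof (rule contact_manifold_contact_quotient)
  note C = liouville_cone_symplectization[OF assms(1)] liouville_cone_symplectization[OF assms(2)]
  show "liouville_cone (prod_cone (symplectization Q) (symplectization Q'))"
    by (rule liouville_cone_prod[OF C])
  show "Hausdorff_space (quotient_topology (prod_cone (symplectization Q) (symplectization Q')))"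
    by (rule Hausdorff_quotient_prod[OF C(1) Hausdorff_quotient_symplectization[OF assms(1)]
          C(2) Hausdorff_quotient_symplectization[OF assms(2)]])
  have "odd DIM('e)" "odd DIM('f)" using assms by (auto simp: contact_manifold_def)
  then show "odd DIM('e \<times> 'f \<times> real)" by simp
qed

section \<open>Products and composition of correspondences as sets\<close>

lemma scale_corr_cone [simp]: "scale (corr_cone C D) r (s, t) = (scale C r s, scale D r t)"
  by (simp add: corr_cone_def)

lemma points_corr_cone [simp]:
  fixes C :: "('s, 'h::euclidean_space) cone" and D :: "('t, 'k::euclidean_space) cone"
  shows "points (cone_atlas (corr_cone C D)) = points (cone_atlas C) \<times> points (cone_atlas D)"
  unfolding corr_cone_def points_prod_cone by simp

lemma liouville_cone_corr: "liouville_cone C \<Longrightarrow> liouville_cone D \<Longrightarrow> liouville_cone (corr_cone C D)"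
  unfolding corr_cone_def by (intro liouville_cone_prod liouville_cone_neg)

lemma mem_preimage_iff:
  "(s, t) \<in> preimage C D R \<longleftrightarrow>
    s \<in> points (cone_atlas C) \<and> t \<in> points (cone_atlas D) \<and> orbit (corr_cone C D) (s, t) \<in> R"
  unfolding preimage_def mem_Collect_eq points_corr_cone by auto

lemma preimage_scale:
  assumes "liouville_cone C" "liouville_cone D" "(s, t) \<in> preimage C D R" "r > 0"
  shows "(scale C r s, scale D r t) \<in> preimage C D R"
  using assms scale_in_points[of C] scale_in_points[of D]
    orbit_scale[OF liouville_cone_corr[OF assms(1,2)] assms(4), of "(s, t)"]
  by (auto simp: mem_preimage_iff)

lemma star_eq:
  "star Ca Cb Cp Cq R R' = {orbit (corr_cone (prod_cone Ca Cp) (prod_cone Cb Cq)) ((a, p), (b, q)) | a b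
    p q.
     (a, b) \<in> preimage Ca Cb R \<and> (p, q) \<in> preimage Cp Cq R'}"
proof -
  have "sigma (orbit (prod_cone (corr_cone Ca Cb) (corr_cone Cp Cq)) ((a, b), (p, q))) =
      orbit (corr_cone (prod_cone Ca Cp) (prod_cone Cb Cq)) ((a, p), (b, q))" for a b p q
    by (force simp: sigma_def orbit_def)
  then show ?thesis unfolding star_def product_corr_def by force
qed

text \<open>
  By definition the product contains the orbit of \<open>((a, p), (b, q))\<close> if some common multiple of
  \<open>(a, b)\<close> and \<open>(p, q)\<close> lies in the two preimages; as these are invariant under scaling, the
  multiple may be taken to be \<open>1\<close>.
\<close>

lemma mem_preimage_star_iff:
  assumes C: "liouville_cone Ca" "liouville_cone Cb" "liouville_cone Cp" "liouville_cone Cq"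
  shows "((a, p), (b, q)) \<in> preimage (prod_cone Ca Cp) (prod_cone Cb Cq) (star Ca Cb Cp Cq R R') \<longleftrightarrow>
    (a, b) \<in> preimage Ca Cb R \<and> (p, q) \<in> preimage Cp Cq R'"
    (is "?L \<longleftrightarrow> ?R")
proof
  let ?M = "corr_cone (prod_cone Ca Cp) (prod_cone Cb Cq)"
  have M: "liouville_cone ?M" by (intro liouville_cone_corr liouville_cone_prod C)
  assume ?L
  then have "orbit ?M ((a, p), (b, q)) \<in> star Ca Cb Cp Cq R R'" by (simp add: mem_preimage_iff)
  then obtain a0 b0 p0 q0 where *: "orbit ?M ((a, p), (b, q)) = orbit ?M ((a0, p0), (b0, q0))"
    "(a0, b0) \<in> preimage Ca Cb R" "(p0, q0) \<in> preimage Cp Cq R'"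
    unfolding star_eq by blast
  then obtain r where "r > 0" "((a, p), (b, q)) = scale ?M r ((a0, p0), (b0, q0))"
    using orbit_eq_iff[OF M] by blast
  then show ?R using preimage_scale[OF C(1,2) *(2)] preimage_scale[OF C(3,4) *(3)] by auto
next
  assume R: ?R
  then have "orbit (corr_cone (prod_cone Ca Cp) (prod_cone Cb Cq)) ((a, p), (b, q)) \<in>
    star Ca Cb Cp Cq R R'"
    unfolding star_eq by blast
  then show ?L using R unfolding mem_preimage_iff points_prod_cone by simp
qed

text \<open>
  Preimages of compositions are compositions of preimages, as relations, by invariance under
  scaling; and relations compose factorwise in a product.
\<close>

lemma comp_corr_star:
  assumes C: "liouville_cone Ca" "liouville_cone Cb" "liouville_cone Cc"
    and D: "liouville_cone Cp" "liouville_cone Cq" "liouville_cone Cr"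
  shows "comp_corr (prod_cone Ca Cp) (prod_cone Cb Cq) (prod_cone Cc Cr) (star Ca Cb Cp Cq R R')
    (star Cb Cc Cq Cr S S')
    = star Ca Cc Cp Cr (comp_corr Ca Cb Cc R S) (comp_corr Cp Cq Cr R' S')"
proof -
  have pre: "(a, c) \<in> preimage A C (comp_corr A B C R S) \<longleftrightarrow>
      (\<exists>b. (a, b) \<in> preimage A B R \<and> (b, c) \<in> preimage B C S)"
    if L: "liouville_cone A" "liouville_cone B" "liouville_cone C"
    for A :: "('x, 'hx::euclidean_space) cone" and B :: "('y, 'hy::euclidean_space) cone"
      and C :: "('z, 'hz::euclidean_space) cone" and R S a c
  proof
    assume "(a, c) \<in> preimage A C (comp_corr A B C R S)"
    then obtain a0 b0 c0 where *: "orbit (corr_cone A C) (a, c) = orbit (corr_cone A C) (a0, c0)"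
      "(a0, b0) \<in> preimage A B R" "(b0, c0) \<in> preimage B C S"
      unfolding mem_preimage_iff comp_corr_def by blast
    then obtain r where "r > 0" "(a, c) = scale (corr_cone A C) r (a0, c0)"
      using orbit_eq_iff[OF liouville_cone_corr[OF L(1,3)]] by blast
    then show "\<exists>b. (a, b) \<in> preimage A B R \<and> (b, c) \<in> preimage B C S"
      using preimage_scale[OF L(1,2) *(2)] preimage_scale[OF L(2,3) *(3)] by auto
  next
    assume "\<exists>b. (a, b) \<in> preimage A B R \<and> (b, c) \<in> preimage B C S"
    then show "(a, c) \<in> preimage A C (comp_corr A B C R S)"
      unfolding mem_preimage_iff comp_corr_def by blast
  qed
  let ?M = "corr_cone (prod_cone Ca Cp) (prod_cone Cc Cr)"
  have "comp_corr (prod_cone Ca Cp) (prod_cone Cb Cq) (prod_cone Cc Cr) (star Ca Cb Cp Cq R R')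
    (star Cb Cc Cq Cr S S')
    = {orbit ?M ((a, p), (c, r)) | a p c r.
      (\<exists>b. (a, b) \<in> preimage Ca Cb R \<and> (b, c) \<in> preimage Cb Cc S) \<and>
      (\<exists>q. (p, q) \<in> preimage Cp Cq R' \<and> (q, r) \<in> preimage Cq Cr S')}"
    unfolding comp_corr_def split_paired_Ex mem_preimage_star_iff[OF C(1,2) D(1,2)]
      mem_preimage_star_iff[OF C(2,3) D(2,3)] by blast
  also have "\<dots> = star Ca Cc Cp Cr (comp_corr Ca Cb Cc R S) (comp_corr Cp Cq Cr R' S')"
    unfolding star_eq pre[OF C] pre[OF D] by blast
  finally show ?thesis .
qed

section \<open>Products of Legendrian correspondences\<close>

definition inverse_smooth_maps ::
  "'e::euclidean_space set \<Rightarrow> 'f::euclidean_space set \<Rightarrow> ('e \<Rightarrow> 'f) \<Rightarrow> ('f \<Rightarrow> 'e) \<Rightarrow> bool" where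
  "inverse_smooth_maps N N' G H \<longleftrightarrow> smooth_on N G \<and> smooth_on N' H \<and>
     (\<forall>v\<in>N. G v \<in> N' \<and> H (G v) = v) \<and> (\<forall>q\<in>N'. H q \<in> N \<and> G (H q) = q)"

lemma chart_overlap:
  assumes A: "diff_atlas A" and x: "(V, x) \<in> max_atlas A" and y: "(W, y) \<in> max_atlas A"
  shows "\<exists>V' W' \<phi> \<psi>. V' = {u \<in> V. x u \<in> y ` W} \<and> W' = {w \<in> W. y w \<in> x ` V} \<and> open V' \<and> open W' \<and>
    smooth_on V' \<phi> \<and> smooth_on W' \<psi> \<and> (\<forall>u\<in>V'. \<phi> u \<in> W' \<and> \<psi> (\<phi> u) = u \<and> y (\<phi> u) = x u) \<and>
    (\<forall>w\<in>W'. \<psi> w \<in> V' \<and> \<phi> (\<psi> w) = w)"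
proof -
  note inj = max_atlasD(2)[OF x] max_atlasD(2)[OF y]
  have xy: "change_at V x W y u" if "u \<in> V" "x u \<in> y ` W" for u
    using max_atlas_change[OF A x y that(1)] that(2) by blast
  have yx: "change_at W y V x u" if "u \<in> W" "y u \<in> x ` V" for u
    using max_atlas_change[OF A y x that(1)] that(2) by blast
  show ?thesis
    using change_at_imp[OF inj(2) xy] change_at_imp[OF inj(1) yx] inj
    by (intro exI[of _ "{u \<in> V. x u \<in> y ` W}"] exI[of _ "{w \<in> W. y w \<in> x ` V}"]
        exI[of _ "inv_into W y \<circ> x"] exI[of _ "inv_into V x \<circ> y"])
       (auto simp: f_inv_into_f inv_into_into)
qed

lemma slice_mem_iff:
  assumes "inj_on x V" "x ` (V \<inter> W) = S \<inter> x ` V" "u \<in> V"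
  shows "x u \<in> S \<longleftrightarrow> u \<in> W"
proof
  assume "x u \<in> S"
  then have "x u \<in> x ` (V \<inter> W)" using assms(2,3) by blast
  then show "u \<in> W" using inj_onD[OF assms(1), of u] assms(3) by blast
qed (use assms in blast)

text \<open>
  If near each of its points the subset \<open>S\<close> corresponds to \<open>S1 \<times> S2 \<times> J\<close> under a diffeomorphism \<open>G\<close>
  from a chart of \<open>B\<close> to \<open>N1 \<times> N2 \<times> J\<close>, then slice charts of \<open>S1\<close> and \<open>S2\<close>, transported by \<open>G\<close>, give
  slice charts of \<open>S\<close>.  The linear isomorphism \<open>\<kappa>\<close> only matches the model spaces.
\<close>

lemma embedded_submanifold_local_product:
  fixes A1 :: "('a, 'e1::euclidean_space) atlas" and A2 :: "('b, 'e2::euclidean_space) atlas"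
    and B :: "('c, 'e::euclidean_space) atlas" and \<kappa> :: "'e \<Rightarrow> 'e1 \<times> 'e2 \<times> real" and \<kappa>'
  assumes A: "diff_atlas A1" "diff_atlas A2" "diff_atlas B"
    and \<kappa>: "linear \<kappa>" "linear \<kappa>'" "\<And>v. \<kappa> (\<kappa>' v) = v" "\<And>v. \<kappa>' (\<kappa> v) = v"
    and S: "embedded_submanifold A1 k1 S1" "embedded_submanifold A2 k2 S2" "S \<subseteq> points B"
    and loc: "\<And>p. p \<in> S \<Longrightarrow> \<exists>N1 y1 N2 y2 J N Y G H. (N1, y1) \<in> max_atlas A1 \<and> (N2, y2) \<in> max_atlas A2 \<and>
      open (J :: real set) \<and> (N, Y) \<in> max_atlas B \<and> p \<in> Y ` N \<and> inverse_smooth_maps N (N1 \<times> N2 \<times>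
        J) G H \<and>
      (\<forall>v\<in>N. Y v \<in> S \<longleftrightarrow> y1 (fst (G v)) \<in> S1 \<and> y2 (fst (snd (G v))) \<in> S2)"
  shows "embedded_submanifold B (k1 + k2 + 1) S"
  unfolding embedded_submanifold_def
proof (intro conjI S(3) ballI)
  fix p assume "p \<in> S"
  from loc[OF this] obtain N1 y1 N2 y2 J N Y G H where
    y: "(N1, y1) \<in> max_atlas A1" "(N2, y2) \<in> max_atlas A2"
    and J: "open (J :: real set)" and Y: "(N, Y) \<in> max_atlas B" and p: "p \<in> Y ` N"
    and inv: "inverse_smooth_maps N (N1 \<times> N2 \<times> J) G H"
    and mem: "\<forall>v\<in>N. Y v \<in> S \<longleftrightarrow> y1 (fst (G v)) \<in> S1 \<and> y2 (fst (snd (G v))) \<in> S2"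
    by blast
  have sm: "smooth_on N G" "smooth_on (N1 \<times> N2 \<times> J) H"
    and G: "\<forall>v\<in>N. G v \<in> N1 \<times> N2 \<times> J \<and> H (G v) = v" and H: "\<forall>q\<in>N1 \<times> N2 \<times> J. H q \<in> N \<and> G (H q) = q"
    using inv unfolding inverse_smooth_maps_def by blast+
  obtain n where n: "n \<in> N" "p = Y n" using p by blast
  obtain n1 n2 \<rho> where Gn: "G n = (n1, n2, \<rho>)" by (cases "G n") auto
  have n12: "n1 \<in> N1" "n2 \<in> N2" "\<rho> \<in> J" using G n(1) Gn by auto
  have S12: "y1 n1 \<in> S1" "y2 n2 \<in> S2" using mem n \<open>p \<in> S\<close> Gn by auto
  obtain V1 x1 W1 where x1: "(V1, x1) \<in> max_atlas A1" "subspace W1" "dim W1 = k1" "y1 n1 \<in> x1 ` V1"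
    "x1 ` (V1 \<inter> W1) = S1 \<inter> x1 ` V1"
    using S(1) S12(1) unfolding embedded_submanifold_def by fast
  obtain V2 x2 W2 where x2: "(V2, x2) \<in> max_atlas A2" "subspace W2" "dim W2 = k2" "y2 n2 \<in> x2 ` V2"
    "x2 ` (V2 \<inter> W2) = S2 \<inter> x2 ` V2"
    using S(2) S12(2) unfolding embedded_submanifold_def by fast
  from chart_overlap[OF A(1) x1(1) y(1)] obtain V1' N1' \<phi>1 \<psi>1 where 1:
    "V1' = {u \<in> V1. x1 u \<in> y1 ` N1}" "N1' = {w \<in> N1. y1 w \<in> x1 ` V1}" "open V1'" "open N1'"
    "smooth_on V1' \<phi>1" "smooth_on N1' \<psi>1" "\<forall>u\<in>V1'. \<phi>1 u \<in> N1' \<and> \<psi>1 (\<phi>1 u) = u \<and> y1 (\<phi>1 u) = x1 u"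
    "\<forall>w\<in>N1'. \<psi>1 w \<in> V1' \<and> \<phi>1 (\<psi>1 w) = w" by (elim exE conjE)
  from chart_overlap[OF A(2) x2(1) y(2)] obtain V2' N2' \<phi>2 \<psi>2 where 2:
    "V2' = {u \<in> V2. x2 u \<in> y2 ` N2}" "N2' = {w \<in> N2. y2 w \<in> x2 ` V2}" "open V2'" "open N2'"
    "smooth_on V2' \<phi>2" "smooth_on N2' \<psi>2" "\<forall>u\<in>V2'. \<phi>2 u \<in> N2' \<and> \<psi>2 (\<phi>2 u) = u \<and> y2 (\<phi>2 u) = x2 u"
    "\<forall>w\<in>N2'. \<psi>2 w \<in> V2' \<and> \<phi>2 (\<psi>2 w) = w" by (elim exE conjE)
  let ?U = "\<kappa> -` (V1' \<times> V2' \<times> J)" and ?U' = "{v \<in> N. G v \<in> N1' \<times> N2' \<times> J}"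
  let ?\<Psi> = "\<lambda>e. H (\<phi>1 (fst (\<kappa> e)), \<phi>2 (fst (snd (\<kappa> e))), snd (snd (\<kappa> e)))"
  let ?\<Theta> = "\<lambda>v. \<kappa>' (\<psi>1 (fst (G v)), \<psi>2 (fst (snd (G v))), snd (snd (G v)))"
  let ?Z = "\<lambda>e. Y (?\<Psi> e)"
  note Nop = max_atlasD(1)[OF y(1)] max_atlasD(1)[OF y(2)] max_atlasD(1)[OF Y]
  have U: "open ?U" by (intro open_vimage_linear \<kappa>(1) open_Times 1(3) 2(3) J)
  have U': "open ?U'" by (intro open_preimage_smooth[OF Nop(3) sm(1)] open_Times 1(4) 2(4) J)
  have sub1: "N1' \<subseteq> N1" and sub2: "N2' \<subseteq> N2" using 1(2) 2(2) by auto
  have \<kappa>U: "smooth_on ?U \<kappa>" by (rule smooth_on_linear[OF U \<kappa>(1)])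
  have GU: "smooth_on ?U' G" by (rule smooth_on_subset[OF sm(1)]) auto
  have dom: "(\<phi>1 (fst (\<kappa> e)), \<phi>2 (fst (snd (\<kappa> e))), snd (snd (\<kappa> e))) \<in> N1 \<times> N2 \<times> J"
    if "e \<in> ?U" for e
  proof -
    have "fst (\<kappa> e) \<in> V1'" "fst (snd (\<kappa> e)) \<in> V2'" "snd (snd (\<kappa> e)) \<in> J"
      using that by (auto simp: mem_Times_iff)
    then show ?thesis using 1(7) 2(7) sub1 sub2 by blast
  qed
  then have \<Psi>: "?\<Psi> e \<in> N \<and> G (?\<Psi> e) = (\<phi>1 (fst (\<kappa> e)), \<phi>2 (fst (snd (\<kappa> e))), snd (snd (\<kappa> e)))"
    if "e \<in> ?U" for e
    using H that by blast
  have Z: "(?U, ?Z) \<in> max_atlas B"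
  proof (rule max_atlas_reparametrize[OF A(3) Y U U', where \<Psi> = ?\<Psi> and \<Theta> = ?\<Theta>])
    have sm': "smooth_on ?U (\<lambda>e. (\<phi>1 (fst (\<kappa> e)), \<phi>2 (fst (snd (\<kappa> e))), snd (snd (\<kappa> e))))"
      by (intro smooth_on_Pair smooth_on_fst smooth_on_snd U \<kappa>U smooth_on_compose[OF U 1(3) _ 1(5)]
          smooth_on_compose[OF U 2(3) _ 2(5)]) auto
    have "open (N1 \<times> N2 \<times> J)" by (intro open_Times Nop J)
    then show "smooth_on ?U ?\<Psi>" by (rule smooth_on_compose[OF U _ sm' sm(2) dom])
    show "smooth_on ?U' ?\<Theta>"
      by (intro smooth_on_linear_compose[OF \<kappa>(2)] smooth_on_Pair smooth_on_fst smooth_on_snd U' GU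
          smooth_on_compose[OF U' 1(4) _ 1(6)] smooth_on_compose[OF U' 2(4) _ 2(6)]) auto
    show "?\<Psi> e \<in> ?U' \<and> ?\<Theta> (?\<Psi> e) = e" if e: "e \<in> ?U" for e
    proof -
      obtain u1 u2 r where k: "\<kappa> e = (u1, u2, r)" by (cases "\<kappa> e") auto
      have "u1 \<in> V1'" "u2 \<in> V2'" "r \<in> J" using e k by auto
      then have "?\<Theta> (?\<Psi> e) = \<kappa>' (\<kappa> e)" using \<Psi>[OF e] k 1(7) 2(7) by simp
      then show ?thesis using \<Psi>[OF e] 1(7) 2(7) e k \<kappa>(4)[of e] by simp
    qed
    show "?\<Theta> v \<in> ?U \<and> ?\<Psi> (?\<Theta> v) = v" if "v \<in> ?U'" for v
    proof -
      obtain m1 m2 r where k: "G v = (m1, m2, r)" by (cases "G v") auto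
      then show ?thesis using that 1(8) 2(8) G \<kappa>(3) by auto
    qed
  qed auto
  let ?W = "\<kappa> -` (W1 \<times> W2 \<times> UNIV)"
  have W_eq: "?W = \<kappa>' ` (W1 \<times> W2 \<times> UNIV)"
    by (auto simp: \<kappa>(3)) (metis \<kappa>(4) UNIV_I image_eqI mem_Sigma_iff)
  have sub: "subspace (W1 \<times> W2 \<times> (UNIV :: real set))"
    by (intro subspace_Times x1(2) x2(2) subspace_UNIV)
  have "subspace ?W" unfolding W_eq by (rule linear_subspace_image[OF \<kappa>(2) sub])
  moreover have "dim ?W = k1 + k2 + 1"
  proof -
    have "inj \<kappa>'" by (rule inj_on_inverseI[of _ \<kappa>]) (rule \<kappa>(3))
    from inj_on_subset[OF this subset_UNIV] have "dim ?W = dim (W1 \<times> W2 \<times> (UNIV :: real set))"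
      unfolding W_eq by (rule dim_image_eq[OF \<kappa>(2)])
    also have "\<dots> = dim W1 + (dim W2 + dim (UNIV :: real set))"
      by (simp only: dim_Times x1(2) x2(2) subspace_Times subspace_UNIV)
    finally show ?thesis using x1(3) x2(3) by simp
  qed
  moreover have "p \<in> ?Z ` ?U"
  proof -
    have m: "n1 \<in> N1'" "n2 \<in> N2'" using 1(2) 2(2) n12 x1(4) x2(4) by auto
    let ?e = "\<kappa>' (\<psi>1 n1, \<psi>2 n2, \<rho>)"
    have "?e \<in> ?U" using m 1(8) 2(8) n12(3) by (simp add: \<kappa>(3))
    moreover have "?\<Psi> ?e = H (G n)" using m 1(8) 2(8) Gn by (simp add: \<kappa>(3))
    then have "p = ?Z ?e" using G n by simp
    ultimately show ?thesis by (rule rev_image_eqI)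
  qed
  moreover have "?Z ` (?U \<inter> ?W) = S \<inter> ?Z ` ?U"
  proof -
    have "?Z e \<in> S \<longleftrightarrow> e \<in> ?W" if e: "e \<in> ?U" for e
    proof -
      obtain u1 u2 r where k: "\<kappa> e = (u1, u2, r)" by (cases "\<kappa> e") auto
      have u: "u1 \<in> V1'" "u2 \<in> V2'" using e k by auto
      then have "?Z e \<in> S \<longleftrightarrow> x1 u1 \<in> S1 \<and> x2 u2 \<in> S2"
        using mem \<Psi>[OF e] k 1(7) 2(7) by simp
      also have "\<dots> \<longleftrightarrow> u1 \<in> W1 \<and> u2 \<in> W2"
        using slice_mem_iff[OF max_atlasD(2)[OF x1(1)] x1(5)] slice_mem_iff[OF max_atlasD(2)[OF x2(1)]
          x2(5)]
          u 1(1) 2(1) by simp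
      finally show ?thesis using k by simp
    qed
    then show ?thesis by blast
  qed
  ultimately show "\<exists>(V, x)\<in>max_atlas B. \<exists>W. subspace W \<and> dim W = k1 + k2 + 1 \<and> p \<in> x ` V \<and>
      x ` (V \<inter> W) = S \<inter> x ` V"
    using Z by (intro bexI[of _ "(?U, ?Z)"]) auto
qed

lemma curve_directions_map:
  assumes h: "h \<in> curve_directions N Y n S" and N: "open N" "n \<in> N"
    and G: "smooth_on N G" "\<And>v. v \<in> N \<Longrightarrow> G v \<in> N'" "\<And>v. v \<in> N \<Longrightarrow> Y v \<in> S \<Longrightarrow> Y' (G v) \<in> S'"
    and D: "(G has_derivative D) (at n)"
  shows "D h \<in> curve_directions N' Y' (G n) S'"
proof -
  obtain g e where g: "e > 0" "smooth_on {-e<..<e} g" "g 0 = n" "\<forall>t\<in>{-e<..<e}. g t \<in> N"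
    "(g has_vector_derivative h) (at 0)" "\<forall>\<^sub>F t in nhds 0. Y (g t) \<in> S"
    using h unfolding curve_directions_def by blast
  have "((\<lambda>t. G (g t)) has_derivative (\<lambda>t. D (t *\<^sub>R h))) (at 0)"
    by (rule has_derivative_compose[OF g(5)[unfolded has_vector_derivative_def]]) (use D g(3) in simp)
  then have "((\<lambda>t. G (g t)) has_vector_derivative D h) (at 0)"
    by (simp add: has_vector_derivative_def linear_scale[OF has_derivative_linear[OF D]])
  moreover have "\<forall>\<^sub>F t in nhds 0. Y' (G (g t)) \<in> S'"
    using g(6) eventually_nhds_interval[OF g(1)] by eventually_elim (use g(4) G(3) in auto)
  moreover have "smooth_on {-e<..<e} (\<lambda>t. G (g t))"
    by (rule smooth_on_compose[OF _ N(1) g(2) G(1)]) (use g(4) in auto)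
  ultimately show ?thesis
    unfolding curve_directions_def using g(1,3,4) G(2)
      by (intro CollectI exI[of _ "\<lambda>t. G (g t)"] exI[of _ e]) auto
qed

text \<open>
  Let \<open>((ha, hp, r), (hb, hq, s), t)\<close> be the coordinates of the orbit of \<open>((a, p), (b, q))\<close>, where \<open>a\<close>
  has scale \<open>t r\<close>, \<open>p\<close> has scale \<open>t\<close>, \<open>b\<close> has scale \<open>s\<close> and \<open>q\<close> has scale \<open>1\<close>.  The orbit of \<open>(a, b)\<close>
  then has relative scale \<open>t r / s\<close> and that of \<open>(p, q)\<close> has relative scale \<open>t\<close>; \<open>s\<close> is kept as the
  remaining coordinate.
\<close>

definition split_coords where
  "split_coords = (\<lambda>((ha, hp, r), (hb, hq, s), t). ((ha, hb, t * r / s :: real), (hp, hq, t), s))"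

definition join_coords where
  "join_coords = (\<lambda>((ha, hb, c), (hp, hq, t), s). ((ha, hp, c * s / t :: real), (hb, hq, s), t))"

text \<open>
  The linear isomorphism of model spaces that permutes factors like \<open>split_coords\<close> but leaves the
  scales alone.
\<close>

definition swap_coords where
  "swap_coords = (\<lambda>((ha, hp, r), (hb, hq, s), t). ((ha, hb, r), (hp, hq, s), t))"

lemma swap_coords_inverse: "swap_coords (swap_coords v) = v"
  by (auto simp: swap_coords_def split: prod.splits)

lemma linear_swap_coords:
  "linear (swap_coords :: ('a::real_vector \<times> 'b::real_vector \<times> 'c::real_vector) \<times>
    ('d::real_vector \<times> 'e::real_vector \<times> 'f::real_vector) \<times> 'g::real_vector \<Rightarrow> _)"
  by (auto simp: linear_iff swap_coords_def)

lemma legendrian_directions_iff: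
  assumes C: "liouville_cone C" and \<sigma>: "contact_section C V \<sigma> a" and u: "u \<in> V"
  shows "tangent (quotient_atlas C) R (orbit C (\<sigma> u)) \<subseteq> hyperplane (contact_quotient C) (orbit C (\<sigma> u))
    \<longleftrightarrow> (\<forall>h\<in>curve_directions V (\<lambda>u. orbit C (\<sigma> u)) u R. a u \<bullet> h = 0)"
  unfolding hyperplane_contact_quotient[OF assms]
    tangent_eq_coord_vec_directions[OF diff_atlas_quotient[OF C] contact_section_quotient_max[OF C \<sigma>] u]
  using coord_vec_inject[OF diff_atlas_quotient[OF C] contact_section_quotient_max[OF C \<sigma>] u] by blast

text \<open>
  Section coordinates around a point of the product in which membership in the product is membership
  of the two components of \<open>split_coords\<close> in the factors.  The existential form collects what both the
  submanifold property and the Legendrian property are derived from.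
\<close>

lemma star_local_form:
  fixes Ca :: "('s, 'a::euclidean_space) cone" and Cb :: "('t, 'b::euclidean_space) cone"
    and Cp :: "('u, 'p::euclidean_space) cone" and Cq :: "('v, 'q::euclidean_space) cone"
  defines "M \<equiv> corr_cone (prod_cone Ca Cp) (prod_cone Cb Cq)"
  assumes C: "liouville_cone Ca" "liouville_cone Cb" "liouville_cone Cp" "liouville_cone Cq"
    and P: "P \<in> star Ca Cb Cp Cq R R'"
  shows "\<exists>fa fb fp fq N \<Sigma> N1 \<Sigma>1 N2 \<Sigma>2 v.
    contact_section M N \<Sigma> (product_form (\<lambda>w. - product_form fa fp w) (product_form fb fq)) \<and>
    contact_section (corr_cone Ca Cb) N1 \<Sigma>1 (product_form (\<lambda>w. - fa w) fb) \<and>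
    contact_section (corr_cone Cp Cq) N2 \<Sigma>2 (product_form (\<lambda>w. - fp w) fq) \<and>
    v \<in> N \<and> P = orbit M (\<Sigma> v) \<and> (\<forall>w\<in>N. snd (snd (fst (snd w))) > 0) \<and>
    inverse_smooth_maps N (N1 \<times> N2 \<times> {0<..}) split_coords join_coords \<and>
    (\<forall>v\<in>N. orbit M (\<Sigma> v) \<in> star Ca Cb Cp Cq R R' \<longleftrightarrow>
      orbit (corr_cone Ca Cb) (\<Sigma>1 (fst (split_coords v))) \<in> R \<and>
      orbit (corr_cone Cp Cq) (\<Sigma>2 (fst (snd (split_coords v)))) \<in> R')"
proof -
  let ?K = "corr_cone Ca Cb" and ?L = "corr_cone Cp Cq" and ?S = "star Ca Cb Cp Cq R R'"
  note K = liouville_cone_corr[OF C(1,2)]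
  have M: "liouville_cone M" unfolding M_def by (intro liouville_cone_corr liouville_cone_prod C)
  obtain a b p q where P_eq: "P = orbit M ((a, p), (b, q))" "a \<in> points (cone_atlas Ca)"
    "b \<in> points (cone_atlas Cb)"
    "p \<in> points (cone_atlas Cp)" "q \<in> points (cone_atlas Cq)"
    using P unfolding star_eq mem_preimage_iff M_def by blast
  obtain Va \<sigma>a fa ha ra where a: "contact_section Ca Va \<sigma>a fa" "ha \<in> Va" "ra > 0"
    "a = scale Ca ra (\<sigma>a ha)"
    using liouville_coneE[OF C(1) P_eq(2)] .
  obtain Vb \<sigma>b fb hb rb where b: "contact_section Cb Vb \<sigma>b fb" "hb \<in> Vb" "rb > 0"
    "b = scale Cb rb (\<sigma>b hb)"
    using liouville_coneE[OF C(2) P_eq(3)] .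
  obtain Vp \<sigma>p fp hp rp where p: "contact_section Cp Vp \<sigma>p fp" "hp \<in> Vp" "rp > 0"
    "p = scale Cp rp (\<sigma>p hp)"
    using liouville_coneE[OF C(3) P_eq(4)] .
  obtain Vq \<sigma>q fq hq rq where q: "contact_section Cq Vq \<sigma>q fq" "hq \<in> Vq" "rq > 0"
    "q = scale Cq rq (\<sigma>q hq)"
    using liouville_coneE[OF C(4) P_eq(5)] .
  define N where "N = (Va \<times> Vp \<times> {0::real<..}) \<times> (Vb \<times> Vq \<times> {0::real<..}) \<times> {0::real<..}"
  define N1 where "N1 = Va \<times> Vb \<times> {0::real<..}"
  define N2 where "N2 = Vp \<times> Vq \<times> {0::real<..}"
  define \<Sigma> where "\<Sigma> = product_section (prod_cone Ca Cp) (product_section Ca \<sigma>a \<sigma>p)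
    (product_section Cb \<sigma>b \<sigma>q)"
  define \<Sigma>1 where "\<Sigma>1 = product_section Ca \<sigma>a \<sigma>b"
  define \<Sigma>2 where "\<Sigma>2 = product_section Cp \<sigma>p \<sigma>q"
  have neg: "product_section (neg_cone A) = product_section A" for A :: "('x, 'y) cone"
    by (simp add: product_section_def fun_eq_iff)
  have s1: "contact_section ?K N1 \<Sigma>1 (product_form (\<lambda>w. - fa w) fb)"
    using contact_section_prod[OF liouville_cone_neg[OF C(1)] contact_section_neg[OF a(1)] C(2) b(1)]
    by (simp only: corr_cone_def neg N1_def \<Sigma>1_def)
  have s2: "contact_section ?L N2 \<Sigma>2 (product_form (\<lambda>w. - fp w) fq)"
    using contact_section_prod[OF liouville_cone_neg[OF C(3)] contact_section_neg[OF p(1)] C(4) q(1)]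
    by (simp only: corr_cone_def neg N2_def \<Sigma>2_def)
  have s: "contact_section M N \<Sigma> (product_form (\<lambda>w. - product_form fa fp w) (product_form fb fq))"
    using contact_section_prod[OF liouville_cone_neg[OF liouville_cone_prod[OF C(1,3)]]
        contact_section_neg[OF contact_section_prod[OF C(1) a(1) C(3) p(1)]]
        liouville_cone_prod[OF C(2,4)] contact_section_prod[OF C(2) b(1) C(4) q(1)]]
    by (simp only: M_def corr_cone_def neg N_def \<Sigma>_def)
  have N: "open N" "open (N1 \<times> N2 \<times> {0::real<..})"
    using open_section_domain[OF s] open_section_domain[OF s1] open_section_domain[OF s2]
    by (auto intro!: open_Times)
  have "smooth_on N split_coords"
    unfolding split_coords_def case_prod_unfold by (intro smooth_intros N) (auto simp: N_def)
  moreover have "smooth_on (N1 \<times> N2 \<times> {0<..}) join_coords"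
    unfolding join_coords_def case_prod_unfold by (intro smooth_intros N) (auto simp: N2_def)
  ultimately have inv: "inverse_smooth_maps N (N1 \<times> N2 \<times> {0<..}) split_coords join_coords"
    by (auto simp: inverse_smooth_maps_def N_def N1_def N2_def split_coords_def join_coords_def)
  let ?v = "((ha, hp, ra / rp), (hb, hq, rb / rq), rp / rq)"
  have "((a, p), (b, q)) = scale M rq (\<Sigma> ?v)"
    using a b p q by (simp add: M_def \<Sigma>_def product_section_def liouville_coneD(3)[OF C(1)]
        liouville_coneD(3)[OF C(2)] liouville_coneD(3)[OF C(3)])
  then have v: "?v \<in> N" "P = orbit M (\<Sigma> ?v)"
    using P_eq(1) orbit_scale[OF M q(3)] a b p q by (simp_all add: N_def)
  have mem: "orbit M (\<Sigma> v) \<in> ?S \<longleftrightarrow> orbit ?K (\<Sigma>1 (fst (split_coords v))) \<in> R \<and>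
      orbit ?L (\<Sigma>2 (fst (snd (split_coords v)))) \<in> R'" if v: "v \<in> N" for v
  proof -
    obtain ha hp r hb hq s t where v_eq: "v = ((ha, hp, r), (hb, hq, s), t)" by (metis surj_pair)
    have pos: "r > 0" "s > 0" "t > 0" and ins: "ha \<in> Va" "hp \<in> Vp" "hb \<in> Vb" "hq \<in> Vq"
      using v by (auto simp: N_def v_eq)
    let ?a = "scale Ca (t * r) (\<sigma>a ha)" and ?p = "scale Cp t (\<sigma>p hp)" and ?b = "scale Cb s (\<sigma>b hb)"
      and ?q = "\<sigma>q hq"
    have pts: "?a \<in> points (cone_atlas Ca)" "?p \<in> points (cone_atlas Cp)"
      "?b \<in> points (cone_atlas Cb)" "?q \<in> points (cone_atlas Cq)"
      using contact_section_points[OF a(1) ins(1), of "t * r"] contact_section_points[OF p(1) ins(2),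
        of t]
        contact_section_points[OF b(1) ins(3), of s] contact_section_points[OF q(1) ins(4), of 1] pos
        liouville_coneD(2)[OF C(4)] by auto
    have "\<Sigma> v = ((?a, ?p), (?b, ?q))"
      by (simp add: \<Sigma>_def v_eq product_section_def liouville_coneD(3)[OF C(1)])
    then have "orbit M (\<Sigma> v) \<in> ?S \<longleftrightarrow> orbit ?K (?a, ?b) \<in> R \<and> orbit ?L (?p, ?q) \<in> R'"
      using mem_preimage_star_iff[OF C, of ?a ?p ?b ?q R R'] pts
      unfolding mem_preimage_iff points_prod_cone M_def by simp
    moreover have "(?a, ?b) = scale ?K s (\<Sigma>1 (fst (split_coords v)))"
      using pos by (simp add: \<Sigma>1_def v_eq product_section_def split_coords_def
        liouville_coneD(3)[OF C(1)])
    then have "orbit ?K (?a, ?b) = orbit ?K (\<Sigma>1 (fst (split_coords v)))"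
      using orbit_scale[OF K pos(2)] by simp
    moreover have "(?p, ?q) = \<Sigma>2 (fst (snd (split_coords v)))"
      by (simp add: \<Sigma>2_def v_eq product_section_def split_coords_def)
    ultimately show ?thesis by simp
  qed
  have pos: "\<forall>w\<in>N. snd (snd (fst (snd w))) > 0" by (auto simp: N_def)
  have "\<forall>v\<in>N. orbit M (\<Sigma> v) \<in> ?S \<longleftrightarrow> orbit ?K (\<Sigma>1 (fst (split_coords v))) \<in> R \<and>
      orbit ?L (\<Sigma>2 (fst (snd (split_coords v)))) \<in> R'" by (intro ballI mem)
  then show ?thesis using s s1 s2 v pos inv by (intro exI conjI)
qed

text \<open>
  Let \<open>h\<close> be a direction of the product correspondence at \<open>((ha, hp, r), (hb, hq, s), t)\<close>.  The
  Legendrian conditions of the factors give \<open>- (t r / s) \<alpha>(ha') + \<beta>(hb') = 0\<close> and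
  \<open>- t \<pi>(hp') + \<kappa>(hq') = 0\<close> for the contact forms \<open>\<alpha>\<close>, \<open>\<beta>\<close>, \<open>\<pi>\<close>, \<open>\<kappa>\<close> of the four sections.  The contact
  form of the product is \<open>s\<close> times the first expression plus the second.
\<close>

lemma legendrian_correspondence_star:
  fixes Ca :: "('s, 'a::euclidean_space) cone" and Cb :: "('t, 'b::euclidean_space) cone"
    and Cp :: "('u, 'p::euclidean_space) cone" and Cq :: "('v, 'q::euclidean_space) cone"
  assumes C: "liouville_cone Ca" "liouville_cone Cb" "liouville_cone Cp" "liouville_cone Cq"
    and R: "legendrian_correspondence Ca Cb R" and R': "legendrian_correspondence Cp Cq R'"
  shows "legendrian_correspondence (prod_cone Ca Cp) (prod_cone Cb Cq) (star Ca Cb Cp Cq R R')"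
proof -
  let ?M = "corr_cone (prod_cone Ca Cp) (prod_cone Cb Cq)" and ?S = "star Ca Cb Cp Cq R R'"
  let ?K = "corr_cone Ca Cb" and ?L = "corr_cone Cp Cq"
  note K = liouville_cone_corr[OF C(1,2)] and L = liouville_cone_corr[OF C(3,4)]
  have M: "liouville_cone ?M" by (intro liouville_cone_corr liouville_cone_prod C)
  obtain k where k: "DIM('a \<times> 'b \<times> real) = 2 * k + 1" "embedded_submanifold (quotient_atlas ?K) k R"
    using R by (auto simp: legendrian_correspondence_def legendrian_def)
  obtain l where l: "DIM('p \<times> 'q \<times> real) = 2 * l + 1" "embedded_submanifold (quotient_atlas ?L) l R'"
    using R' by (auto simp: legendrian_correspondence_def legendrian_def)
  have Spts: "?S \<subseteq> points (quotient_atlas ?M)"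
    unfolding points_quotient_atlas[OF M] star_eq
      by (auto simp: mem_preimage_iff simp del: prod_cone_simps(1))
  have "embedded_submanifold (quotient_atlas ?M) (k + l + 1) ?S"
  proof (rule embedded_submanifold_local_product[OF diff_atlas_quotient[OF K] diff_atlas_quotient[OF L]
        diff_atlas_quotient[OF M] linear_swap_coords linear_swap_coords swap_coords_inverse
          swap_coords_inverse k(2) l(2) Spts])
    fix P assume "P \<in> ?S"
    from star_local_form[OF C this] obtain fa fb fp fq N \<Sigma> N1 \<Sigma>1 N2 \<Sigma>2 v where
      s: "contact_section ?M N \<Sigma> (product_form (\<lambda>w. - product_form fa fp w) (product_form fb fq))"
        "contact_section ?K N1 \<Sigma>1 (product_form (\<lambda>w. - fa w) fb)"
        "contact_section ?L N2 \<Sigma>2 (product_form (\<lambda>w. - fp w) fq)"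
      and v: "v \<in> N" "P = orbit ?M (\<Sigma> v)" "\<forall>w\<in>N. snd (snd (fst (snd w))) > 0"
      and inv: "inverse_smooth_maps N (N1 \<times> N2 \<times> {0<..}) split_coords join_coords"
      and mem: "\<forall>v\<in>N. orbit ?M (\<Sigma> v) \<in> ?S \<longleftrightarrow> orbit ?K (\<Sigma>1 (fst (split_coords v))) \<in> R \<and>
        orbit ?L (\<Sigma>2 (fst (snd (split_coords v)))) \<in> R'"
      by (elim exE conjE)
    have P: "P \<in> (\<lambda>v. orbit ?M (\<Sigma> v)) ` N" using v(1,2) by blast
    show "\<exists>N1 y1 N2 y2 J N Y G H. (N1, y1) \<in> max_atlas (quotient_atlas ?K) \<and>
      (N2, y2) \<in> max_atlas (quotient_atlas ?L) \<and>
      open (J :: real set) \<and> (N, Y) \<in> max_atlas (quotient_atlas ?M) \<and> P \<in> Y ` N \<and>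
      inverse_smooth_maps N (N1 \<times> N2 \<times> J) G H \<and>
      (\<forall>v\<in>N. Y v \<in> ?S \<longleftrightarrow> y1 (fst (G v)) \<in> R \<and> y2 (fst (snd (G v))) \<in> R')"
      by (rule exI[of _ N1], rule exI[of _ "\<lambda>w. orbit ?K (\<Sigma>1 w)"], rule exI[of _ N2],
          rule exI[of _ "\<lambda>w. orbit ?L (\<Sigma>2 w)"], rule exI[of _ "{0<..}"], rule exI[of _ N],
          rule exI[of _ "\<lambda>v. orbit ?M (\<Sigma> v)"], rule exI[of _ split_coords], rule exI[of _ join_coords])
         (intro conjI contact_section_quotient_max[OF K s(2)] contact_section_quotient_max[OF L s(3)]
           contact_section_quotient_max[OF M s(1)] P inv mem open_greaterThan)
  qed
  moreover have "DIM(('a \<times> 'p \<times> real) \<times> ('b \<times> 'q \<times> real) \<times> real) = 2 * (k + l + 1) + 1"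
    using k(1) l(1) by simp
  moreover have "tangent (quotient_atlas ?M) ?S P \<subseteq> hyperplane (contact_quotient ?M) P"
    if P: "P \<in> ?S" for P
  proof -
    from star_local_form[OF C P] obtain fa fb fp fq N \<Sigma> N1 \<Sigma>1 N2 \<Sigma>2 v where
      s: "contact_section ?M N \<Sigma> (product_form (\<lambda>w. - product_form fa fp w) (product_form fb fq))"
        "contact_section ?K N1 \<Sigma>1 (product_form (\<lambda>w. - fa w) fb)"
        "contact_section ?L N2 \<Sigma>2 (product_form (\<lambda>w. - fp w) fq)"
      and v: "v \<in> N" "P = orbit ?M (\<Sigma> v)" "\<forall>w\<in>N. snd (snd (fst (snd w))) > 0"
      and inv: "inverse_smooth_maps N (N1 \<times> N2 \<times> {0<..}) split_coords join_coords"
      and mem: "\<forall>v\<in>N. orbit ?M (\<Sigma> v) \<in> ?S \<longleftrightarrow> orbit ?K (\<Sigma>1 (fst (split_coords v))) \<in> R \<and>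
        orbit ?L (\<Sigma>2 (fst (snd (split_coords v)))) \<in> R'"
      by (elim exE conjE)
    have G: "smooth_on N split_coords" "\<And>v. v \<in> N \<Longrightarrow> split_coords v \<in> N1 \<times> N2 \<times> {0<..}"
      using inv by (auto simp: inverse_smooth_maps_def)
    note N = open_section_domain[OF s(1)]
    obtain ha hp r hb hq s' t where v_eq: "v = ((ha, hp, r), (hb, hq, s'), t)" by (metis surj_pair)
    have pos: "s' > 0" using v(1,3) by (auto simp: v_eq)
    have w: "fst (split_coords v) \<in> N1" "fst (snd (split_coords v)) \<in> N2"
      using G(2)[OF v(1)] by auto
    have in_R: "orbit ?K (\<Sigma>1 (fst (split_coords v))) \<in> R"
      "orbit ?L (\<Sigma>2 (fst (snd (split_coords v)))) \<in> R'"
      using mem v(1,2) P by auto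
    have leg: "product_form (\<lambda>w. - fa w) fb (fst (split_coords v)) \<bullet> h = 0"
      if "h \<in> curve_directions N1 (\<lambda>w. orbit ?K (\<Sigma>1 w)) (fst (split_coords v)) R" for h
      using that R in_R(1) legendrian_directions_iff[OF K s(2) w(1), of R]
      by (auto simp: legendrian_correspondence_def legendrian_def)
    have leg': "product_form (\<lambda>w. - fp w) fq (fst (snd (split_coords v))) \<bullet> h = 0"
      if "h \<in> curve_directions N2 (\<lambda>w. orbit ?L (\<Sigma>2 w)) (fst (snd (split_coords v))) R'" for h
      using that R' in_R(2) legendrian_directions_iff[OF L s(3) w(2), of R']
      by (auto simp: legendrian_correspondence_def legendrian_def)
    have "product_form (\<lambda>w. - product_form fa fp w) (product_form fb fq) v \<bullet> h = 0"
      if h: "h \<in> curve_directions N (\<lambda>v. orbit ?M (\<Sigma> v)) v ?S" for h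
    proof -
      obtain ha' hp' r' hb' hq' s'' t' where h_eq: "h = ((ha', hp', r'), (hb', hq', s''), t')"
        by (metis surj_pair)
      let ?c = "\<lambda>v::('a \<times> 'p \<times> real) \<times> ('b \<times> 'q \<times> real) \<times> real. snd (snd (fst (split_coords v)))"
      have "smooth_on N ?c" by (intro smooth_on_fst smooth_on_snd N G(1))
      then obtain Dc where Dc: "(?c has_derivative Dc) (at v)"
        using smooth_on_has_derivative[OF N _ v(1)] by blast
      have G1: "(\<lambda>v::('a \<times> 'p \<times> real) \<times> ('b \<times> 'q \<times> real) \<times> real. fst (split_coords v)) =
          (\<lambda>v. (fst (fst v), fst (fst (snd v)), ?c v))"
        by (auto simp: split_coords_def)
      have D1: "((\<lambda>v. fst (split_coords v)) has_derivative (\<lambda>h. (fst (fst h), fst (fst (snd h)), Dc h)))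
        (at v)"
        unfolding G1 by (intro has_derivative_Pair Dc) (auto intro!: derivative_eq_intros)
      have "(fst (fst h), fst (fst (snd h)), Dc h)
          \<in> curve_directions N1 (\<lambda>w. orbit ?K (\<Sigma>1 w)) (fst (split_coords v)) R"
      proof (rule curve_directions_map[OF h N v(1) smooth_on_fst[OF N G(1)] _ _ D1])
        fix w assume w: "w \<in> N"
        show "fst (split_coords w) \<in> N1" using G(2)[OF w] by auto
        show "orbit ?K (\<Sigma>1 (fst (split_coords w))) \<in> R" if "orbit ?M (\<Sigma> w) \<in> ?S"
          using mem w that by simp
      qed
      from leg[OF this] have 1: "- (t * r / s') * (fa ha \<bullet> ha') + fb hb \<bullet> hb' = 0"
        by (simp add: product_form_def split_coords_def v_eq h_eq)
      have G2: "(\<lambda>v::('a \<times> 'p \<times> real) \<times> ('b \<times> 'q \<times> real) \<times> real. fst (snd (split_coords v))) =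
          (\<lambda>v. (fst (snd (fst v)), fst (snd (fst (snd v))), snd (snd v)))"
        by (auto simp: split_coords_def)
      have D2: "((\<lambda>v. fst (snd (split_coords v))) has_derivative
          (\<lambda>h. (fst (snd (fst h)), fst (snd (fst (snd h))), snd (snd h)))) (at v)"
        unfolding G2 by (auto intro!: derivative_eq_intros)
      have "(fst (snd (fst h)), fst (snd (fst (snd h))), snd (snd h))
          \<in> curve_directions N2 (\<lambda>w. orbit ?L (\<Sigma>2 w)) (fst (snd (split_coords v))) R'"
      proof (rule curve_directions_map[OF h N v(1) smooth_on_fst[OF N smooth_on_snd[OF N G(1)]] _ _ D2])
        fix w assume w: "w \<in> N"
        show "fst (snd (split_coords w)) \<in> N2" using G(2)[OF w] by auto
        show "orbit ?L (\<Sigma>2 (fst (snd (split_coords w)))) \<in> R'" if "orbit ?M (\<Sigma> w) \<in> ?S"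
          using mem w that by simp
      qed
      from leg'[OF this] have 2: "- t * (fp hp \<bullet> hp') + fq hq \<bullet> hq' = 0"
        by (simp add: product_form_def split_coords_def v_eq h_eq)
      have "- (t * r) * (fa ha \<bullet> ha') + s' * (fb hb \<bullet> hb') = s' *
        (- (t * r / s') * (fa ha \<bullet> ha') + fb hb \<bullet> hb')"
        using pos by (simp add: field_simps)
      then have "- (t * r) * (fa ha \<bullet> ha') + s' * (fb hb \<bullet> hb') = 0" using 1 by simp
      then show ?thesis using 2 by (simp add: product_form_def v_eq h_eq algebra_simps)
    qed
    then show ?thesis using legendrian_directions_iff[OF M s(1) v(1), of ?S] v(2) by blast
  qed
  ultimately show ?thesis
    unfolding legendrian_correspondence_def legendrian_def contact_quotient_simps by blast
qed

section \<open>Composability of products\<close>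

text \<open>
  Directions of a product are pairs of directions, since two curves can be run simultaneously on
  a common interval; so decompositions in the factors add up to one in the product.
\<close>

lemma transverse_local_product:
  fixes A :: "('a, 'e::euclidean_space) atlas" and A' :: "('b, 'f::euclidean_space) atlas"
    and B :: "('c, 'g::euclidean_space) atlas" and j :: "'g \<Rightarrow> 'e \<times> 'f" and i
  assumes A: "diff_atlas A" "diff_atlas A'" "diff_atlas B"
    and j: "linear j" "linear i" "\<And>v. j (i v) = v" "\<And>v. i (j v) = v"
    and tr: "transverse A S T" "transverse A' S' T'"
    and loc: "\<And>p. p \<in> S0 \<Longrightarrow> p \<in> T0 \<Longrightarrow> \<exists>V x V' x' Y v. (V, x) \<in> max_atlas A \<and> (V', x') \<in> max_atlas A' \<and>
      (j -` (V \<times> V'), Y) \<in> max_atlas B \<and> j v \<in> V \<times> V' \<and> p = Y v \<and>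
      (\<forall>u\<in>V. \<forall>u'\<in>V'. (Y (i (u, u')) \<in> S0 \<longleftrightarrow> x u \<in> S \<and> x' u' \<in> S') \<and>
         (Y (i (u, u')) \<in> T0 \<longleftrightarrow> x u \<in> T \<and> x' u' \<in> T'))"
  shows "transverse B S0 T0"
  unfolding transverse_def
proof
  fix p assume p: "p \<in> S0 \<inter> T0"
  from loc[OF IntD1[OF p] IntD2[OF p]] obtain V x V' x' Y v
    where x: "(V, x) \<in> max_atlas A" and x': "(V', x') \<in> max_atlas A'"
    and Y: "(j -` (V \<times> V'), Y) \<in> max_atlas B" and v: "j v \<in> V \<times> V'" "p = Y v"
    and mem: "\<forall>u\<in>V. \<forall>u'\<in>V'. (Y (i (u, u')) \<in> S0 \<longleftrightarrow> x u \<in> S \<and> x' u' \<in> S') \<and>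
         (Y (i (u, u')) \<in> T0 \<longleftrightarrow> x u \<in> T \<and> x' u' \<in> T')"
    by (elim exE conjE)
  obtain u u' where uu: "j v = (u, u')" "u \<in> V" "u' \<in> V'" using v(1) by (cases "j v") auto
  have v_eq: "v = i (u, u')" using j(4)[of v] uu(1) by simp
  have dirs: "i (h, h') \<in> curve_directions (j -` (V \<times> V')) Y v P0"
    if h: "h \<in> curve_directions V x u P" "h' \<in> curve_directions V' x' u' P'"
      and P: "\<forall>u\<in>V. \<forall>u'\<in>V'. Y (i (u, u')) \<in> P0 \<longleftrightarrow> x u \<in> P \<and> x' u' \<in> P'" for h h' P P' P0
  proof -
    obtain g e where g: "e > 0" "smooth_on {-e<..<e} g" "g 0 = u" "\<forall>t\<in>{-e<..<e}. g t \<in> V"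
      "(g has_vector_derivative h) (at 0)" "\<forall>\<^sub>F t in nhds 0. x (g t) \<in> P"
      using h(1) unfolding curve_directions_def by blast
    obtain g' e' where g': "e' > 0" "smooth_on {-e'<..<e'} g'" "g' 0 = u'" "\<forall>t\<in>{-e'<..<e'}. g' t \<in> V'"
      "(g' has_vector_derivative h') (at 0)" "\<forall>\<^sub>F t in nhds 0. x' (g' t) \<in> P'"
      using h(2) unfolding curve_directions_def by blast
    let ?d = "min e e'" and ?c = "\<lambda>t. i (g t, g' t)"
    have d: "?d > 0" using g(1) g'(1) by simp
    have sub: "{-?d<..<?d} \<subseteq> {-e<..<e}" "{-?d<..<?d} \<subseteq> {-e'<..<e'}" by auto
    have "smooth_on {-?d<..<?d} ?c"
      by (intro smooth_on_linear_compose[OF j(2)] smooth_on_Pair smooth_on_subset[OF g(2) sub(1)]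
          smooth_on_subset[OF g'(2) sub(2)] open_greaterThanLessThan)
    moreover have "?c 0 = v" using g(3) g'(3) v_eq by simp
    moreover have "\<forall>t\<in>{-?d<..<?d}. ?c t \<in> j -` (V \<times> V')"
      using g(4) g'(4) sub j(3) by auto
    moreover have "(?c has_vector_derivative i (h, h')) (at 0)"
      using bounded_linear.has_vector_derivative[OF _ has_vector_derivative_Pair[OF g(5) g'(5)]] j(2)
      by (simp add: linear_conv_bounded_linear)
    moreover have "\<forall>\<^sub>F t in nhds 0. Y (?c t) \<in> P0"
      using g(6) g'(6) eventually_nhds_interval[OF d]
    proof eventually_elim
      case (elim t)
      then have "g t \<in> V" "g' t \<in> V'" using g(4) g'(4) sub by blast+
      then show ?case using P elim(1,2) by blast
    qed
    ultimately show ?thesis using d unfolding curve_directions_def by blast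
  qed
  have pST: "x u \<in> S \<inter> T" "x' u' \<in> S' \<inter> T'"
    using mem p v_eq v(2) uu(2,3) by auto
  have 1: "\<forall>k. \<exists>h1\<in>curve_directions V x u S. \<exists>h2\<in>curve_directions V x u T. k = h1 + h2"
    using tr(1) pST(1) unfolding transverse_def transverse_at_iff[OF A(1) x uu(2), symmetric]
      by (rule bspec)
  have 2: "\<forall>k. \<exists>h1\<in>curve_directions V' x' u' S'. \<exists>h2\<in>curve_directions V' x' u' T'. k = h1 + h2"
    using tr(2) pST(2) unfolding transverse_def transverse_at_iff[OF A(2) x' uu(3), symmetric]
      by (rule bspec)
  have "\<exists>h1\<in>curve_directions (j -` (V \<times> V')) Y v S0. \<exists>h2\<in>curve_directions (j -` (V \<times> V')) Y v T0. h = h1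
    + h2" for h
  proof -
    obtain k1 k2 where k: "k1 \<in> curve_directions V x u S" "k2 \<in> curve_directions V x u T"
      "fst (j h) = k1 + k2"
      using 1 by blast
    obtain l1 l2 where l: "l1 \<in> curve_directions V' x' u' S'" "l2 \<in> curve_directions V' x' u' T'"
      "snd (j h) = l1 + l2"
      using 2 by blast
    have "h = i (fst (j h), snd (j h))" using j(4) by simp
    also have "\<dots> = i ((k1, l1) + (k2, l2))" by (simp add: k(3) l(3))
    also have "\<dots> = i (k1, l1) + i (k2, l2)" by (rule linear_add[OF j(2)])
    finally have "h = i (k1, l1) + i (k2, l2)" .
    moreover have "i (k1, l1) \<in> curve_directions (j -` (V \<times> V')) Y v S0"
      by (rule dirs[OF k(1) l(1)]) (use mem in blast)
    moreover have "i (k2, l2) \<in> curve_directions (j -` (V \<times> V')) Y v T0"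
      by (rule dirs[OF k(2) l(2)]) (use mem in blast)
    ultimately show ?thesis by blast
  qed
  then show "\<forall>w\<in>tangent_space B p. \<exists>v1\<in>tangent B S0 p. \<exists>v2\<in>tangent B T0 p. w = (\<lambda>f. v1 f + v2 f)"
    using transverse_at_iff[OF A(3) Y, of v S0 T0] v by simp
qed

text \<open>
  From the order of factors in which the two product correspondences are listed to the order in which
  the correspondences of each of the two factors stand together.
\<close>

definition regroup where
  "regroup = (\<lambda>(((a, p), (b, q)), ((b', q'), (c, r))). (((a, b), (b', c)), ((p, q), (q', r))))"

definition ungroup where
  "ungroup = (\<lambda>(((a, b), (b', c)), ((p, q), (q', r))). (((a, p), (b, q)), ((b', q'), (c, r))))"

lemma regroup_inverse: "regroup (ungroup v) = v" "ungroup (regroup w) = w"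
  by (auto simp: regroup_def ungroup_def split: prod.splits)

lemma linear_map_prod: "linear f \<Longrightarrow> linear g \<Longrightarrow> linear (map_prod f g)"
  by (auto simp: linear_iff)

lemma linear_regroup:
  "linear (regroup :: ((('a::real_vector \<times> 'p::real_vector) \<times> ('b::real_vector \<times> 'q::real_vector)) \<times>
     (('c::real_vector \<times> 'r::real_vector) \<times> ('d::real_vector \<times> 's::real_vector))) \<Rightarrow> _)"
  "linear (ungroup :: ((('a::real_vector \<times> 'p::real_vector) \<times> ('b::real_vector \<times> 'q::real_vector)) \<times>
     (('c::real_vector \<times> 'r::real_vector) \<times> ('d::real_vector \<times> 's::real_vector))) \<Rightarrow> _)"
  by (auto simp: linear_iff regroup_def ungroup_def)

definition split_model where
  "split_model = regroup \<circ> map_prod (map_prod interleave interleave) (map_prod interleave interleave)"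

definition join_model where
  "join_model = map_prod (map_prod deinterleave deinterleave) (map_prod deinterleave deinterleave) \<circ>
    ungroup"

lemma split_model_inverse: "split_model (join_model v) = v" "join_model (split_model w) = w"
proof -
  show "split_model (join_model v) = v"
    by (simp add: split_model_def join_model_def map_prod.compositionality o_def interleave_inverse
        map_prod.identity[unfolded id_def] regroup_inverse map_prod.comp[unfolded comp_def])
  show "join_model (split_model w) = w"
    by (simp add: split_model_def join_model_def regroup_inverse map_prod.compositionality o_def
      interleave_inverse
        map_prod.identity[unfolded id_def])
qed

lemma linear_split_model:
  "linear (split_model :: (((('a::real_vector \<times> 'p::real_vector \<times> real) \<times> real) \<times>
    (('b::real_vector \<times> 'q::real_vector \<times> real) \<times> real)) \<times>
     ((('c::real_vector \<times> 'r::real_vector \<times> real) \<times> real) \<times>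
       (('d::real_vector \<times> 's::real_vector \<times> real) \<times> real))) \<Rightarrow> _)"
  unfolding split_model_def by (intro linear_compose linear_map_prod linear_interleave linear_regroup)

lemma linear_join_model:
  "linear (join_model :: _ \<Rightarrow>
    (((('a::real_vector \<times> 'p::real_vector \<times> real) \<times> real) \<times>
    (('b::real_vector \<times> 'q::real_vector \<times> real) \<times> real)) \<times>
     ((('c::real_vector \<times> 'r::real_vector \<times> real) \<times> real) \<times>
       (('d::real_vector \<times> 's::real_vector \<times> real) \<times> real))))"
  unfolding join_model_def by (intro linear_compose linear_map_prod linear_interleave linear_regroup)

abbreviation middle_diagonal ::
  "('s, 'h::euclidean_space) cone \<Rightarrow> ('t, 'k::euclidean_space) cone \<Rightarrow> ('u, 'l::euclidean_space) cone \<Rightarrow>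
   (('s \<times> 't) \<times> ('t \<times> 'u)) set" where
  "middle_diagonal C1 C2 C3 \<equiv> {((b1, b2), (b2, b3)) | b1 b2 b3.
     b1 \<in> points (cone_atlas C1) \<and> b2 \<in> points (cone_atlas C2) \<and> b3 \<in> points (cone_atlas C3)}"

lemma composable_star:
  fixes Ca :: "('s1, 'a::euclidean_space) cone" and Cb :: "('s2, 'b::euclidean_space) cone"
    and Cc :: "('s3, 'c::euclidean_space) cone" and Cp :: "('s4, 'p::euclidean_space) cone"
    and Cq :: "('s5, 'q::euclidean_space) cone" and Cr :: "('s6, 'r::euclidean_space) cone"
  assumes C: "liouville_cone Ca" "liouville_cone Cb" "liouville_cone Cc"
    and D: "liouville_cone Cp" "liouville_cone Cq" "liouville_cone Cr"
    and comp: "composable Ca Cb Cc R S" "composable Cp Cq Cr R' S'"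
  shows "composable (prod_cone Ca Cp) (prod_cone Cb Cq) (prod_cone Cc Cr) (star Ca Cb Cp Cq R R')
    (star Cb Cc Cq Cr S S')"
proof -
  note dC = liouville_coneD(1)[OF C(1)] liouville_coneD(1)[OF C(2)] liouville_coneD(1)[OF C(3)]
  note dD = liouville_coneD(1)[OF D(1)] liouville_coneD(1)[OF D(2)] liouville_coneD(1)[OF D(3)]
  note dP = diff_atlas_prod_cone[OF dC(1) dD(1)] diff_atlas_prod_cone[OF dC(2)
    dD(2)] diff_atlas_prod_cone[OF dC(3) dD(3)]
  let ?A = "prod_atlas (prod_atlas (cone_atlas Ca) (cone_atlas Cb))
    (prod_atlas (cone_atlas Cb) (cone_atlas Cc))"
  let ?A' = "prod_atlas (prod_atlas (cone_atlas Cp) (cone_atlas Cq))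
    (prod_atlas (cone_atlas Cq) (cone_atlas Cr))"
  let ?B = "prod_atlas (prod_atlas (cone_atlas (prod_cone Ca Cp)) (cone_atlas (prod_cone Cb Cq)))
      (prod_atlas (cone_atlas (prod_cone Cb Cq)) (cone_atlas (prod_cone Cc Cr)))"
  show ?thesis
    unfolding composable_def
  proof (rule transverse_local_product[OF _ _ _ linear_split_model linear_join_model split_model_inverse
        comp(1)[unfolded composable_def] comp(2)[unfolded composable_def]])
    show "diff_atlas ?A" "diff_atlas ?A'" "diff_atlas ?B" by (intro diff_atlas_prod dC dD dP)+
    fix w
    assume "w \<in> middle_diagonal (prod_cone Ca Cp) (prod_cone Cb Cq) (prod_cone Cc Cr)"
    then obtain a p b q c r where w: "w = (((a, p), (b, q)), ((b, q), (c, r)))"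
      "a \<in> points (cone_atlas Ca)" "p \<in> points (cone_atlas Cp)" "b \<in> points (cone_atlas Cb)"
      "q \<in> points (cone_atlas Cq)" "c \<in> points (cone_atlas Cc)" "r \<in> points (cone_atlas Cr)"
      unfolding points_prod_cone by auto
    have ex: "\<exists>V x u. (V, x) \<in> max_atlas A \<and> u \<in> V \<and> s = x u" if A: "diff_atlas A" "s \<in> points A"
      for A :: "('x, 'y::euclidean_space) atlas" and s
    proof -
      obtain V x u where "(V, x) \<in> A" "u \<in> V" "s = x u" by (rule pointsE[OF A(2)])
      then show ?thesis using subsetD[OF atlas_subset_max_atlas[OF A(1)]] by (intro exI conjI)
    qed
    \<comment> \<open>The point lies on the diagonal, so one chart serves both copies of \<open>Cb\<close>, and one those of \<open>Cq\<close>.\<close>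
    obtain Va xa ua where a: "(Va, xa) \<in> max_atlas (cone_atlas Ca)" "ua \<in> Va" "a = xa ua"
      using ex[OF dC(1) w(2)] by blast
    obtain Vp xp up where p: "(Vp, xp) \<in> max_atlas (cone_atlas Cp)" "up \<in> Vp" "p = xp up"
      using ex[OF dD(1) w(3)] by blast
    obtain Vb xb ub where b: "(Vb, xb) \<in> max_atlas (cone_atlas Cb)" "ub \<in> Vb" "b = xb ub"
      using ex[OF dC(2) w(4)] by blast
    obtain Vq xq uq where q: "(Vq, xq) \<in> max_atlas (cone_atlas Cq)" "uq \<in> Vq" "q = xq uq"
      using ex[OF dD(2) w(5)] by blast
    obtain Vc xc uc where c: "(Vc, xc) \<in> max_atlas (cone_atlas Cc)" "uc \<in> Vc" "c = xc uc"
      using ex[OF dC(3) w(6)] by blast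
    obtain Vr xr ur where r: "(Vr, xr) \<in> max_atlas (cone_atlas Cr)" "ur \<in> Vr" "r = xr ur"
      using ex[OF dD(3) w(7)] by blast
    let ?V = "(Va \<times> Vb) \<times> (Vb \<times> Vc)" and ?V' = "(Vp \<times> Vq) \<times> (Vq \<times> Vr)"
    let ?x = "map_prod (map_prod xa xb) (map_prod xb xc)" and ?x'
      = "map_prod (map_prod xp xq) (map_prod xq xr)"
    let ?ya = "map_prod xa xp \<circ> interleave" and ?yb = "map_prod xb xq \<circ> interleave" and ?yc
      = "map_prod xc xr \<circ> interleave"
    let ?Y = "map_prod (map_prod ?ya ?yb) (map_prod ?yb ?yc)"
    let ?v = "join_model ((((ua, ub), (ub, uc)), ((up, uq), (uq, ur))))"
    have Y_join: "?Y (join_model (u, u')) = ungroup (?x u, ?x' u')" for u u'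
    proof -
      obtain h1 h2 h3 h4 where u: "u = ((h1, h2), (h3, h4))" by (metis surj_pair)
      obtain k1 k2 k3 k4 where u': "u' = ((k1, k2), (k3, k4))" by (metis surj_pair)
      show ?thesis unfolding u u' by (simp add: join_model_def ungroup_def interleave_inverse)
    qed
    have x: "(?V, ?x) \<in> max_atlas ?A" "(?V', ?x') \<in> max_atlas ?A'"
      by (intro max_atlas_prod diff_atlas_prod dC dD a(1) b(1) c(1) p(1) q(1) r(1))+
    have "split_model -` (?V \<times> ?V') = ((interleave -` (Va \<times> Vp)) \<times> (interleave -` (Vb \<times> Vq))) \<times>
        ((interleave -` (Vb \<times> Vq)) \<times> (interleave -` (Vc \<times> Vr)))"
      by (auto simp: split_model_def regroup_def split: prod.splits)
    then have Y: "(split_model -` (?V \<times> ?V'), ?Y) \<in> max_atlas ?B"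
      by (simp only:) (intro max_atlas_prod diff_atlas_prod dP max_atlas_prod_cone dC dD a(1) b(1) c(1)
        p(1) q(1) r(1))
    have v: "split_model ?v \<in> ?V \<times> ?V'" "w = ?Y ?v"
      unfolding split_model_inverse(1) Y_join using a b c p q r w(1) by (auto simp: ungroup_def)
    have mem: "(?Y (join_model (u, u')) \<in>
      preimage (prod_cone Ca Cp) (prod_cone Cb Cq) (star Ca Cb Cp Cq R R') \<times>
          preimage (prod_cone Cb Cq) (prod_cone Cc Cr) (star Cb Cc Cq Cr S S') \<longleftrightarrow>
        ?x u \<in> preimage Ca Cb R \<times> preimage Cb Cc S \<and> ?x' u' \<in> preimage Cp Cq R' \<times> preimage Cq Cr S') \<and>
      (?Y (join_model (u, u')) \<in> middle_diagonal (prod_cone Ca Cp) (prod_cone Cb Cq) (prod_cone Cc Cr) \<longleftrightarrow>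
        ?x u \<in> middle_diagonal Ca Cb Cc \<and>
        ?x' u' \<in> middle_diagonal Cp Cq Cr)" for u u'
    proof -
      obtain a1 b1 b2 c1 where 1: "?x u = ((a1, b1), (b2, c1))" by (metis surj_pair)
      obtain p1 q1 q2 r1 where 2: "?x' u' = ((p1, q1), (q2, r1))" by (metis surj_pair)
      show ?thesis
        unfolding Y_join 1 2 points_prod_cone
        by (auto simp: ungroup_def mem_preimage_star_iff[OF C(1,2) D(1,2)]
          mem_preimage_star_iff[OF C(2,3) D(2,3)])
    qed
    show "\<exists>V x V' x' Y v. (V, x) \<in> max_atlas ?A \<and> (V', x') \<in> max_atlas ?A' \<and>
      (split_model -` (V \<times> V'), Y) \<in> max_atlas ?B \<and> split_model v \<in> V \<times> V' \<and> w = Y v \<and>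
      (\<forall>u\<in>V. \<forall>u'\<in>V'. (Y (join_model (u, u')) \<in> preimage (prod_cone Ca Cp) (prod_cone Cb Cq)
        (star Ca Cb Cp Cq R R') \<times>
          preimage (prod_cone Cb Cq) (prod_cone Cc Cr) (star Cb Cc Cq Cr S S') \<longleftrightarrow>
        x u \<in> preimage Ca Cb R \<times> preimage Cb Cc S \<and> x' u' \<in> preimage Cp Cq R' \<times> preimage Cq Cr S') \<and>
      (Y (join_model (u, u')) \<in> middle_diagonal (prod_cone Ca Cp) (prod_cone Cb Cq) (prod_cone Cc Cr) \<longleftrightarrow>
        x u \<in> middle_diagonal Ca Cb Cc \<and>
        x' u' \<in> middle_diagonal Cp Cq Cr))"
      by (rule exI[of _ ?V], rule exI[of _ ?x], rule exI[of _ ?V'], rule exI[of _ ?x'],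
        rule exI[of _ ?Y], rule exI[of _ ?v])
         (intro conjI ballI x Y v mem[THEN conjunct1] mem[THEN conjunct2])
  qed
qed

section \<open>The contact product is a bifunctor\<close>

theorem proposition1p13:
  fixes Qa :: "('a, 'ea::euclidean_space) contact"
    and Qb :: "('b, 'eb::euclidean_space) contact"
    and Qc :: "('c, 'ec::euclidean_space) contact"
    and Q\<alpha> :: "('p, 'ep::euclidean_space) contact"
    and Q\<beta> :: "('q, 'eq::euclidean_space) contact"
    and Q\<gamma> :: "('r, 'er::euclidean_space) contact"
  assumes "contact_manifold Qa" "contact_manifold Qb" "contact_manifold Qc"
    and "contact_manifold Q\<alpha>" "contact_manifold Q\<beta>" "contact_manifold Q\<gamma>"
    and "legendrian_correspondence (symplectization Qa) (symplectization Qb) Rab"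
    and "legendrian_correspondence (symplectization Qb) (symplectization Qc) Rbc"
    and "legendrian_correspondence (symplectization Q\<alpha>) (symplectization Q\<beta>) R\<alpha>\<beta>"
    and "legendrian_correspondence (symplectization Q\<beta>) (symplectization Q\<gamma>) R\<beta>\<gamma>"
    and "composable (symplectization Qa) (symplectization Qb) (symplectization Qc) Rab Rbc"
    and "composable (symplectization Q\<alpha>) (symplectization Q\<beta>) (symplectization Q\<gamma>) R\<alpha>\<beta> R\<beta>\<gamma>"
  shows "contact_manifold (contact_product Qa Q\<alpha>) \<and>
    contact_manifold (contact_product Qb Q\<beta>) \<and>
    contact_manifold (contact_product Qc Q\<gamma>) \<and>
    legendrian_correspondence (prod_cone (symplectization Qa) (symplectization Q\<alpha>)) (prod_cone (symplectization Qb) (symplectization Q\<beta>))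
      (star (symplectization Qa) (symplectization Qb) (symplectization Q\<alpha>) (symplectization Q\<beta>) Rab R\<alpha>\<beta>) \<and>
    legendrian_correspondence (prod_cone (symplectization Qb) (symplectization Q\<beta>)) (prod_cone (symplectization Qc) (symplectization Q\<gamma>))
      (star (symplectization Qb) (symplectization Qc) (symplectization Q\<beta>) (symplectization Q\<gamma>) Rbc R\<beta>\<gamma>) \<and>
    composable (prod_cone (symplectization Qa) (symplectization Q\<alpha>)) (prod_cone (symplectization Qb) (symplectization Q\<beta>)) (prod_cone (symplectization Qc) (symplectization Q\<gamma>))
      (star (symplectization Qa) (symplectization Qb) (symplectization Q\<alpha>) (symplectization Q\<beta>) Rab R\<alpha>\<beta>)
      (star (symplectization Qb) (symplectization Qc) (symplectization Q\<beta>) (symplectization Q\<gamma>) Rbc R\<beta>\<gamma>) \<and>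
    comp_corr (prod_cone (symplectization Qa) (symplectization Q\<alpha>)) (prod_cone (symplectization Qb) (symplectization Q\<beta>)) (prod_cone (symplectization Qc) (symplectization Q\<gamma>))
      (star (symplectization Qa) (symplectization Qb) (symplectization Q\<alpha>) (symplectization Q\<beta>) Rab R\<alpha>\<beta>)
      (star (symplectization Qb) (symplectization Qc) (symplectization Q\<beta>) (symplectization Q\<gamma>) Rbc R\<beta>\<gamma>)
    = star (symplectization Qa) (symplectization Qc) (symplectization Q\<alpha>) (symplectization Q\<gamma>)
        (comp_corr (symplectization Qa) (symplectization Qb) (symplectization Qc) Rab Rbc)
        (comp_corr (symplectization Q\<alpha>) (symplectization Q\<beta>) (symplectization Q\<gamma>) R\<alpha>\<beta> R\<beta>\<gamma>)"
  by (intro conjI contact_manifold_contact_product legendrian_correspondence_star composable_star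
      comp_corr_star liouville_cone_symplectization assms)

end
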